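(* Let $k \ge 3$ and $d>1$ be integers, and let $h_1,\ldots,h_s \in \mathbb{Z}[t]$ be polynomials of degree $d$, each irreducible in $\mathbb{Q}[t]$, pairwise relatively prime in $\mathbb{Q}[t]$ and having no integer roots; if $k$ is even, assume the leading coefficients of $h_1,\ldots,h_s$ do not all have the same sign. Assume $s \ge 2^k+1$ or $s \ge 2k^2-2$. Then $T^{-1}\sum_{t\le T}(\mathfrak{G}(t)-\mathfrak{G})^2$ converges, as $T\to\infty$, to a positive real number.
   Context: $e(x)=\exp(2\pi i x)$; $S(q,a)=\sum_{m=1}^q e(am^k/q)$; $\mathfrak{G}(t)=\sum_{q=1}^\infty q^{-s}\sum_{1\le a\le q,\,(a,q)=1}\prod_{i=1}^s S(q,ah_i(t))$; $\mathfrak{G}=\sum_{q=1}^\infty q^{-1-s}\sum_{t=1}^q\sum_{1\le a\le q,\,(a,q)=1}\prod_{i=1}^s S(q,ah_i(t))$. *)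

theory Defs
  imports Complex_Main "HOL-Computational_Algebra.Polynomial"
begin

definition expo :: "real \<Rightarrow> complex" where
  "expo x = exp (2 * of_real pi * \<i> * of_real x)"

definition gauss_S :: "nat \<Rightarrow> nat \<Rightarrow> int \<Rightarrow> complex" where
  "gauss_S k q a = (\<Sum>m=1..q. expo (of_int (a * int m ^ k) / of_nat q))"

definition coprime_sum :: "nat \<Rightarrow> nat \<Rightarrow> (nat \<Rightarrow> int poly) \<Rightarrow> int \<Rightarrow> nat \<Rightarrow> complex" where
  "coprime_sum k s h t q =
     (\<Sum>a\<in>{a\<in>{1..q}. coprime a q}. \<Prod>i=1..s. gauss_S k q (int a * poly (h i) t))"

definition singular_series_term :: "nat \<Rightarrow> nat \<Rightarrow> (nat \<Rightarrow> int poly) \<Rightarrow> int \<Rightarrow> nat \<Rightarrow> complex" where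
  "singular_series_term k s h t q = coprime_sum k s h t q / of_nat q ^ s"

definition mean_series_term :: "nat \<Rightarrow> nat \<Rightarrow> (nat \<Rightarrow> int poly) \<Rightarrow> nat \<Rightarrow> complex" where
  "mean_series_term k s h q = (\<Sum>t=1..int q. coprime_sum k s h t q) / of_nat q ^ (1 + s)"

text \<open>
  Both series run over \<open>q \<ge> 1\<close>, hence the shift by \<open>Suc\<close>. They are complex valued; that their
  sums are real (pair \<open>a\<close> with \<open>-a\<close>) is not built in.
\<close>

definition singular_series :: "nat \<Rightarrow> nat \<Rightarrow> (nat \<Rightarrow> int poly) \<Rightarrow> int \<Rightarrow> complex" where
  "singular_series k s h t = (\<Sum>n. singular_series_term k s h t (Suc n))"

definition mean_series :: "nat \<Rightarrow> nat \<Rightarrow> (nat \<Rightarrow> int poly) \<Rightarrow> complex" where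
  "mean_series k s h = (\<Sum>n. mean_series_term k s h (Suc n))"

end

theory Submission
  imports Defs "HOL-Analysis.Analysis" "HOL-Number_Theory.Number_Theory"
    "HOL-Computational_Algebra.Field_as_Ring" "HOL-Computational_Algebra.Polynomial_Factorial"
begin

text \<open>
  The normalised terms \<open>A(q,t) = q\<^sup>-\<^sup>s \<Sum>\<^sub>a \<Prod>\<^sub>i S(q, a h\<^sub>i(t))\<close> are multiplicative in \<open>q\<close> and depend only on \<open>t\<close> modulo
  \<open>q\<close>. Since \<open>\<bar>S(q,b)\<bar>\<^sup>k\<close> is at most a constant times \<open>q\<^sup>k\<^sup>-\<^sup>1 gcd(b,q)\<close>, and the numbers \<open>h\<^sub>i(t)\<close> have pairwise
  bounded greatest common divisors, \<open>A(q,t)\<close> is bounded by a multiple of \<open>q\<^sup>-\<^sup>5\<^sup>/\<^sup>3\<close> uniformly in \<open>t\<close>. Hence the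
  singular series is a uniform limit of periodic functions of \<open>t\<close>, so the mean square exists, and it is
  positive unless the singular series is constant.

  The singular series is a product of \<open>p\<close>-adic densities. They do not vanish, because diagonal forms
  of degree \<open>k\<close> in this many variables have non-singular \<open>p\<close>-adic zeros (Davenport and Lewis). For a
  suitable prime \<open>p\<close>, the density at \<open>p\<close> for an argument where \<open>p\<close> divides \<open>h\<^sub>1(t)\<close> exactly once differs
  from the one where \<open>p\<close> divides it exactly \<open>k + 1\<close> times. By the Chinese remainder theorem an
  argument can imitate the second one at \<open>p\<close> and the first one at all other primes, so the
  singular series is not constant.
\<close>

subsection \<open>Sums over residue classes\<close>

text \<open>The exponent 5/3 comes from \<open>s \<ge> 3 * k\<close>: a product of \<open>s\<close>
  Gauss sums is O(q^(s - s/k + 1/k)), the sum over \<open>a\<close> costs one more factor q, and s/k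
  - 1/k - 1 \<ge> 5/3. Solubility of diagonal forms is proved here, not quoted. Replacing x_i by p^f
  x_i makes only the valuations of the coefficients modulo \<open>k\<close> matter, and a rotation
  of these classes puts at least s/k coefficients on the lowest level. General zero-sum and growth
  arguments then fall short for \<open>k = 3\<close> and, at p = 2, for powers of 2, which get
  arguments of their own. Nonvanishing is needed twice. If D and D' are the densities at
  \<open>p\<close> for exact powers 1 and k + 1, then D' - D = (p - 1) p^(k - s) D, so they differ
  because D is not zero; and the contribution of the other primes must be nonzero for the difference
  to show in the product. The powers 1 and k + 1 are chosen congruent modulo \<open>k\<close>:
  beyond p^k, the terms of D' are multiples of terms of a density of the first kind.\<close>

definition periodic :: "int \<Rightarrow> (int \<Rightarrow> 'a) \<Rightarrow> bool" where
  "periodic q f \<longleftrightarrow> (\<forall>x y. [x = y] (mod q) \<longrightarrow> f x = f y)"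

lemma periodicD: "periodic q f \<Longrightarrow> [x = y] (mod q) \<Longrightarrow> f x = f y"
  unfolding periodic_def by blast

lemma periodicI: "(\<And>x y. [x = y] (mod q) \<Longrightarrow> f x = f y) \<Longrightarrow> periodic q f"
  unfolding periodic_def by blast

lemma periodic_mod: "periodic q f \<Longrightarrow> f (x mod q) = f x"
  by (rule periodicD) (auto simp: cong_def)

lemma sum_residues_affine:
  fixes f :: "int \<Rightarrow> 'a::comm_monoid_add"
  assumes "periodic q f" "q > 0" "coprime u q"
  shows "(\<Sum>x\<in>{0..<q}. f (u * x + v)) = (\<Sum>x\<in>{0..<q}. f x)"
proof -
  let ?g = "\<lambda>x. (u * x + v) mod q"
  have inj: "inj_on ?g {0..<q}"
  proof (rule inj_onI)
    fix x y assume xy: "x \<in> {0..<q}" "y \<in> {0..<q}" and "?g x = ?g y"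
    then have "[u * x + v = u * y + v] (mod q)" by (simp add: cong_def)
    then have "[u * x = u * y] (mod q)" by (simp add: cong_add_rcancel)
    then have "[x = y] (mod q)" using assms(3) by (simp add: cong_mult_lcancel)
    then show "x = y" using xy by (simp add: cong_def)
  qed
  have sub: "?g ` {0..<q} \<subseteq> {0..<q}" using assms(2) by (intro image_subsetI) simp
  have img: "?g ` {0..<q} = {0..<q}"
    by (rule endo_inj_surj[OF _ sub inj]) simp
  have "(\<Sum>x\<in>{0..<q}. f (u * x + v)) = (\<Sum>x\<in>{0..<q}. f (?g x))"
    by (simp add: periodic_mod[OF assms(1)])
  also have "\<dots> = (\<Sum>x\<in>?g ` {0..<q}. f x)"
    by (simp add: sum.reindex[OF inj] o_def)
  finally show ?thesis by (simp add: img)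
qed

lemma sum_residues_cong:
  fixes f :: "int \<Rightarrow> 'a::comm_monoid_add"
  assumes "periodic q f" "q > 0"
  shows "(\<Sum>x\<in>{1..q}. f x) = (\<Sum>x\<in>{0..<q}. f x)"
proof -
  have "(\<Sum>x\<in>{0..<q}. f (1 * x + 1)) = (\<Sum>x\<in>{0..<q}. f x)"
    by (rule sum_residues_affine) (use assms in auto)
  moreover have "(\<Sum>x\<in>{0..<q}. f (1 * x + 1)) = (\<Sum>x\<in>{1..q}. f x)"
    by (rule sum.reindex_bij_witness[of _ "\<lambda>x. x - 1" "\<lambda>x. x + 1"]) (auto simp: add.commute)
  ultimately show ?thesis by simp
qed

lemma sum_residues_mult:
  fixes f :: "int \<Rightarrow> 'a::comm_monoid_add"
  assumes "q > 0" "r > 0"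
  shows "(\<Sum>x\<in>{0..<q*r}. f x) = (\<Sum>u\<in>{0..<q}. \<Sum>v\<in>{0..<r}. f (u + q * v))"
proof -
  have "(\<Sum>u\<in>{0..<q}. \<Sum>v\<in>{0..<r}. f (u + q * v)) = (\<Sum>(u,v)\<in>{0..<q}\<times>{0..<r}. f (u + q * v))"
    by (simp add: sum.cartesian_product)
  also have "\<dots> = (\<Sum>x\<in>{0..<q*r}. f x)"
  proof (rule sum.reindex_bij_witness[of _ "\<lambda>x. (x mod q, x div q)" "\<lambda>(u,v). u + q * v"])
    fix a assume "a \<in> {0..<q} \<times> {0..<r}"
    then obtain u v where a: "a = (u,v)" "0 \<le> u" "u < q" "0 \<le> v" "v < r" by auto
    have "u + q * v < q * (v + 1)" using a by (simp add: algebra_simps)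
    also have "\<dots> \<le> q * r" using a assms by (intro mult_left_mono) auto
    finally show "(case a of (u, v) \<Rightarrow> u + q * v) \<in> {0..<q * r}" using a assms by simp
  next
    fix b assume b: "b \<in> {0..<q * r}"
    have "b div q < r"
    proof (rule ccontr)
      assume "\<not> b div q < r"
      then have "q * r \<le> q * (b div q)" using assms by (intro mult_left_mono) auto
      also have "\<dots> \<le> b" using assms by (simp add: minus_mod_eq_mult_div[symmetric])
      finally show False using b by simp
    qed
    then show "(b mod q, b div q) \<in> {0..<q} \<times> {0..<r}"
      using b assms by (simp add: pos_imp_zdiv_nonneg_iff)
  qed (use assms in auto)
  finally show ?thesis by simp
qed

lemma sum_residues_periodic:
  fixes f :: "int \<Rightarrow> complex"
  assumes "periodic q f" "q > 0" "r > 0"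
  shows "(\<Sum>x\<in>{0..<q*r}. f x) = of_int r * (\<Sum>u\<in>{0..<q}. f u)"
proof -
  have "f (u + q * v) = f u" for u v
    by (rule periodicD[OF assms(1)]) (simp add: cong_def)
  then show ?thesis using assms by (simp add: sum_residues_mult sum_distrib_left)
qed

lemma sum_residues_CRT:
  fixes f :: "int \<Rightarrow> 'a::comm_monoid_add"
  assumes "periodic (q*r) f" "q > 0" "r > 0" "coprime q r"
  shows "(\<Sum>x\<in>{0..<q*r}. f x) = (\<Sum>u\<in>{0..<q}. \<Sum>v\<in>{0..<r}. f (u * r + v * q))"
proof -
  let ?g = "\<lambda>(u,v). (u * r + v * q) mod (q * r)"
  have inj: "inj_on ?g ({0..<q}\<times>{0..<r})"
  proof (rule inj_onI)
    fix x y assume x: "x \<in> {0..<q}\<times>{0..<r}" and y: "y \<in> {0..<q}\<times>{0..<r}" and eq: "?g x = ?g y"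
    obtain u v u' v' where xy: "x = (u,v)" "y = (u',v')" by (metis surj_pair)
    have c: "[u * r + v * q = u' * r + v' * q] (mod q * r)" using eq xy by (simp add: cong_def)
    have "[u * r + v * q = u' * r + v' * q] (mod q)" using c cong_dvd_modulus dvd_triv_left by blast
    then have "[u * r = u' * r] (mod q)" by (simp add: cong_def)
    then have "[u = u'] (mod q)" using assms(4) by (simp add: cong_mult_rcancel coprime_commute)
    moreover have "[u * r + v * q = u' * r + v' * q] (mod r)" using c cong_dvd_modulus dvd_triv_right by blast
    then have "[v * q = v' * q] (mod r)" by (simp add: cong_def)
    then have "[v = v'] (mod r)" using assms(4) by (simp add: cong_mult_rcancel)
    ultimately show "x = y" using x y xy by (simp add: cong_def)
  qed
  have sub: "?g ` ({0..<q}\<times>{0..<r}) \<subseteq> {0..<q*r}" using assms by (intro image_subsetI) (simp add: split_def)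
  have img: "?g ` ({0..<q}\<times>{0..<r}) = {0..<q*r}"
    by (rule card_subset_eq[OF _ sub]) (use assms in \<open>auto simp: card_image[OF inj] nat_mult_distrib\<close>)
  have "(\<Sum>u\<in>{0..<q}. \<Sum>v\<in>{0..<r}. f (u * r + v * q)) = (\<Sum>x\<in>{0..<q}\<times>{0..<r}. f (?g x))"
    by (simp add: sum.cartesian_product periodic_mod[OF assms(1)] split_def)
  also have "\<dots> = (\<Sum>x\<in>?g ` ({0..<q}\<times>{0..<r}). f x)"
    by (simp add: sum.reindex[OF inj] o_def)
  finally show ?thesis by (simp add: img)
qed

subsection \<open>Additive characters\<close>

definition echar :: "int \<Rightarrow> int \<Rightarrow> complex" where
  "echar q a = expo (of_int a / of_int q)"

lemma expo_add: "expo (x + y) = expo x * expo y"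
  unfolding expo_def by (simp add: exp_add[symmetric] algebra_simps)

lemma expo_of_int [simp]: "expo (of_int n) = 1"
  unfolding expo_def using exp_integer_2pi[of "of_int n"] by (simp add: algebra_simps)

lemma norm_expo [simp]: "norm (expo x) = 1"
  unfolding expo_def by (simp add: norm_exp_eq_Re)

lemma cnj_expo: "cnj (expo x) = expo (- x)"
  unfolding expo_def by (simp add: exp_cnj)

lemma expo_eq_1_iff: "expo x = 1 \<longleftrightarrow> x \<in> \<int>"
proof
  assume "expo x = 1"
  then obtain n :: int where "2 * pi * x = of_int (2 * n) * pi"
    unfolding expo_def by (auto simp: exp_eq_1)
  then have "x = of_int n" by simp
  then show "x \<in> \<int>" by simp
qed (auto elim: Ints_cases)

lemma echar_add: "echar q (a + b) = echar q a * echar q b"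
  by (simp add: echar_def expo_add[symmetric] add_divide_distrib)

lemma echar_0 [simp]: "echar q 0 = 1"
  using expo_of_int[of 0] by (simp add: echar_def)

lemma norm_echar [simp]: "norm (echar q a) = 1"
  by (simp add: echar_def)

lemma cnj_echar: "cnj (echar q a) = echar q (- a)"
  by (simp add: echar_def cnj_expo)

lemma echar_eq_1_iff: "q > 0 \<Longrightarrow> echar q a = 1 \<longleftrightarrow> q dvd a"
proof
  assume q: "q > 0" and "echar q a = 1"
  then have "real_of_int a / of_int q \<in> \<int>" by (simp add: echar_def expo_eq_1_iff)
  then obtain n where "real_of_int a / of_int q = of_int n" by (auto elim: Ints_cases)
  then have "real_of_int a = of_int (n * q)" using q by (simp add: field_simps)
  then show "q dvd a" by (metis dvd_triv_right of_int_eq_iff)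
qed (auto simp: echar_def expo_eq_1_iff)

lemma echar_cong: "q > 0 \<Longrightarrow> [a = b] (mod q) \<Longrightarrow> echar q a = echar q b"
proof -
  assume q: "q > 0" and "[a = b] (mod q)"
  then have "q dvd a - b" by (simp add: cong_iff_dvd_diff)
  then have "echar q (a - b) = 1" by (simp add: echar_eq_1_iff q)
  then show ?thesis using echar_add[of q "a - b" b] by simp
qed

lemma echar_cancel: "c \<noteq> 0 \<Longrightarrow> echar (c * q) (c * a) = echar q a"
  by (simp add: echar_def)

lemma echar_power: "echar q (a * int n) = echar q a ^ n"
  by (induction n) (auto simp: algebra_simps echar_add)

lemma sum_echar:
  assumes "q > 0"
  shows "(\<Sum>x\<in>{0..<q}. echar q (b * x)) = (if q dvd b then of_int q else 0)"
proof (cases "q dvd b")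
  case True
  then have "echar q (b * x) = 1" for x using assms by (simp add: echar_eq_1_iff)
  then show ?thesis using True assms by simp
next
  case False
  let ?z = "echar q b"
  have z: "?z \<noteq> 1" using False assms by (simp add: echar_eq_1_iff)
  have "(\<Sum>x\<in>{0..<q}. echar q (b * x)) = (\<Sum>n<nat q. ?z ^ n)"
    by (rule sum.reindex_bij_witness[of _ int nat]) (auto simp: echar_power[symmetric])
  also have "\<dots> = (?z ^ nat q - 1) / (?z - 1)" using z by (rule geometric_sum)
  also have "?z ^ nat q = 1"
    using assms by (simp add: echar_power[symmetric] echar_eq_1_iff)
  finally show ?thesis using False by simp
qed

subsection \<open>Bounds for the sums \<open>S(q,a)\<close>\<close>

lemma periodic_power: "q > 0 \<Longrightarrow> periodic q (\<lambda>x. echar q (a * x ^ k))"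
  by (intro periodicI echar_cong cong_mult cong_pow) auto

lemma gauss_S_altdef:
  assumes "q > 0"
  shows "gauss_S k q a = (\<Sum>x\<in>{0..<int q}. echar (int q) (a * x ^ k))"
proof -
  have "gauss_S k q a = (\<Sum>x\<in>{1..int q}. echar (int q) (a * x ^ k))"
    unfolding gauss_S_def echar_def
    by (rule sum.reindex_bij_witness[of _ nat int]) auto
  also have "\<dots> = (\<Sum>x\<in>{0..<int q}. echar (int q) (a * x ^ k))"
    by (rule sum_residues_cong) (use assms periodic_power in auto)
  finally show ?thesis .
qed

lemma gauss_S_cong:
  assumes "q > 0" "[a = b] (mod int q)"
  shows "gauss_S k q a = gauss_S k q b"
  unfolding gauss_S_altdef[OF assms(1)]
  by (intro sum.cong echar_cong cong_mult) (use assms in auto)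

lemma gauss_S_mult_power:
  assumes "q > 0" "coprime u (int q)"
  shows "gauss_S k q (a * u ^ k) = gauss_S k q a"
proof -
  have "(\<Sum>x\<in>{0..<int q}. echar (int q) (a * (u * x + 0) ^ k)) = (\<Sum>x\<in>{0..<int q}. echar (int q) (a * x ^ k))"
    by (rule sum_residues_affine) (use assms periodic_power in auto)
  then show ?thesis using assms by (simp add: gauss_S_altdef power_mult_distrib mult.assoc)
qed

lemma norm_gauss_S_le: "q > 0 \<Longrightarrow> norm (gauss_S k q a) \<le> real q"
  unfolding gauss_S_altdef by (rule order.trans[OF norm_sum]) simp

lemma cnj_gauss_S: "q > 0 \<Longrightarrow> cnj (gauss_S k q a) = gauss_S k q (- a)"
  by (simp add: gauss_S_altdef cnj_echar)

lemma gauss_S_zero: "q > 0 \<Longrightarrow> gauss_S k q 0 = of_nat q"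
  by (simp add: gauss_S_altdef)

lemma gauss_S_one [simp]: "gauss_S k 1 a = 1"
proof -
  have "gauss_S k 1 a = gauss_S k 1 0" by (rule gauss_S_cong) auto
  then show ?thesis using gauss_S_zero[of 1 k] by simp
qed

text \<open>Residues modulo \<open>q * r\<close> are u r + v q, and modulo \<open>q\<close> only the
  part with u survives. The factors r^k and q^k left behind are k-th powers of units, removed by
  \<open>gauss_S_mult_power\<close>. The factor \<open>c\<close> stays outside the splitting because
  in the singular series only \<open>a\<close> is decomposed, while the coefficient is the same for
  both moduli.\<close>

lemma gauss_S_CRT:
  assumes "q > 0" "r > 0" "coprime q r" "k > 0"
  shows "gauss_S k (q * r) ((a * int r + b * int q) * c) = gauss_S k q (a * c) * gauss_S k r (b * c)"
proof -
  let ?q = "int q" and ?r = "int r"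
  have cop: "coprime ?q ?r" using assms(3) by simp
  have pos: "?q > 0" "?r > 0" "int (q * r) > 0" using assms by auto
  have split: "echar (?q * ?r) ((a * ?r + b * ?q) * c * (u * ?r + v * ?q) ^ k) =
      echar ?q (a * c * (?r * u) ^ k) * echar ?r (b * c * (?q * v) ^ k)" for u v
  proof -
    let ?X = "a * c * (?r * u) ^ k" and ?Y = "b * c * (?q * v) ^ k"
    have "[(a * ?r + b * ?q) * c * (u * ?r + v * ?q) ^ k = (a * ?r + 0) * c * (u * ?r + 0) ^ k] (mod ?q)"
      by (intro cong_mult cong_pow cong_add cong_refl) (auto simp: cong_def)
    also have "(a * ?r + 0) * c * (u * ?r + 0) ^ k = ?r * ?X + 0" by (simp add: mult_ac)
    also have "[?r * ?X + 0 = ?r * ?X + ?q * ?Y] (mod ?q)"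
      by (intro cong_add cong_refl) (auto simp: cong_def)
    finally have 1: "[(a * ?r + b * ?q) * c * (u * ?r + v * ?q) ^ k = ?r * ?X + ?q * ?Y] (mod ?q)" .
    have "[(a * ?r + b * ?q) * c * (u * ?r + v * ?q) ^ k = (0 + b * ?q) * c * (0 + v * ?q) ^ k] (mod ?r)"
      by (intro cong_mult cong_pow cong_add cong_refl) (auto simp: cong_def)
    also have "(0 + b * ?q) * c * (0 + v * ?q) ^ k = 0 + ?q * ?Y" by (simp add: mult_ac)
    also have "[0 + ?q * ?Y = ?r * ?X + ?q * ?Y] (mod ?r)"
      by (intro cong_add cong_refl) (auto simp: cong_def)
    finally have 2: "[(a * ?r + b * ?q) * c * (u * ?r + v * ?q) ^ k = ?r * ?X + ?q * ?Y] (mod ?r)" .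
    have "[(a * ?r + b * ?q) * c * (u * ?r + v * ?q) ^ k = ?r * ?X + ?q * ?Y] (mod ?q * ?r)"
      using coprime_cong_mult[OF 1 2 cop] .
    then have "echar (?q * ?r) ((a * ?r + b * ?q) * c * (u * ?r + v * ?q) ^ k) =
        echar (?r * ?q) (?r * ?X) * echar (?q * ?r) (?q * ?Y)"
      using pos by (subst echar_cong[where b = "?r * ?X + ?q * ?Y"]) (auto simp: echar_add mult.commute)
    then show ?thesis using pos by (simp add: echar_cancel)
  qed
  have "gauss_S k (q * r) ((a * ?r + b * ?q) * c) =
      (\<Sum>x\<in>{0..<?q * ?r}. echar (?q * ?r) ((a * ?r + b * ?q) * c * x ^ k))"
    using assms by (simp add: gauss_S_altdef)
  also have "\<dots> = (\<Sum>u\<in>{0..<?q}. \<Sum>v\<in>{0..<?r}. echar (?q * ?r) ((a * ?r + b * ?q) * c * (u * ?r + v * ?q) ^ k))"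
    by (rule sum_residues_CRT) (use pos cop periodic_power[of "?q * ?r"] in auto)
  also have "\<dots> = (\<Sum>u\<in>{0..<?q}. echar ?q (a * c * (?r * u) ^ k)) * (\<Sum>v\<in>{0..<?r}. echar ?r (b * c * (?q * v) ^ k))"
    by (simp only: split sum_product)
  also have "(\<Sum>u\<in>{0..<?q}. echar ?q (a * c * (?r * u) ^ k)) = gauss_S k q (a * c * ?r ^ k)"
    using assms by (simp add: gauss_S_altdef power_mult_distrib mult.assoc)
  also have "\<dots> = gauss_S k q (a * c)"
    by (rule gauss_S_mult_power) (use assms cop in \<open>auto simp: coprime_commute\<close>)
  also have "(\<Sum>v\<in>{0..<?r}. echar ?r (b * c * (?q * v) ^ k)) = gauss_S k r (b * c * ?q ^ k)"
    using assms by (simp add: gauss_S_altdef power_mult_distrib mult.assoc)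
  also have "\<dots> = gauss_S k r (b * c)"
    by (rule gauss_S_mult_power) (use assms cop in auto)
  finally show ?thesis .
qed

lemma gauss_S_scale:
  assumes "g > 0" "q > 0"
  shows "gauss_S k (g * q) (int g * a) = of_nat g * gauss_S k q a"
proof -
  have "gauss_S k (g * q) (int g * a) = (\<Sum>x\<in>{0..<int q * int g}. echar (int q) (a * x ^ k))"
    using assms by (simp add: gauss_S_altdef echar_cancel mult.assoc mult.commute[of "int q"])
  also have "\<dots> = of_int (int g) * (\<Sum>x\<in>{0..<int q}. echar (int q) (a * x ^ k))"
    by (rule sum_residues_periodic) (use assms periodic_power in auto)
  finally show ?thesis using assms by (simp add: gauss_S_altdef)
qed

lemma power_add_expand:
  fixes x y :: int
  shows "\<exists>z. (x + y) ^ n = x ^ n + of_nat n * x ^ (n - 1) * y + y\<^sup>2 * z"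
proof (induction n)
  case (Suc n)
  then obtain z where z: "(x + y) ^ n = x ^ n + of_nat n * x ^ (n - 1) * y + y\<^sup>2 * z" by blast
  define Y where "Y = of_nat n * x ^ (n - 1)"
  have Y: "x * Y = of_nat n * x ^ n" by (cases n) (auto simp: Y_def)
  have "(x + y) ^ Suc n = (x + y) * (x ^ n + Y * y + y\<^sup>2 * z)" by (simp add: z Y_def)
  also have "\<dots> = x * x ^ n + (x * Y) * y + y * x ^ n + y\<^sup>2 * (Y + (x + y) * z)"
    by (simp add: algebra_simps power2_eq_square)
  also have "\<dots> = x ^ Suc n + of_nat (Suc n) * x ^ (Suc n - 1) * y + y\<^sup>2 * (Y + (x + y) * z)"
    by (simp only: Y) (simp add: algebra_simps)
  finally show ?case by blast
qed (auto intro: exI[of _ 0])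

text \<open>Write x = u + p^(j-T-1) v. The quadratic term vanishes modulo p^j because 2(j-T-1) \<ge>
  j, and what is left is linear in v. Since p^T divides \<open>k\<close> exactly, the sum over v
  vanishes unless p divides u.\<close>

lemma gauss_S_prime_power:
  assumes p: "prime p" and a: "\<not> int p dvd a" and k: "k = p ^ T * k0" "\<not> p dvd k0" "k \<ge> 2"
    and j: "j \<ge> 2 * T + 2"
  shows "gauss_S k (p ^ j) a =
    of_nat p ^ (T + 1) * (\<Sum>w\<in>{0..<int p ^ (j - T - 2)}. echar (int p ^ j) (a * int p ^ k * w ^ k))"
proof -
  define Q R Q' where "Q = int p ^ (j - T - 1)" and "R = int p ^ (T + 1)" and "Q' = int p ^ (j - T - 2)"
  have pp: "int p > 0" "prime (int p)" using p by (auto simp: prime_gt_0_nat)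
  have pos: "Q > 0" "R > 0" "Q' > 0" using pp by (auto simp: Q_def R_def Q'_def)
  have QR: "int p ^ j = Q * R" using j by (simp add: Q_def R_def power_add[symmetric] del: power_Suc)
  have Q: "Q = int p * Q'" using j by (simp add: Q_def Q'_def flip: power_Suc) (simp add: Suc_diff_Suc numeral_2_eq_2)
  have QQ: "int p ^ j dvd Q\<^sup>2" using j by (auto simp: Q_def power_mult[symmetric] intro!: le_imp_power_dvd)
  have inner: "echar (int p ^ j) (a * (u + Q * v) ^ k) = echar (int p ^ j) (a * u ^ k) * echar R (a * int k * u ^ (k - 1) * v)" for u v
  proof -
    obtain z where z: "(u + Q * v) ^ k = u ^ k + of_nat k * u ^ (k - 1) * (Q * v) + (Q * v)\<^sup>2 * z"
      using power_add_expand by blast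
    have "a * (u + Q * v) ^ k = (a * u ^ k + Q * (a * int k * u ^ (k - 1) * v)) + Q\<^sup>2 * (a * v\<^sup>2 * z)"
      by (simp add: z power_mult_distrib algebra_simps power2_eq_square)
    moreover have "[(a * u ^ k + Q * (a * int k * u ^ (k - 1) * v)) + Q\<^sup>2 * (a * v\<^sup>2 * z) = (a * u ^ k + Q * (a * int k * u ^ (k - 1) * v)) + 0] (mod int p ^ j)"
      by (intro cong_add cong_refl) (use QQ in \<open>auto simp: cong_0_iff\<close>)
    ultimately have "echar (int p ^ j) (a * (u + Q * v) ^ k) = echar (int p ^ j) (a * u ^ k + Q * (a * int k * u ^ (k - 1) * v))"
      using pp by (intro echar_cong) auto
    then show ?thesis using pos by (simp add: echar_add QR echar_cancel)
  qed
  have dv: "R dvd a * int k * u ^ (k - 1) \<longleftrightarrow> int p dvd u" for u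
  proof
    assume "int p dvd u"
    then have "int p dvd u ^ (k - 1)" using k(3) by (simp add: dvd_power_same prime_dvd_power_iff[OF pp(2)])
    then have "int p ^ T * int p dvd int p ^ T * (a * int k0 * u ^ (k - 1))"
      by (intro mult_dvd_mono) auto
    also have "int p ^ T * (a * int k0 * u ^ (k - 1)) = a * int k * u ^ (k - 1)"
      by (simp only: k(1) of_nat_mult of_nat_power mult_ac)
    finally show "R dvd a * int k * u ^ (k - 1)" by (simp add: R_def mult.commute)
  next
    assume "R dvd a * int k * u ^ (k - 1)"
    also have "a * int k * u ^ (k - 1) = int p ^ T * (a * int k0 * u ^ (k - 1))"
      by (simp only: k(1) of_nat_mult of_nat_power mult_ac)
    finally have "int p ^ T * int p dvd int p ^ T * (a * int k0 * u ^ (k - 1))"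
      by (simp add: R_def mult.commute)
    then have "int p dvd a * int k0 * u ^ (k - 1)" using pp by simp
    then have "int p dvd u ^ (k - 1)" using a k(2) pp by (simp add: prime_dvd_mult_iff)
    then show "int p dvd u" using prime_dvd_power pp(2) by blast
  qed
  have "gauss_S k (p ^ j) a = (\<Sum>u\<in>{0..<Q}. \<Sum>v\<in>{0..<R}. echar (int p ^ j) (a * (u + Q * v) ^ k))"
    using p pos by (simp add: gauss_S_altdef prime_gt_0_nat QR sum_residues_mult)
  also have "\<dots> = (\<Sum>u\<in>{0..<Q}. echar (int p ^ j) (a * u ^ k) * (if int p dvd u then of_int R else 0))"
    by (simp only: inner sum_distrib_left[symmetric] sum_echar[OF pos(2)] dv)
  also have "\<dots> = (\<Sum>r\<in>{0..<int p}. \<Sum>w\<in>{0..<Q'}. echar (int p ^ j) (a * (r + int p * w) ^ k) * (if int p dvd r + int p * w then of_int R else 0))"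
    unfolding Q using pp pos by (simp add: sum_residues_mult)
  also have "\<dots> = (\<Sum>r\<in>{0}. \<Sum>w\<in>{0..<Q'}. echar (int p ^ j) (a * (r + int p * w) ^ k) * (if int p dvd r + int p * w then of_int R else 0))"
  proof (rule sum.mono_neutral_right)
    show "\<forall>i\<in>{0..<int p} - {0}. (\<Sum>w = 0..<Q'. echar (int p ^ j) (a * (i + int p * w) ^ k) * (if int p dvd i + int p * w then of_int R else 0)) = 0"
    proof
      fix i assume "i \<in> {0..<int p} - {0}"
      then have "\<not> int p dvd i" by (auto dest: zdvd_imp_le)
      then have "\<not> int p dvd i + int p * w" for w by (simp add: dvd_add_left_iff)
      then show "(\<Sum>w = 0..<Q'. echar (int p ^ j) (a * (i + int p * w) ^ k) * (if int p dvd i + int p * w then of_int R else 0)) = 0"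
        by simp
    qed
  qed (use pp in auto)
  also have "\<dots> = of_int R * (\<Sum>w\<in>{0..<Q'}. echar (int p ^ j) (a * int p ^ k * w ^ k))"
    by (simp add: sum_distrib_left power_mult_distrib mult.commute mult.left_commute)
  finally show ?thesis by (simp add: R_def Q'_def)
qed

text \<open>The factor p^k in the argument cancels against the modulus, after which w runs through
  p^(k-T-2) full periods modulo p^(j-k); this uses \<open>k \<ge> T + 2\<close>.\<close>

lemma gauss_S_prime_power_rec:
  assumes p: "prime p" and a: "\<not> int p dvd a" and k: "k = p ^ T * k0" "\<not> p dvd k0" "k \<ge> T + 2"
    and j: "j \<ge> 2 * T + 2" "j > k"
  shows "gauss_S k (p ^ j) a = of_nat p ^ (k - 1) * gauss_S k (p ^ (j - k)) a"
proof -
  have pp: "int p > 0" using p by (auto simp: prime_gt_0_nat)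
  have e: "echar (int p ^ j) (a * int p ^ k * w ^ k) = echar (int p ^ (j - k)) (a * w ^ k)" for w
    using j pp echar_cancel[of "int p ^ k" "int p ^ (j - k)" "a * w ^ k"]
    by (simp add: power_add[symmetric] mult.commute mult.left_commute)
  have "int p ^ (j - T - 2) = int p ^ (j - k) * int p ^ (k - T - 2)"
    using k(3) j by (simp add: power_add[symmetric])
  then have "(\<Sum>w\<in>{0..<int p ^ (j - T - 2)}. echar (int p ^ j) (a * int p ^ k * w ^ k)) =
     of_int (int p ^ (k - T - 2)) * gauss_S k (p ^ (j - k)) a"
    using p pp sum_residues_periodic[of "int p ^ (j - k)" "\<lambda>w. echar (int p ^ (j - k)) (a * w ^ k)" "int p ^ (k - T - 2)"]
    by (simp add: e gauss_S_altdef prime_gt_0_nat periodic_power)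
  then have "gauss_S k (p ^ j) a = of_nat p ^ (T + 1) * of_nat p ^ (k - T - 2) * gauss_S k (p ^ (j - k)) a"
    using gauss_S_prime_power[OF p a k(1,2) _ j(1)] k(3) by simp
  also have "(of_nat p ^ (T + 1) * of_nat p ^ (k - T - 2) :: complex) = of_nat p ^ ((T + 1) + (k - T - 2))"
    by (simp only: power_add)
  also have "(T + 1) + (k - T - 2) = k - 1" using k(3) by simp
  finally show ?thesis .
qed

text \<open>For j \<le> k the factor p^k makes every character value in
  \<open>gauss_S_prime_power\<close> trivial, so the sum only counts its terms (here T = 0).\<close>

lemma gauss_S_prime_power_small:
  assumes p: "prime p" and a: "\<not> int p dvd a" and k: "\<not> p dvd k" and j: "2 \<le> j" "j \<le> k"
  shows "gauss_S k (p ^ j) a = of_nat p ^ (j - 1)"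
proof -
  have pp: "int p > 0" using p by (auto simp: prime_gt_0_nat)
  have e: "echar (int p ^ j) (a * int p ^ k * w ^ k) = 1" for w
    using pp by (subst echar_eq_1_iff) (auto intro: dvd_mult2[OF dvd_mult[OF le_imp_power_dvd[OF j(2)]]])
  have "gauss_S k (p ^ j) a = of_nat p ^ 1 * of_nat p ^ (j - 2)"
    using gauss_S_prime_power[OF p a, of k 0 k j] k j by (simp add: e)
  also have "\<dots> = of_nat p ^ (1 + (j - 2))" by (simp only: power_add)
  also have "1 + (j - 2) = j - 1" using j by simp
  finally show ?thesis .
qed

section \<open>Gauss sums to a prime modulus\<close>

lemma sum_gauss_S_prime:
  assumes p: "prime p" and k: "k > 0"
  shows "(\<Sum>x\<in>{0..<int p}. gauss_S k p x) = of_nat p"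
proof -
  have pp: "prime (int p)" "int p > 0" "p > 0" using p by (auto simp: prime_gt_0_nat)
  have "(\<Sum>x\<in>{0..<int p}. gauss_S k p x) = (\<Sum>y\<in>{0..<int p}. \<Sum>x\<in>{0..<int p}. echar (int p) (y ^ k * x))"
    unfolding gauss_S_altdef[OF pp(3)] by (subst sum.swap) (simp add: mult.commute)
  also have "\<dots> = (\<Sum>y\<in>{0..<int p}. if int p dvd y ^ k then of_int (int p) else 0)"
    by (simp only: sum_echar[OF pp(2)])
  also have "\<dots> = (\<Sum>y\<in>{0}. if int p dvd y ^ k then of_int (int p) else 0)"
  proof (rule sum.mono_neutral_right)
    show "\<forall>i\<in>{0..<int p} - {0}. (if int p dvd i ^ k then of_int (int p) else 0) = (0::complex)"
    proof
      fix i assume "i \<in> {0..<int p} - {0}"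
      then have "\<not> int p dvd i" by (auto dest: zdvd_imp_le)
      then have "\<not> int p dvd i ^ k" using prime_dvd_power[OF pp(1)] by blast
      then show "(if int p dvd i ^ k then of_int (int p) else 0) = (0::complex)" by simp
    qed
  qed (use pp in auto)
  finally show ?thesis using k by (simp add: zero_power)
qed

lemma card_kth_roots_mod_prime:
  assumes "prime p" "k > 0"
  shows "card {x\<in>{0..<int p}. [x ^ k = c] (mod int p)} \<le> k"
proof -
  let ?c = "nat (c mod int p)"
  have p: "int p > 0" using assms by (simp add: prime_gt_0_nat)
  define B where "B = {x\<in>{..<p}. [x ^ k = ?c] (mod p)}"
  have finB: "finite B" by (rule finite_subset[of _ "{..<p}"]) (auto simp: B_def)
  have sub: "{x\<in>{0..<int p}. [x ^ k = c] (mod int p)} \<subseteq> int ` B"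
  proof
    fix x assume x: "x \<in> {x\<in>{0..<int p}. [x ^ k = c] (mod int p)}"
    then have "[x ^ k = c mod int p] (mod int p)" by simp
    moreover have "x ^ k = int (nat x ^ k)" "c mod int p = int ?c" using x p by auto
    ultimately have "[int (nat x ^ k) = int ?c] (mod int p)" by metis
    then have "[nat x ^ k = ?c] (mod p)" by (simp only: cong_int_iff)
    then show "x \<in> int ` B"
      using x by (intro image_eqI[of _ _ "nat x"]) (auto simp: B_def)
  qed
  have "card {x\<in>{0..<int p}. [x ^ k = c] (mod int p)} \<le> card B"
    by (rule surj_card_le[OF finB sub])
  also have "\<dots> \<le> k" unfolding B_def by (rule roots_mod_prime_bound[OF assms])
  finally show ?thesis .
qed

lemma card_kth_powers_mod_prime:
  assumes "prime p" "k > 0"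
  shows "p - 1 \<le> k * card ((\<lambda>x. x ^ k mod int p) ` {1..<int p})"
proof -
  define f where "f x = x ^ k mod int p" for x
  define A where "A = {1..<int p}"
  have fib: "card {x\<in>A. f x = y} \<le> k" for y
  proof -
    have "card {x\<in>A. f x = y} \<le> card {x\<in>{0..<int p}. [x ^ k = y] (mod int p)}"
    proof (rule card_mono)
      show "finite {x\<in>{0..<int p}. [x ^ k = y] (mod int p)}"
        by (rule finite_subset[of _ "{0..<int p}"]) blast+
      show "{x\<in>A. f x = y} \<subseteq> {x\<in>{0..<int p}. [x ^ k = y] (mod int p)}"
        unfolding A_def f_def cong_def by force
    qed
    then show ?thesis using card_kth_roots_mod_prime[OF assms, of y] by linarith
  qed
  have "A = (\<Union>y\<in>f ` A. {x\<in>A. f x = y})" by blast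
  then have 1: "card A = card (\<Union>y\<in>f ` A. {x\<in>A. f x = y})" by (rule arg_cong[of _ _ card])
  have 2: "card (\<Union>y\<in>f ` A. {x\<in>A. f x = y}) \<le> (\<Sum>y\<in>f ` A. card {x\<in>A. f x = y})"
    by (rule card_UN_le) (simp add: A_def)
  have 3: "(\<Sum>y\<in>f ` A. card {x\<in>A. f x = y}) \<le> (\<Sum>y\<in>f ` A. k)"
    by (rule sum_mono) (rule fib)
  have "card A = p - 1" by (simp add: A_def)
  then have "p - 1 \<le> (\<Sum>y\<in>f ` A. k)" using 1 2 3 by linarith
  then show ?thesis unfolding f_def[abs_def] A_def by (simp add: mult.commute)
qed

text \<open>Averaging replaces the decomposition into multiplicative characters. The sum of squares
  over all residues is p N, where N \<le> k p counts pairs with equal k-th powers. The value at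
  \<open>a\<close> is shared by the at least (p-1)/k residues \<open>a * y\<close> with
  \<open>y\<close> a nonzero k-th power. Comparing both gives the claim, with the factor 2 from p
  \<le> 2(p-1).\<close>

lemma norm_gauss_S_prime:
  assumes p: "prime p" and a: "\<not> int p dvd a" and k: "k > 0"
  shows "norm (gauss_S k p a) ^ 2 \<le> 2 * real k ^ 2 * real p"
proof -
  let ?P = "{0..<int p}" and ?f = "\<lambda>x. x ^ k mod int p"
  have pp: "int p > 0" "p > 0" "prime (int p)" using p by (auto simp: prime_gt_0_nat)
  define N where "N = card {z\<in>?P \<times> ?P. int p dvd fst z ^ k - snd z ^ k}"
  have sq: "complex_of_real (norm (gauss_S k p b) ^ 2) =
      (\<Sum>(x,y)\<in>?P \<times> ?P. echar (int p) ((x ^ k - y ^ k) * b))" for b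
  proof -
    have "complex_of_real (norm (gauss_S k p b) ^ 2) = gauss_S k p b * gauss_S k p (- b)"
      by (simp only: complex_norm_square cnj_gauss_S[OF pp(2)])
    also have "\<dots> = (\<Sum>x\<in>?P. \<Sum>y\<in>?P. echar (int p) ((x ^ k - y ^ k) * b))"
      by (simp add: gauss_S_altdef pp sum_product echar_add[symmetric] algebra_simps)
    finally show ?thesis by (simp add: sum.cartesian_product)
  qed
  have "complex_of_real (\<Sum>b\<in>?P. norm (gauss_S k p b) ^ 2) = (\<Sum>b\<in>?P. \<Sum>(x,y)\<in>?P \<times> ?P. echar (int p) ((x ^ k - y ^ k) * b))"
    by (simp only: of_real_sum sq)
  also have "\<dots> = (\<Sum>(x,y)\<in>?P \<times> ?P. \<Sum>b\<in>?P. echar (int p) ((x ^ k - y ^ k) * b))"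
    by (subst sum.swap) (simp add: split_def)
  also have "\<dots> = (\<Sum>z\<in>?P \<times> ?P. if int p dvd fst z ^ k - snd z ^ k then of_int (int p) else 0)"
    by (simp add: sum_echar pp split_def)
  also have "\<dots> = of_nat p * of_nat N"
    by (subst sum.inter_filter[symmetric]) (simp_all add: N_def)
  finally have "complex_of_real (\<Sum>b\<in>?P. norm (gauss_S k p b) ^ 2) = complex_of_real (real p * real N)" by simp
  then have tot: "(\<Sum>b\<in>?P. norm (gauss_S k p b) ^ 2) = real p * real N" by (simp only: of_real_eq_iff)
  have "{z\<in>?P \<times> ?P. int p dvd fst z ^ k - snd z ^ k} = (\<Union>y\<in>?P. (\<lambda>x. (x,y)) ` {x\<in>?P. [x ^ k = y ^ k] (mod int p)})"
    by (auto simp: cong_iff_dvd_diff)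
  then have "N \<le> (\<Sum>y\<in>?P. card ((\<lambda>x. (x,y)) ` {x\<in>?P. [x ^ k = y ^ k] (mod int p)}))"
    unfolding N_def by (simp only:) (rule card_UN_le, simp)
  also have "\<dots> \<le> (\<Sum>y\<in>?P. k)"
    by (rule sum_mono, rule order.trans[OF card_image_le card_kth_roots_mod_prime[OF p k]])
      (auto intro: finite_subset[of _ ?P])
  finally have N: "N \<le> p * k" by simp
  define K where "K = ?f ` {1..<int p}"
  have finK: "finite K" by (simp add: K_def)
  have injK: "inj_on (\<lambda>y. (a * y) mod int p) K"
  proof (rule inj_onI)
    fix x y assume xy: "x \<in> K" "y \<in> K" and "(a * x) mod int p = (a * y) mod int p"
    then have "[a * x = a * y] (mod int p)" by (simp add: cong_def)
    moreover have "coprime a (int p)" using a pp prime_imp_coprime coprime_commute by blast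
    ultimately have "[x = y] (mod int p)" by (simp add: cong_mult_lcancel)
    then show "x = y" using xy by (auto simp: K_def cong_def)
  qed
  have "real (card K) * norm (gauss_S k p a) ^ 2 = (\<Sum>y\<in>K. norm (gauss_S k p ((a * y) mod int p)) ^ 2)"
  proof -
    have "gauss_S k p ((a * y) mod int p) = gauss_S k p a" if yK: "y \<in> K" for y
    proof -
      obtain x where x: "x \<in> {1..<int p}" "y = x ^ k mod int p" using yK unfolding K_def by blast
      have "\<not> int p dvd x" using x by (auto dest: zdvd_imp_le)
      then have "coprime x (int p)" using pp prime_imp_coprime coprime_commute by blast
      then have "gauss_S k p (a * x ^ k) = gauss_S k p a" using pp by (intro gauss_S_mult_power) auto
      moreover have "gauss_S k p ((a * y) mod int p) = gauss_S k p (a * x ^ k)"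
        using pp by (intro gauss_S_cong) (auto simp: cong_def x mod_mult_right_eq)
      ultimately show ?thesis by simp
    qed
    then show ?thesis by simp
  qed
  also have "\<dots> = (\<Sum>b\<in>(\<lambda>y. (a * y) mod int p) ` K. norm (gauss_S k p b) ^ 2)"
    by (simp add: sum.reindex[OF injK])
  also have "\<dots> \<le> (\<Sum>b\<in>?P. norm (gauss_S k p b) ^ 2)"
    using pp finK by (intro sum_mono2) auto
  finally have 1: "real (card K) * norm (gauss_S k p a) ^ 2 \<le> real p * real N" by (simp add: tot)
  have "real p \<le> 2 * real (p - 1)" using p by (simp add: prime_ge_2_nat of_nat_diff prime_gt_0_nat Suc_leI)
  also have "\<dots> \<le> 2 * real (k * card K)"
    using card_kth_powers_mod_prime[OF p k] by (simp only: K_def of_nat_le_iff mult_le_cancel_left_pos zero_less_numeral)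
  finally have 2: "real p \<le> 2 * real k * real (card K)" by simp
  have "real p * norm (gauss_S k p a) ^ 2 \<le> 2 * real k * real (card K) * norm (gauss_S k p a) ^ 2"
    using 2 by (intro mult_right_mono) auto
  also have "\<dots> = 2 * real k * (real (card K) * norm (gauss_S k p a) ^ 2)" by simp
  also have "\<dots> \<le> 2 * real k * (real p * real N)" by (intro mult_left_mono[OF 1]) auto
  also have "\<dots> \<le> 2 * real k * (real p * real (p * k))" using of_nat_mono[OF N, where 'a = real] by (intro mult_left_mono) auto
  finally have "real p * norm (gauss_S k p a) ^ 2 \<le> real p * (2 * real k ^ 2 * real p)"
    by (simp add: power2_eq_square algebra_simps)
  then show ?thesis using pp by simp
qed

section \<open>From prime powers to all moduli: a bound with a constant independent of q\<close>

lemma exponent_le: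
  assumes "prime p" "k = p ^ T * k0" "k \<ge> 3"
  shows "T + 2 \<le> k"
proof -
  have "k0 > 0" using assms by (cases k0) auto
  have "2 ^ T \<le> p ^ T" using assms(1) prime_ge_2_nat power_mono by blast
  also have "\<dots> \<le> k" using assms(2) \<open>k0 > 0\<close> by simp
  finally have k: "2 ^ T \<le> k" .
  show ?thesis
  proof (cases "T \<ge> 2")
    case True
    then have "T + 2 \<le> 2 ^ T"
      by (induction T rule: nat_induct_at_least) auto
    then show ?thesis using k by simp
  qed (use assms(3) in linarith)
qed

text \<open>The k-th power keeps the exponents integral. At j = 1 the bound 2 k^2 p for the square
  gives the claim with constant 1 as soon as (2 k^2)^k \<le> p^(k-2), for which p > (2 k^2)^3
  suffices. A constant other than 1 thus occurs for finitely many primes only; there the trivial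
  bound is used up to j = 2 k and the recursion afterwards.\<close>

lemma norm_gauss_S_prime_power:
  assumes p: "prime p" and a: "\<not> int p dvd a" and k: "k \<ge> 3"
  shows "norm (gauss_S k (p ^ j) a) ^ k \<le>
    real (if p \<le> (2 * k ^ 2) ^ 3 then p ^ (2 * k) else 1) * (real p ^ j) ^ (k - 1)"
proof -
  define C where "C = real (if p \<le> (2 * k ^ 2) ^ 3 then p ^ (2 * k) else 1)"
  have p1: "real p \<ge> 1" "p > 0" using prime_ge_1_nat[OF p] prime_gt_0_nat[OF p] by simp_all
  have C1: "C \<ge> 1" using p1 by (auto simp: C_def one_le_power)
  \<comment> \<open>The recursion multiplies both sides by the same power p^(k (k-1)), so the
    constant does not grow with \<open>j\<close>.\<close>
  have step: "norm (gauss_S k (p ^ j) a) ^ k \<le> C * (real p ^ j) ^ (k - 1)"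
    if "gauss_S k (p ^ j) a = of_nat p ^ (k - 1) * gauss_S k (p ^ (j - k)) a" "j > k"
      "norm (gauss_S k (p ^ (j - k)) a) ^ k \<le> C * (real p ^ (j - k)) ^ (k - 1)" for j
  proof -
    have "norm (gauss_S k (p ^ j) a) ^ k = (real p ^ k) ^ (k - 1) * norm (gauss_S k (p ^ (j - k)) a) ^ k"
      by (simp add: that(1) norm_mult norm_power power_mult_distrib power_mult[symmetric] mult.commute)
    also have "\<dots> \<le> (real p ^ k) ^ (k - 1) * (C * (real p ^ (j - k)) ^ (k - 1))"
      by (intro mult_left_mono that(3)) auto
    also have "\<dots> = C * (real p ^ k * real p ^ (j - k)) ^ (k - 1)"
      by (simp only: power_mult_distrib mult_ac)
    also have "real p ^ k * real p ^ (j - k) = real p ^ j"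
      using that(2) by (simp add: power_add[symmetric])
    finally show ?thesis .
  qed
  have "norm (gauss_S k (p ^ j) a) ^ k \<le> C * (real p ^ j) ^ (k - 1)"
  proof (induction j rule: less_induct)
    case (less j)
    show ?case
    proof (cases "p \<le> (2 * k ^ 2) ^ 3")
      case small: True
      show ?thesis
      proof (cases "j \<le> 2 * k")
        case True
        have "norm (gauss_S k (p ^ j) a) ^ k \<le> real (p ^ j) ^ k"
          using p1 by (intro power_mono norm_gauss_S_le) auto
        also have "\<dots> = real p ^ j * (real p ^ j) ^ (k - 1)"
          using k by (cases k) auto
        also have "\<dots> \<le> C * (real p ^ j) ^ (k - 1)"
          using small True p1 by (intro mult_right_mono) (simp_all add: C_def power_increasing)
        finally show ?thesis .
      next
        case False
        define T where "T = multiplicity p k"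
        have k_nz: "k \<noteq> 0" and p_nu: "\<not> is_unit p" using k p not_prime_unit by auto
        obtain k0 where k0: "k = p ^ T * k0" "\<not> p dvd k0"
          unfolding T_def using multiplicity_decompose'[OF k_nz p_nu] by blast
        have "T + 2 \<le> k" by (rule exponent_le[OF p k0(1) k])
        then have rec: "gauss_S k (p ^ j) a = of_nat p ^ (k - 1) * gauss_S k (p ^ (j - k)) a"
          by (intro gauss_S_prime_power_rec[OF p a k0]) (use False in linarith)+
        have "norm (gauss_S k (p ^ (j - k)) a) ^ k \<le> C * (real p ^ (j - k)) ^ (k - 1)"
          by (rule less) (use False k in linarith)
        then show ?thesis by (intro step[OF rec]) (use False in linarith)+
      qed
    next
      case False
      then have C: "C = 1" by (simp add: C_def)
      have "k < p"
      proof -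
        have "k \<le> k ^ 6" using k by (intro self_le_power) auto
        also have "\<dots> \<le> (2 * k ^ 2) ^ 3" by (simp add: power_mult_distrib power_mult[symmetric])
        finally show ?thesis using False by simp
      qed
      then have pk: "\<not> p dvd k" using k by (auto dest: dvd_imp_le)
      consider "j = 0" | "j = 1" | "2 \<le> j" "j \<le> k" | "j > k" by linarith
      then show ?thesis
      proof cases
        case 1 then show ?thesis using C by (simp flip: One_nat_def)
      next
        case 2
        let ?n = "norm (gauss_S k p a)"
        have "?n ^ 2 \<le> 2 * real k ^ 2 * real p" using norm_gauss_S_prime[OF p a] k by simp
        then have "(?n ^ 2) ^ k \<le> (2 * real k ^ 2 * real p) ^ k" by (intro power_mono) auto
        also have "\<dots> = (2 * real k ^ 2) ^ k * real p ^ k" by (simp add: power_mult_distrib)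
        \<comment> \<open>k \<le> 3 (k - 2) for k \<ge> 3, with equality at k = 3; this dictates the
          cube in the threshold for \<open>p\<close>.\<close>
        also have "(2 * real k ^ 2) ^ k \<le> (2 * real k ^ 2) ^ (3 * (k - 2))"
        proof (rule power_increasing)
          have "1 \<le> real k ^ 2" using k by (intro one_le_power) auto
          then show "1 \<le> 2 * real k ^ 2" by linarith
        qed (use k in linarith)
        also have "\<dots> = real ((2 * k ^ 2) ^ 3) ^ (k - 2)" by (simp add: power_mult)
        also have "\<dots> \<le> real p ^ (k - 2)" using False by (intro power_mono) (auto simp del: of_nat_power of_nat_mult)
        finally have "(?n ^ 2) ^ k \<le> real p ^ (k - 2) * real p ^ k" by (simp add: mult_right_mono)
        also have "\<dots> = real p ^ ((k - 2) + k)" by (simp only: power_add)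
        also have "(k - 2) + k = (k - 1) * 2" using k by simp
        also have "real p ^ ((k - 1) * 2) = (real p ^ (k - 1)) ^ 2" by (simp only: power_mult)
        finally have "(?n ^ k) ^ 2 \<le> (real p ^ (k - 1)) ^ 2" by (simp add: power_mult[symmetric] mult.commute)
        then have "?n ^ k \<le> real p ^ (k - 1)" by (rule power2_le_imp_le) auto
        then show ?thesis using 2 C by simp
      next
        case 3
        have "norm (gauss_S k (p ^ j) a) ^ k = (real p ^ (j - 1)) ^ k"
          by (simp add: gauss_S_prime_power_small[OF p a pk 3] norm_power)
        also have "\<dots> \<le> (real p ^ j) ^ (k - 1)"
          unfolding power_mult[symmetric]
          by (rule power_increasing) (use p1 3 in \<open>auto simp: algebra_simps diff_mult_distrib diff_mult_distrib2\<close>)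
        finally show ?thesis using C by simp
      next
        case 4
        have rec: "gauss_S k (p ^ j) a = of_nat p ^ (k - 1) * gauss_S k (p ^ (j - k)) a"
          by (rule gauss_S_prime_power_rec[OF p a, of k 0 k]) (use 4 k pk in simp_all)
        have "norm (gauss_S k (p ^ (j - k)) a) ^ k \<le> C * (real p ^ (j - k)) ^ (k - 1)"
          by (rule less) (use 4 k in linarith)
        then show ?thesis by (rule step[OF rec 4])
      qed
    qed
  qed
  then show ?thesis by (simp add: C_def)
qed

lemma coprime_split:
  fixes a :: int
  assumes "coprime q r" "coprime a (int (q * r))"
  obtains a1 a2 where "a = a1 * int r + a2 * int q" "coprime a1 (int q)" "coprime a2 (int r)"
proof -
  have "gcd (int r) (int q) = 1" using assms(1) by (metis coprime_commute coprime_imp_gcd_eq_1 coprime_int_iff)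
  then obtain u v where uv: "u * int r + v * int q = 1" by (metis bezout_int)
  have eq: "a = (a * u) * int r + (a * v) * int q"
  proof -
    have "a * (u * int r + v * int q) = a" by (simp only: uv mult_1_right)
    then show ?thesis by (simp add: algebra_simps)
  qed
  have c: "coprime a (int q)" "coprime a (int r)" using assms(2) by auto
  have "coprime ((a * u) * int r + (a * v) * int q) (int q)" using c(1) eq by simp
  then have 1: "coprime (a * u) (int q)"
    by (metis coprime_iff_gcd_eq_1 coprime_mult_left_iff gcd_add_mult mult.commute add.commute gcd.commute)
  have "coprime ((a * u) * int r + (a * v) * int q) (int r)" using c(2) eq by simp
  then have 2: "coprime (a * v) (int r)"
    by (metis coprime_iff_gcd_eq_1 coprime_mult_left_iff gcd_add_mult mult.commute add.commute gcd.commute)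
  show ?thesis using that eq 1 2 by blast
qed

lemma prime_power_split:
  fixes q :: nat
  assumes "q > 1"
  obtains p j r where "prime p" "j > 0" "q = p ^ j * r" "\<not> p dvd r" "coprime (p ^ j) r" "r < q" "r > 0"
proof -
  obtain p where p: "prime p" "p dvd q" using prime_factor_nat[of q] assms by blast
  define j where "j = multiplicity p q"
  have q_nz: "q \<noteq> 0" and p_nu: "\<not> is_unit p" using assms p not_prime_unit by auto
  obtain r where r: "q = p ^ j * r" "\<not> p dvd r"
    unfolding j_def using multiplicity_decompose'[OF q_nz p_nu] by blast
  have j: "j > 0" using r p by (cases j) auto
  have r0: "r > 0" using r assms by (cases r) auto
  have "p ^ j > 1" by (rule one_less_power[OF prime_gt_1_nat[OF p(1)] j])
  then have "r < q" using r0 by (simp add: r(1))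
  moreover have "coprime (p ^ j) r" using r(2) p by (simp add: prime_imp_coprime coprime_power_left_iff)
  ultimately show ?thesis using that p j r r0 by blast
qed

text \<open>The constant is a product over the small primes that divide \<open>q\<close>, hence
  multiplicative along the induction that splits off one prime power. A constant common to all
  \<open>q\<close> would be multiplied up in every step.\<close>

lemma norm_gauss_S_coprime:
  assumes k: "k \<ge> 3" and "q > 0" "coprime a (int q)"
  shows "norm (gauss_S k q a) ^ k \<le>
    real (\<Prod>p | prime p \<and> p \<le> (2 * k ^ 2) ^ 3 \<and> p dvd q. p ^ (2 * k)) * real q ^ (k - 1)"
  using assms(2,3)
proof (induction q arbitrary: a rule: less_induct)
  case (less q)
  let ?P = "\<lambda>q. {p. prime p \<and> p \<le> (2 * k ^ 2) ^ 3 \<and> p dvd q}"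
  let ?C = "\<lambda>q. real (\<Prod>p\<in>?P q. p ^ (2 * k))"
  show ?case
  proof (cases "q = 1")
    case True
    have "?P q = {}" using True by auto
    then show ?thesis using True by (simp del: One_nat_def)
  next
    case False
    then have "q > 1" using less.prems by simp
    then obtain p j r where p: "prime p" "j > 0" "q = p ^ j * r" "\<not> p dvd r" "coprime (p ^ j) r" "r < q" "r > 0"
      by (rule prime_power_split)
    have pj: "p ^ j > 0" using p by (simp add: prime_gt_0_nat)
    obtain a1 a2 where a: "a = a1 * int r + a2 * int (p ^ j)" "coprime a1 (int (p ^ j))" "coprime a2 (int r)"
      using coprime_split[OF p(5)] less.prems p(3) by metis
    have na1: "\<not> int p dvd a1"
    proof
      assume "int p dvd a1"
      moreover have "int p dvd int (p ^ j)" using p(2) by simp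
      ultimately have "is_unit (int p)" using a(2) coprime_common_divisor by blast
      then show False using p(1) by (simp add: prime_gt_1_nat)
    qed
    have "gauss_S k q a = gauss_S k (p ^ j) a1 * gauss_S k r a2"
      using gauss_S_CRT[OF pj p(7) p(5), of k a1 a2 1] k by (simp add: a p(3))
    then have "norm (gauss_S k q a) ^ k = norm (gauss_S k (p ^ j) a1) ^ k * norm (gauss_S k r a2) ^ k"
      by (simp add: norm_mult power_mult_distrib)
    also have "\<dots> \<le> (real (if p \<le> (2 * k ^ 2) ^ 3 then p ^ (2 * k) else 1) * (real p ^ j) ^ (k - 1)) * (?C r * real r ^ (k - 1))"
      by (intro mult_mono norm_gauss_S_prime_power[OF p(1) na1 k] less.IH p(6,7) a(3)) auto
    also have "\<dots> = (real (if p \<le> (2 * k ^ 2) ^ 3 then p ^ (2 * k) else 1) * ?C r) * real q ^ (k - 1)"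
      by (simp add: p(3) power_mult_distrib)
    also have "real (if p \<le> (2 * k ^ 2) ^ 3 then p ^ (2 * k) else 1) * ?C r = ?C q"
    proof -
      have dv: "x dvd q \<longleftrightarrow> x = p \<or> x dvd r" if "prime x" for x
        using that p by (auto simp: prime_dvd_mult_iff prime_dvd_power_iff primes_dvd_imp_eq)
      show ?thesis
      proof (cases "p \<le> (2 * k ^ 2) ^ 3")
        case True
        have "?P q = insert p (?P r)" using True p(1) dv by auto
        moreover have "p \<notin> ?P r" "finite (?P r)" using p(4) by auto
        ultimately show ?thesis using True by simp
      next
        case False
        then have "?P q = ?P r" using dv by auto
        then show ?thesis using False by simp
      qed
    qed
    finally show ?thesis .
  qed
qed

text \<open>Dividing \<open>q\<close> and \<open>b\<close> by their gcd g leaves a coprime pair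
  modulo r = q/g and a factor g in front of the sum; then g^k r^(k-1) = q^(k-1) g. The constant now
  collects all small primes, whether or not they divide \<open>q\<close>.\<close>

lemma gauss_S_bound:
  assumes k: "k \<ge> 3"
  obtains C where "C \<ge> 1" "\<And>q b. q > 0 \<Longrightarrow> norm (gauss_S k q b) ^ k \<le> C * real q ^ (k - 1) * real_of_int (gcd b (int q))"
proof
  let ?P = "{p. prime p \<and> p \<le> (2 * k ^ 2) ^ 3}"
  define C where "C = real (\<Prod>p\<in>?P. p ^ (2 * k))"
  show "C \<ge> 1" unfolding C_def of_nat_prod by (intro prod_ge_1) (use prime_ge_1_nat in \<open>force intro: one_le_power\<close>)
  fix q :: nat and b :: int
  assume q: "q > 0"
  define g where "g = nat (gcd b (int q))"
  have g: "int g = gcd b (int q)" by (simp add: g_def)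
  then have "int g dvd int q" "int g dvd b" by auto
  then obtain r c where rc: "q = g * r" "b = int g * c" by (auto elim!: dvdE)
  have pos: "g > 0" "r > 0" using q rc by auto
  have "gcd b (int q) = int g * gcd c (int r)" by (simp add: rc gcd_mult_left)
  then have "int g * gcd c (int r) = int g * 1" using g by simp
  then have "gcd c (int r) = 1" using pos by (metis mult_cancel_left of_nat_0_eq_iff less_irrefl)
  then have cop: "coprime c (int r)" by (simp add: coprime_iff_gcd_eq_1)
  have nrm: "norm (gauss_S k r c) ^ k \<le> real (\<Prod>p | prime p \<and> p \<le> (2 * k ^ 2) ^ 3 \<and> p dvd r. p ^ (2 * k)) * real r ^ (k - 1)"
    by (rule norm_gauss_S_coprime[OF k pos(2) cop])
  have "real (\<Prod>p | prime p \<and> p \<le> (2 * k ^ 2) ^ 3 \<and> p dvd r. p ^ (2 * k)) \<le> C"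
    unfolding C_def of_nat_prod
    by (rule prod_mono2) (use prime_ge_1_nat in \<open>force intro: one_le_power\<close>)+
  then have le: "real (\<Prod>p | prime p \<and> p \<le> (2 * k ^ 2) ^ 3 \<and> p dvd r. p ^ (2 * k)) * real r ^ (k - 1) \<le> C * real r ^ (k - 1)"
    by (intro mult_right_mono) auto
  have *: "norm (gauss_S k r c) ^ k \<le> C * real r ^ (k - 1)" using nrm le by (rule order.trans)
  have "norm (gauss_S k q b) ^ k = real g ^ k * norm (gauss_S k r c) ^ k"
    unfolding rc by (simp add: gauss_S_scale[OF pos] norm_mult power_mult_distrib)
  also have "\<dots> \<le> real g ^ k * (C * real r ^ (k - 1))" by (intro mult_left_mono *) auto
  also have "\<dots> = C * real q ^ (k - 1) * real g"
    using k by (cases k) (auto simp: rc power_mult_distrib)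
  also have "real g = real_of_int (gcd b (int q))" using g by (metis of_int_of_nat_eq)
  finally show "norm (gauss_S k q b) ^ k \<le> C * real q ^ (k - 1) * real_of_int (gcd b (int q))" .
qed

subsection \<open>The terms of the singular series\<close>

text \<open>The coefficients are arbitrary integers, so that the same sums serve the values of the
  polynomials and the modified tuples in the density computations. Residues prime to
  \<open>q\<close> are selected by a conditional, not by restricting the range, which keeps the
  summand periodic on all residues.\<close>

definition sterm :: "nat \<Rightarrow> nat \<Rightarrow> (nat \<Rightarrow> int) \<Rightarrow> nat \<Rightarrow> complex" where
  "sterm k s c q = (\<Sum>a\<in>{0..<int q}. if coprime a (int q) then \<Prod>i=1..s. gauss_S k q (a * c i) else 0) / of_nat q ^ s"

lemma periodic_coprime_prod:
  assumes "q > 0"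
  shows "periodic (int q) (\<lambda>a. if coprime a (int q) then \<Prod>i=1..s. gauss_S k q (a * c i) else 0)"
proof (rule periodicI)
  fix x y assume c: "[x = y] (mod int q)"
  then have "coprime x (int q) = coprime y (int q)" using cong_imp_coprime cong_sym by blast
  moreover have "gauss_S k q (x * c i) = gauss_S k q (y * c i)" for i
    by (rule gauss_S_cong[OF assms]) (use c in \<open>simp add: cong_scalar_right\<close>)
  ultimately show "(if coprime x (int q) then \<Prod>i=1..s. gauss_S k q (x * c i) else 0) = (if coprime y (int q) then \<Prod>i=1..s. gauss_S k q (y * c i) else 0)"
    by simp
qed

lemma singular_series_term_eq:
  assumes "q > 0"
  shows "singular_series_term k s h t q = sterm k s (\<lambda>i. poly (h i) t) q"
proof -
  let ?f = "\<lambda>a. if coprime a (int q) then \<Prod>i=1..s. gauss_S k q (a * poly (h i) t) else 0"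
  have "coprime_sum k s h t q = (\<Sum>a\<in>{1..q}. ?f (int a))"
    unfolding coprime_sum_def by (subst sum.inter_filter) auto
  also have "\<dots> = (\<Sum>a\<in>{1..int q}. ?f a)"
    by (rule sum.reindex_bij_witness[of _ nat int]) auto
  also have "\<dots> = (\<Sum>a\<in>{0..<int q}. ?f a)"
    by (rule sum_residues_cong[OF periodic_coprime_prod]) (use assms in auto)
  finally show ?thesis by (simp add: singular_series_term_def sterm_def)
qed

lemma sterm_cong:
  assumes "q > 0" "\<And>i. i \<in> {1..s} \<Longrightarrow> [c i = c' i] (mod int q)"
  shows "sterm k s c q = sterm k s c' q"
proof -
  have "gauss_S k q (a * c i) = gauss_S k q (a * c' i)" if "i \<in> {1..s}" for a i
    by (rule gauss_S_cong[OF assms(1)]) (use assms(2) that in \<open>simp add: cong_scalar_left\<close>)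
  then show ?thesis unfolding sterm_def by (intro arg_cong2[where f = "(/)"] sum.cong refl if_cong prod.cong) auto
qed

lemma sterm_1 [simp]: "sterm k s c 1 = 1"
  by (simp add: sterm_def del: One_nat_def)

lemma cnj_sterm:
  assumes "q > 0"
  shows "cnj (sterm k s c q) = sterm k s c q"
proof -
  let ?f = "\<lambda>a. if coprime a (int q) then \<Prod>i=1..s. gauss_S k q (a * c i) else 0"
  have "cnj (\<Sum>a\<in>{0..<int q}. ?f a) = (\<Sum>a\<in>{0..<int q}. ?f (- 1 * a + 0))"
    unfolding cnj_sum by (intro sum.cong refl) (auto simp: cnj_gauss_S[OF assms])
  also have "\<dots> = (\<Sum>a\<in>{0..<int q}. ?f a)"
    by (rule sum_residues_affine[OF periodic_coprime_prod]) (use assms in auto)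
  finally show ?thesis by (simp add: sterm_def)
qed

lemma sterm_mult:
  assumes "q > 0" "r > 0" "coprime q r" "k > 0"
  shows "sterm k s c (q * r) = sterm k s c q * sterm k s c r"
proof -
  let ?f = "\<lambda>q a. if coprime a (int q) then \<Prod>i=1..s. gauss_S k q (a * c i) else 0"
  have cop: "coprime (int q) (int r)" using assms(3) by simp
  have f: "?f (q * r) (u * int r + v * int q) = ?f q u * ?f r v" for u v
  proof -
    have "coprime (u * int r + v * int q) (int q) = coprime u (int q)"
      using cop by (metis coprime_commute coprime_iff_gcd_eq_1 coprime_mult_left_iff gcd_add_mult mult.commute add.commute gcd.commute)
    moreover have "coprime (u * int r + v * int q) (int r) = coprime v (int r)"
      using cop by (metis coprime_commute coprime_iff_gcd_eq_1 coprime_mult_left_iff gcd_add_mult mult.commute add.commute gcd.commute)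
    ultimately show ?thesis
      by (simp add: gauss_S_CRT[OF assms] prod.distrib)
  qed
  have "(\<Sum>a\<in>{0..<int q * int r}. ?f (q * r) a) = (\<Sum>u\<in>{0..<int q}. \<Sum>v\<in>{0..<int r}. ?f (q * r) (u * int r + v * int q))"
    by (rule sum_residues_CRT) (use assms cop periodic_coprime_prod[of "q * r"] in auto)
  also have "\<dots> = (\<Sum>u\<in>{0..<int q}. ?f q u) * (\<Sum>v\<in>{0..<int r}. ?f r v)"
    by (simp only: f sum_product)
  finally show ?thesis by (simp add: sterm_def power_mult_distrib)
qed

lemma gcd_mult_dvd_mult_gcd:
  fixes a b c :: int
  shows "gcd (a * b) c dvd gcd a c * gcd b c"
proof -
  let ?d = "gcd (a * b) c"
  have "?d dvd gcd a c * b" if "?d dvd a * b" "?d dvd c * b" for b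
  proof -
    have "?d dvd gcd (b * a) (b * c)" using that by (simp add: mult.commute)
    also have "gcd (b * a) (b * c) = \<bar>gcd a c * b\<bar>" by (subst gcd_mult_left) (simp add: abs_mult mult.commute)
    finally show ?thesis by simp
  qed
  then have "?d dvd gcd a c * b" "?d dvd gcd a c * c" by auto
  then have "?d dvd gcd (gcd a c * b) (gcd a c * c)" by simp
  then show ?thesis by (simp add: gcd_mult_left)
qed

lemma gcd_prod_dvd_prod_gcd:
  fixes g :: "'a \<Rightarrow> int"
  assumes "finite I"
  shows "gcd (\<Prod>i\<in>I. g i) c dvd (\<Prod>i\<in>I. gcd (g i) c)"
  using assms
proof (induction I rule: finite_induct)
  case (insert x F)
  have "gcd (g x * (\<Prod>i\<in>F. g i)) c dvd gcd (g x) c * gcd (\<Prod>i\<in>F. g i) c"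
    by (rule gcd_mult_dvd_mult_gcd)
  also have "\<dots> dvd gcd (g x) c * (\<Prod>i\<in>F. gcd (g i) c)"
    by (intro mult_dvd_mono insert.IH) auto
  finally show ?case using insert.hyps by simp
qed auto

text \<open>Induction with P g = gcd(P, g) lcm(P, g) up to sign: the lcm divides whatever P and g
  both divide, and gcd(P, g) divides R^n. The exponent n^2 is a convenient bound for 0 + 1 + ... +
  (n - 1).\<close>

lemma prod_dvd_of_gcd_dvd:
  fixes g :: "'a \<Rightarrow> int"
  assumes "finite I" "\<And>i. i \<in> I \<Longrightarrow> g i dvd q"
    and "\<And>i j. i \<in> I \<Longrightarrow> j \<in> I \<Longrightarrow> i \<noteq> j \<Longrightarrow> gcd (g i) (g j) dvd R"
  shows "(\<Prod>i\<in>I. g i) dvd R ^ (card I)\<^sup>2 * q"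
  using assms
proof (induction I rule: finite_induct)
  case (insert x F)
  let ?P = "\<Prod>i\<in>F. g i" and ?n = "card F"
  have IH: "?P dvd R ^ ?n\<^sup>2 * q" using insert by auto
  have "gcd ?P (g x) dvd (\<Prod>i\<in>F. gcd (g i) (g x))" by (rule gcd_prod_dvd_prod_gcd[OF insert.hyps(1)])
  also have "\<dots> dvd (\<Prod>i\<in>F. R)" using insert.prems(2) insert.hyps by (intro prod_dvd_prod) auto
  finally have 1: "gcd ?P (g x) dvd R ^ ?n" by simp
  have "lcm ?P (g x) dvd R ^ ?n\<^sup>2 * q" using IH insert.prems(1) by (auto intro: lcm_least)
  then have "gcd ?P (g x) * lcm ?P (g x) dvd R ^ ?n * (R ^ ?n\<^sup>2 * q)" by (intro mult_dvd_mono 1)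
  then have "?P * g x dvd R ^ (?n + ?n\<^sup>2) * q" by (simp add: power_add mult.assoc flip: abs_mult)
  also have "\<dots> dvd R ^ (card (insert x F))\<^sup>2 * q"
    using insert.hyps by (intro mult_dvd_mono le_imp_power_dvd) (auto simp: power2_eq_square)
  finally show ?case using insert.hyps by (simp add: mult.commute)
qed auto

text \<open>The constant depends on the coefficients only through \<open>R\<close>, which later
  makes the bound uniform in \<open>t\<close>. Each Gauss sum contributes gcd(c i, q)^(1/k), and by
  \<open>prod_dvd_of_gcd_dvd\<close> the product of these gcds is at most a constant times
  q.\<close>

lemma sterm_bound:
  assumes k: "k \<ge> 3" and s: "s \<ge> 3 * k" and R: "R > 0"
  obtains C where "C \<ge> 0" "\<And>c q. q > 0 \<Longrightarrow> (\<And>i j. i \<in> {1..s} \<Longrightarrow> j \<in> {1..s} \<Longrightarrow> i \<noteq> j \<Longrightarrow> gcd (c i) (c j) dvd R) \<Longrightarrow>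
    norm (sterm k s c q) \<le> C * real q powr (- 5/3)"
proof -
  obtain C where C: "C \<ge> 1" "\<And>q b. q > 0 \<Longrightarrow> norm (gauss_S k q b) ^ k \<le> C * real q ^ (k - 1) * real_of_int (gcd b (int q))"
    using gauss_S_bound[OF k] by blast
  define C1 where "C1 = C ^ s * real_of_int R ^ s\<^sup>2"
  have C1: "C1 \<ge> 1"
  proof -
    have "1 * 1 \<le> C ^ s * real_of_int R ^ s\<^sup>2"
      using C(1) R by (intro mult_mono one_le_power) auto
    then show ?thesis by (simp add: C1_def)
  qed
  have "norm (sterm k s c q) \<le> C1 * real q powr (- 5/3)"
    if q: "q > 0" and c: "\<And>i j. i \<in> {1..s} \<Longrightarrow> j \<in> {1..s} \<Longrightarrow> i \<noteq> j \<Longrightarrow> gcd (c i) (c j) dvd R" for c q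
  proof -
    have rq: "real q \<ge> 1" "real q > 0" using q by auto
    \<comment> \<open>((k - 1) s + 1) / k = s - s/k + 1/k \<le> s - 3 + 1/3 = s - 8/3. The sum over
      \<open>a\<close> adds 1 to this exponent and the division by q^s removes s, which leaves
      -5/3.\<close>
    define y where "y = C1 * real q powr (real s - 8/3)"
    have gp: "(\<Prod>i=1..s. real_of_int (gcd (c i) (int q))) \<le> real_of_int R ^ s\<^sup>2 * real q"
    proof -
      have "(\<Prod>i=1..s. gcd (c i) (int q)) dvd R ^ (card {1..s})\<^sup>2 * int q"
      proof (rule prod_dvd_of_gcd_dvd)
        fix i j assume "i \<in> {1..s}" "j \<in> {1..s}" "i \<noteq> j"
        then have "gcd (c i) (c j) dvd R" by (rule c)
        moreover have "gcd (gcd (c i) (int q)) (gcd (c j) (int q)) dvd gcd (c i) (c j)"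
          by (intro gcd_greatest) (meson gcd_dvd1 gcd_dvd2 dvd_trans)+
        ultimately show "gcd (gcd (c i) (int q)) (gcd (c j) (int q)) dvd R" by (rule dvd_trans[rotated])
      qed auto
      then have "(\<Prod>i=1..s. gcd (c i) (int q)) \<le> R ^ s\<^sup>2 * int q"
        using R q by (intro zdvd_imp_le) auto
      then have "real_of_int (\<Prod>i=1..s. gcd (c i) (int q)) \<le> real_of_int (R ^ s\<^sup>2 * int q)"
        by (simp only: of_int_le_iff)
      then show ?thesis by simp
    qed
    have prod_le: "norm (\<Prod>i=1..s. gauss_S k q (a * c i)) \<le> y" if a: "coprime a (int q)" for a
    proof -
      have "norm (\<Prod>i=1..s. gauss_S k q (a * c i)) ^ k = (\<Prod>i=1..s. norm (gauss_S k q (a * c i)) ^ k)"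
        by (simp add: prod_norm[symmetric] prod_power_distrib)
      also have "\<dots> \<le> (\<Prod>i=1..s. C * real q ^ (k - 1) * real_of_int (gcd (c i) (int q)))"
      proof (rule prod_mono)
        fix i
        have "gcd (a * c i) (int q) = gcd (c i) (int q)" using a by (simp add: gcd_mult_left_left_cancel coprime_commute)
        then show "0 \<le> norm (gauss_S k q (a * c i)) ^ k \<and> norm (gauss_S k q (a * c i)) ^ k \<le> C * real q ^ (k - 1) * real_of_int (gcd (c i) (int q))"
          using C(2)[OF q, of "a * c i"] by simp
      qed
      also have "\<dots> = C ^ s * real q ^ ((k - 1) * s) * (\<Prod>i=1..s. real_of_int (gcd (c i) (int q)))"
        by (simp add: prod.distrib power_mult power_mult_distrib)
      also have "\<dots> \<le> C ^ s * real q ^ ((k - 1) * s) * (real_of_int R ^ s\<^sup>2 * real q)"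
        using C(1) by (intro mult_left_mono gp) auto
      also have "\<dots> = C1 * real q ^ ((k - 1) * s + 1)" by (simp add: C1_def)
      also have "\<dots> = C1 * real q powr real ((k - 1) * s + 1)"
        using rq by (simp only: powr_realpow)
      also have "\<dots> \<le> C1 * real q powr ((real s - 8/3) * real k)"
      proof -
        have "real ((k - 1) * s + 1) = (real k - 1) * real s + 1" using k by (simp add: of_nat_diff)
        also have "\<dots> = real k * real s - real s + 1" by (simp add: algebra_simps)
        also have "\<dots> \<le> (real s - 8/3) * real k"
        proof -
          have "real s \<ge> 3 * real k" using s by (metis of_nat_le_iff of_nat_mult of_nat_numeral)
          moreover have "real k \<ge> 3" using k by simp
          ultimately show ?thesis by (simp add: algebra_simps)
        qed
        finally show ?thesis using C1 rq by (intro mult_left_mono powr_mono) auto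
      qed
      also have "\<dots> \<le> C1 ^ k * real q powr ((real s - 8/3) * real k)"
        using C1 k self_le_power[of C1 k] by (intro mult_right_mono) auto
      also have "\<dots> = y ^ k" using rq by (simp add: y_def power_mult_distrib powr_powr[symmetric] powr_realpow)
      finally have "norm (\<Prod>i=1..s. gauss_S k q (a * c i)) ^ k \<le> y ^ k" .
      moreover have "y \<ge> 0" "k > 0" using C1 k by (simp_all add: y_def)
      ultimately show ?thesis by (subst (asm) power_mono_iff) auto
    qed
    define X where "X = (\<Sum>a\<in>{0..<int q}. if coprime a (int q) then \<Prod>i=1..s. gauss_S k q (a * c i) else 0)"
    have "norm X \<le> (\<Sum>a\<in>{0..<int q}. y)"
      unfolding X_def
    proof (rule order.trans[OF norm_sum], rule sum_mono)
      fix a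
      have "y \<ge> 0" using C1 by (simp add: y_def)
      then show "norm (if coprime a (int q) then \<Prod>i=1..s. gauss_S k q (a * c i) else 0) \<le> y"
        using prod_le by auto
    qed
    then have X: "norm X \<le> real q * y" by simp
    have "norm (sterm k s c q) = norm X / real q ^ s"
      by (simp add: sterm_def X_def norm_divide norm_power)
    also have "\<dots> \<le> real q * y / real q ^ s"
      by (rule divide_right_mono[OF X]) simp
    also have "\<dots> = C1 * (real q * real q powr (real s - 8/3) * real q powr (- real s))"
    proof -
      have "real q powr (- real s) = inverse (real q ^ s)" using rq by (simp add: powr_minus powr_realpow)
      then show ?thesis by (simp only: y_def divide_inverse mult_ac)
    qed
    also have "real q * real q powr (real s - 8/3) * real q powr (- real s) = real q powr (1 + (real s - 8/3) + (- real s))"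
      unfolding powr_add using rq by simp
    also have "1 + (real s - 8/3) + (- real s) = - 5/3" by simp
    finally show ?thesis .
  qed
  then show ?thesis using that[of C1] C1 by simp
qed


section \<open>Bezout identities for integer polynomials\<close>

lemma poly_map_of_int: "poly (map_poly of_int f :: rat poly) (of_int t) = of_int (poly f t)"
  by (induction f) (simp_all add: map_poly_pCons)

lemma clear_denominators:
  fixes f :: "rat poly"
  obtains N :: int and g :: "int poly" where "N > 0" "map_poly of_int g = Polynomial.smult (of_int N) f"
proof -
  have "\<exists>N>0. \<exists>g :: int poly. map_poly of_int g = Polynomial.smult (of_int N) f"
  proof (induction f)
    case 0
    have "map_poly of_int (0 :: int poly) = Polynomial.smult (of_int 1) (0 :: rat poly)" by simp
    then show ?case by (metis zero_less_one)
  next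
    case (pCons a f)
    then obtain N g where N: "N > 0" "map_poly of_int (g :: int poly) = Polynomial.smult (of_int N) f" by blast
    obtain x y where xy: "quotient_of a = (x, y)" by fastforce
    have y: "y > 0" using xy quotient_of_denom_pos by blast
    have a: "a = of_int x / of_int y" using xy quotient_of_div by blast
    have "map_poly of_int (pCons (x * N) (Polynomial.smult y g)) = Polynomial.smult (of_int (N * y)) (pCons a f)"
    proof -
      have "map_poly of_int (Polynomial.smult y g) = Polynomial.smult (of_int y) (map_poly of_int g :: rat poly)"
        by (rule poly_eqI) (simp add: coeff_map_poly)
      then show ?thesis using y by (simp add: map_poly_pCons N(2) a mult.commute)
    qed
    moreover have "N * y > 0" using N y by simp
    ultimately show ?case by blast
  qed
  then show ?thesis using that by blast
qed

text \<open>A substitute for the resultant: every common divisor of f(t) and g(t) divides the one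
  integer \<open>R\<close>, whatever \<open>t\<close> is. The Bezout identity over the rationals is
  multiplied by common denominators of its coefficients.\<close>

lemma coprime_imp_int_bezout:
  fixes f g :: "int poly"
  assumes "coprime (map_poly of_int f :: rat poly) (map_poly of_int g)"
  obtains R :: int and u v :: "int poly" where "R > 0" "\<And>t. poly u t * poly f t + poly v t * poly g t = R"
proof -
  let ?f = "map_poly of_int f :: rat poly" and ?g = "map_poly of_int g :: rat poly"
  obtain a b where ab: "bezout_coefficients ?f ?g = (a, b)" by fastforce
  have bez: "a * ?f + b * ?g = 1"
    using bezout_coefficients[OF ab] assms by (simp add: coprime_iff_gcd_eq_1)
  obtain N u where u: "N > 0" "map_poly of_int (u :: int poly) = Polynomial.smult (of_int N) a" using clear_denominators by blast
  obtain M v where v: "M > 0" "map_poly of_int (v :: int poly) = Polynomial.smult (of_int M) b" using clear_denominators by blast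
  have "poly (Polynomial.smult M u) t * poly f t + poly (Polynomial.smult N v) t * poly g t = M * N" for t
  proof -
    have 1: "poly a (of_int t) * poly ?f (of_int t) + poly b (of_int t) * poly ?g (of_int t) = 1"
      using arg_cong[OF bez, of "\<lambda>p. poly p (of_int t)"] by simp
    have 2: "of_int (poly u t) = of_int N * poly a (of_int t)"
      using arg_cong[OF u(2), of "\<lambda>p. poly p (of_int t)"] by (simp add: poly_map_of_int)
    have 3: "of_int (poly v t) = of_int M * poly b (of_int t)"
      using arg_cong[OF v(2), of "\<lambda>p. poly p (of_int t)"] by (simp add: poly_map_of_int)
    have "(of_int (poly (Polynomial.smult M u) t * poly f t + poly (Polynomial.smult N v) t * poly g t) :: rat) =
        of_int (M * N) * (poly a (of_int t) * poly ?f (of_int t) + poly b (of_int t) * poly ?g (of_int t))"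
      by (simp add: poly_map_of_int 2 3 algebra_simps)
    also have "\<dots> = of_int (M * N)" by (simp only: 1 mult_1_right)
    finally show ?thesis by (simp only: of_int_eq_iff)
  qed
  moreover have "M * N > 0" using u v by simp
  ultimately show ?thesis using that by blast
qed

text \<open>In characteristic 0 the derivative is a nonzero polynomial of smaller degree, so an
  irreducible polynomial cannot divide it.\<close>

lemma irreducible_imp_coprime_pderiv:
  fixes f :: "int poly"
  assumes "irreducible (map_poly of_int f :: rat poly)" "degree f > 0"
  shows "coprime (map_poly of_int f :: rat poly) (map_poly of_int (pderiv f))"
proof -
  let ?f = "map_poly of_int f :: rat poly" and ?g = "map_poly of_int (pderiv f) :: rat poly"
  have deg: "degree (map_poly of_int p :: rat poly) = degree p" for p :: "int poly"
    by (rule degree_map_poly) simp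
  have "\<not> ?f dvd ?g"
  proof
    assume "?f dvd ?g"
    moreover have "degree (pderiv f) < degree f" using assms(2) by (simp add: degree_pderiv)
    moreover have "pderiv f \<noteq> 0" using assms(2) by (simp add: pderiv_eq_0_iff)
    then have "?g \<noteq> 0" by (simp add: poly_eq_iff coeff_map_poly)
    ultimately show False using dvd_imp_degree_le[of ?f ?g] by (simp add: deg)
  qed
  moreover have "prime_elem ?f" using assms(1) by (rule irreducible_imp_prime_elem)
  ultimately show ?thesis by (rule prime_elem_imp_coprime[rotated])
qed

subsection \<open>Numbers of solutions modulo prime powers\<close>

definition nsol :: "nat \<Rightarrow> nat \<Rightarrow> (nat \<Rightarrow> int) \<Rightarrow> nat \<Rightarrow> nat" where
  "nsol k s c q = card {x \<in> {1..s} \<rightarrow>\<^sub>E {0..<int q}. int q dvd (\<Sum>i=1..s. c i * x i ^ k)}"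

lemma sum_prod_gauss_S:
  assumes "q > 0"
  shows "(\<Sum>a\<in>{0..<int q}. \<Prod>i=1..s. gauss_S k q (a * c i)) = of_nat (q * nsol k s c q)"
proof -
  let ?X = "{1..s} \<rightarrow>\<^sub>E {0..<int q}" and ?F = "\<lambda>x. \<Sum>i=1..s. c i * x i ^ k"
  have fin: "finite ?X" by (intro finite_PiE) auto
  have e: "(\<Prod>i\<in>I. echar (int q) (a * c i * x i ^ k)) = echar (int q) ((\<Sum>i\<in>I. c i * x i ^ k) * a)"
    if "finite I" for a x and I :: "nat set"
    using that by (induction I rule: finite_induct) (simp_all add: echar_add algebra_simps)
  have "(\<Prod>i=1..s. gauss_S k q (a * c i)) = (\<Sum>x\<in>?X. echar (int q) (?F x * a))" for a
  proof -
    have "(\<Prod>i=1..s. gauss_S k q (a * c i)) = (\<Sum>x\<in>?X. \<Prod>i=1..s. echar (int q) (a * c i * x i ^ k))"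
      unfolding gauss_S_altdef[OF assms] by (rule prod_sum_PiE) auto
    then show ?thesis by (simp only: e finite_atLeastAtMost)
  qed
  then have "(\<Sum>a\<in>{0..<int q}. \<Prod>i=1..s. gauss_S k q (a * c i)) = (\<Sum>x\<in>?X. \<Sum>a\<in>{0..<int q}. echar (int q) (?F x * a))"
    by (subst sum.swap) simp
  also have "\<dots> = (\<Sum>x\<in>?X. if int q dvd ?F x then of_int (int q) else 0)"
    using assms by (simp only: sum_echar of_nat_0_less_iff)
  also have "\<dots> = (\<Sum>x\<in>{x\<in>?X. int q dvd ?F x}. of_int (int q))"
    using fin by (rule sum.inter_filter[symmetric])
  finally show ?thesis by (simp add: nsol_def mult.commute)
qed

lemma sum_multiples_prime:
  fixes f :: "int \<Rightarrow> 'a::comm_monoid_add"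
  assumes "p > 0" "q > 0"
  shows "(\<Sum>a\<in>{0..<p * q}. if p dvd a then f a else 0) = (\<Sum>v\<in>{0..<q}. f (p * v))"
proof -
  have "(\<Sum>a\<in>{0..<p * q}. if p dvd a then f a else 0) = (\<Sum>u\<in>{0..<p}. \<Sum>v\<in>{0..<q}. if p dvd u + p * v then f (u + p * v) else 0)"
    by (rule sum_residues_mult[OF assms])
  also have "\<dots> = (\<Sum>u\<in>{0}. \<Sum>v\<in>{0..<q}. if p dvd u + p * v then f (u + p * v) else 0)"
  proof (rule sum.mono_neutral_right)
    show "\<forall>i\<in>{0..<p} - {0}. (\<Sum>v\<in>{0..<q}. if p dvd i + p * v then f (i + p * v) else 0) = 0"
    proof
      fix i assume "i \<in> {0..<p} - {0}"
      then have "\<not> p dvd i" by (auto dest: zdvd_imp_le)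
      then have "\<not> p dvd i + p * v" for v by (simp add: dvd_add_left_iff)
      then show "(\<Sum>v\<in>{0..<q}. if p dvd i + p * v then f (i + p * v) else 0) = 0" by simp
    qed
  qed (use assms in auto)
  finally show ?thesis by simp
qed

lemma coprime_prime_power_iff:
  assumes "prime p" "n > 0"
  shows "coprime a (int (p ^ n)) \<longleftrightarrow> \<not> int p dvd a"
proof -
  have p: "prime (int p)" using assms by simp
  have "coprime a (int (p ^ n)) \<longleftrightarrow> coprime a (int p)" using assms(2) by simp
  also have "\<dots> \<longleftrightarrow> \<not> int p dvd a"
  proof
    assume "coprime a (int p)"
    then show "\<not> int p dvd a" using coprime_common_divisor[of a "int p" "int p"] p by auto
  next
    assume "\<not> int p dvd a"
    then show "coprime a (int p)" using prime_imp_coprime[OF p, of a] by (simp add: coprime_commute)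
  qed
  finally show ?thesis .
qed

text \<open>Sort the residues modulo p^n by their power of p: units give the new term, and multiples
  of p reduce to the modulus p^(n-1), each Gauss sum losing a factor p.\<close>

lemma sum_prod_gauss_S_prime_power:
  assumes p: "prime p"
  shows "(\<Sum>a\<in>{0..<int (p ^ n)}. \<Prod>i=1..s. gauss_S k (p ^ n) (a * c i)) = of_nat p ^ (n * s) * (\<Sum>j\<le>n. sterm k s c (p ^ j))"
proof (induction n)
  case 0
  have "{0..<int (p ^ 0)} = {0}" by auto
  moreover have "(\<Prod>i=1..s. gauss_S k (p ^ 0) (0 * c i)) = 1" by (simp del: One_nat_def)
  ultimately show ?case using sterm_1[of k s c] by (simp del: sterm_1 One_nat_def)
next
  case (Suc n)
  let ?q = "p ^ Suc n"
  let ?P = "\<lambda>m a. \<Prod>i=1..s. gauss_S k (p ^ m) (a * c i)"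
  have pp: "p > 0" "prime (int p)" using p by (auto simp: prime_gt_0_nat)
  have cop: "coprime a (int ?q) \<longleftrightarrow> \<not> int p dvd a" for a
    by (rule coprime_prime_power_iff[OF p]) simp
  have "(\<Sum>a\<in>{0..<int ?q}. ?P (Suc n) a) = (\<Sum>a\<in>{0..<int ?q}. (if coprime a (int ?q) then ?P (Suc n) a else 0) + (if int p dvd a then ?P (Suc n) a else 0))"
    by (intro sum.cong refl) (simp only: cop, simp)
  also have "\<dots> = of_nat ?q ^ s * sterm k s c ?q + (\<Sum>a\<in>{0..<int ?q}. if int p dvd a then ?P (Suc n) a else 0)"
    using pp by (simp add: sum.distrib sterm_def del: power_Suc of_nat_power)
  also have "(\<Sum>a\<in>{0..<int ?q}. if int p dvd a then ?P (Suc n) a else 0) = (\<Sum>v\<in>{0..<int (p ^ n)}. ?P (Suc n) (int p * v))"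
    using sum_multiples_prime[of "int p" "int (p ^ n)" "?P (Suc n)"] pp by simp
  also have "\<dots> = (\<Sum>v\<in>{0..<int (p ^ n)}. of_nat p ^ s * ?P n v)"
  proof (intro sum.cong refl)
    fix v
    have "gauss_S k (p ^ Suc n) (int p * v * c i) = of_nat p * gauss_S k (p ^ n) (v * c i)" for i
      using gauss_S_scale[of p "p ^ n" k "v * c i"] pp by (simp add: mult.assoc)
    then show "?P (Suc n) (int p * v) = of_nat p ^ s * ?P n v" by (simp add: prod.distrib del: power_Suc)
  qed
  also have "\<dots> = of_nat p ^ s * (of_nat p ^ (n * s) * (\<Sum>j\<le>n. sterm k s c (p ^ j)))"
    by (simp only: sum_distrib_left[symmetric] Suc.IH)
  finally show ?case by (simp add: algebra_simps power_add power_mult power_mult_distrib)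
qed

text \<open>Partial sums of the local series are normalised solution counts, so a lower bound for
  \<open>nsol\<close> is a lower bound for the p-adic density.\<close>

lemma sum_sterm_prime_powers:
  assumes p: "prime p"
  shows "(\<Sum>j\<le>n. sterm k s c (p ^ j)) = of_real (real (p ^ n) * real (nsol k s c (p ^ n)) / real p ^ (n * s))"
proof -
  have pp: "p > 0" using p by (auto simp: prime_gt_0_nat)
  have "of_nat p ^ (n * s) * (\<Sum>j\<le>n. sterm k s c (p ^ j)) = of_nat (p ^ n * nsol k s c (p ^ n))"
    using sum_prod_gauss_S_prime_power[OF p, where s = s and k = k and c = c and n = n] sum_prod_gauss_S[where q = "p ^ n" and s = s and k = k and c = c] pp by simp
  then show ?thesis using pp by (simp add: field_simps)
qed

subsection \<open>Lifting \<open>k\<close>-th powers\<close>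

lemma one_plus_power_expand:
  fixes X :: int
  shows "\<exists>z. (1 + X) ^ n = 1 + int n * X + int (n choose 2) * X\<^sup>2 + X ^ 3 * z"
proof (induction n)
  case (Suc n)
  then obtain z where z: "(1 + X) ^ n = 1 + int n * X + int (n choose 2) * X\<^sup>2 + X ^ 3 * z" by blast
  have "(1 + X) ^ Suc n = (1 + X) * (1 + int n * X + int (n choose 2) * X\<^sup>2 + X ^ 3 * z)" by (simp add: z)
  also have "\<dots> = 1 + int (Suc n) * X + int (n + (n choose 2)) * X\<^sup>2 + X ^ 3 * (int (n choose 2) + (1 + X) * z)"
    by (simp add: algebra_simps power2_eq_square power3_eq_cube)
  also have "n + (n choose 2) = Suc n choose 2" by (simp add: numeral_2_eq_2)
  finally show ?case by blast
qed (auto intro: exI[of _ 0] simp: numeral_2_eq_2)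

text \<open>After the linear term everything must vanish modulo p^(b+2). For the quadratic term this
  holds because p divides the binomial coefficient if p is odd, and because 2 b \<ge> b + 2 if p =
  2; this is why 2 needs a larger \<open>b\<close>.\<close>

lemma one_plus_power_prime:
  assumes p: "prime p" and b: "b \<ge> 1" "p = 2 \<Longrightarrow> b \<ge> 2"
  shows "\<exists>w'. (1 + int p ^ b * w) ^ p = 1 + int p ^ (b + 1) * w' \<and> [w' = w] (mod int p)"
proof -
  let ?X = "int p ^ b * w"
  obtain z where z: "(1 + ?X) ^ p = 1 + int p * ?X + int (p choose 2) * ?X\<^sup>2 + ?X ^ 3 * z"
    using one_plus_power_expand by blast
  have "int p ^ (b + 2) dvd int (p choose 2) * ?X\<^sup>2"
  proof (cases "p = 2")
    case True
    have "int p ^ (b + 2) dvd int p ^ (b * 2)" using b True by (intro le_imp_power_dvd) auto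
    then show ?thesis by (simp add: power_mult_distrib power_mult)
  next
    case False
    then have "p > 2" using p prime_ge_2_nat[OF p] by linarith
    then have "p dvd (p choose 2)" using p by (intro dvd_choose_prime) auto
    then have "int p * int p ^ (b * 2) dvd int (p choose 2) * ?X\<^sup>2"
      by (intro mult_dvd_mono) (auto simp: power_mult_distrib power_mult)
    moreover have "int p ^ (b + 2) dvd int p * int p ^ (b * 2)"
      using b by (subst power_Suc[symmetric], intro le_imp_power_dvd) auto
    ultimately show ?thesis by (rule dvd_trans[rotated])
  qed
  moreover have "int p ^ (b + 2) dvd ?X ^ 3 * z"
  proof -
    have "int p ^ (b + 2) dvd int p ^ (b * 3)" using b by (intro le_imp_power_dvd) auto
    then show ?thesis by (simp add: power_mult_distrib power_mult)
  qed
  ultimately have "int p ^ (b + 2) dvd int (p choose 2) * ?X\<^sup>2 + ?X ^ 3 * z" by (rule dvd_add)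
  then obtain y where y: "int (p choose 2) * ?X\<^sup>2 + ?X ^ 3 * z = int p ^ (b + 2) * y" by (elim dvdE)
  have "(1 + ?X) ^ p = 1 + int p ^ (b + 1) * (w + int p * y)"
    using z y by (simp add: algebra_simps)
  moreover have "[w + int p * y = w] (mod int p)" by (simp add: cong_def)
  ultimately show ?thesis by blast
qed

lemma one_plus_power_prime_power:
  assumes p: "prime p" and b: "b \<ge> 1" "p = 2 \<and> T > 0 \<Longrightarrow> b \<ge> 2"
  shows "\<exists>w'. (1 + int p ^ b * w) ^ (p ^ T) = 1 + int p ^ (b + T) * w' \<and> [w' = w] (mod int p)"
  using b(2)
proof (induction T)
  case 0
  show ?case by auto
next
  case (Suc T)
  obtain w' where w': "(1 + int p ^ b * w) ^ (p ^ T) = 1 + int p ^ (b + T) * w'" "[w' = w] (mod int p)"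
    using Suc by auto
  obtain w'' where w'': "(1 + int p ^ (b + T) * w') ^ p = 1 + int p ^ (b + T + 1) * w''" "[w'' = w'] (mod int p)"
  proof -
    have "b + T \<ge> 1" "p = 2 \<Longrightarrow> b + T \<ge> 2" using b(1) Suc.prems by auto
    from one_plus_power_prime[OF p this, of w'] show ?thesis using that by blast
  qed
  have "(1 + int p ^ b * w) ^ (p ^ Suc T) = ((1 + int p ^ b * w) ^ (p ^ T)) ^ p"
    by (simp add: power_mult[symmetric] mult.commute)
  also have "\<dots> = 1 + int p ^ (b + Suc T) * w''" by (simp only: w'(1) w''(1)) simp
  finally show ?case using w''(2) w'(2) cong_trans by blast
qed

text \<open>Hensel lifting for k-th powers when p may divide \<open>k\<close>: a factor 1 + p^(n-T)
  w corrects \<open>z\<close>. Its k-th power is 1 + p^n k0 w modulo p^(n+1), so w is found from a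
  linear congruence modulo p.\<close>

lemma kth_power_lift:
  assumes p: "prime p" and k: "k = p ^ T * k0" "\<not> p dvd k0"
    and G: "G \<ge> T + 1" "p = 2 \<and> T > 0 \<Longrightarrow> G \<ge> T + 2"
    and u: "\<not> int p dvd u" and y: "\<not> int p dvd y" and Y: "[Y = u * y ^ k] (mod int p ^ G)"
  shows "\<exists>z. [Y = u * z ^ k] (mod int p ^ n)"
proof -
  have pp: "prime (int p)" "int p > 0" using p by (auto simp: prime_gt_0_nat)
  have "\<exists>z. \<not> int p dvd z \<and> [Y = u * z ^ k] (mod int p ^ (G + m))" for m
  proof (induction m)
    case 0 then show ?case using y Y by auto
  next
    case (Suc m)
    then obtain z where z: "\<not> int p dvd z" "[Y = u * z ^ k] (mod int p ^ (G + m))" by blast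
    define n where "n = G + m"
    obtain D where D: "Y = u * z ^ k + int p ^ n * D"
      using z(2) unfolding n_def by (metis cong_iff_lin mult.commute cong_sym)
    have "\<not> int p dvd u * z ^ k * int k0"
      using u z(1) k(2) pp by (simp add: prime_dvd_mult_iff prime_dvd_power_iff) (metis prime_dvd_power pp(1))
    then have "coprime (u * z ^ k * int k0) (int p)" using pp prime_imp_coprime coprime_commute by blast
    then obtain w0 where w0: "[u * z ^ k * int k0 * w0 = 1] (mod int p)" using cong_solve_coprime_int by blast
    \<comment> \<open>\<open>D\<close> is the error at precision p^n, and \<open>w0\<close> inverts
      the coefficient u z^k k0 with which the correction enters.\<close>
    define w where "w = w0 * D"
    \<comment> \<open>Raising to the power p^T increases the exponent by T, so the correction has to
      start at p^(n-T). For p = 2 and T > 0 the hypothesis on \<open>G\<close> keeps n - T \<ge>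
      2.\<close>
    define b where "b = n - T"
    have b: "b \<ge> 1" "p = 2 \<and> T > 0 \<Longrightarrow> b \<ge> 2" "b + T = n" using G by (auto simp: b_def n_def)
    obtain w' where w': "(1 + int p ^ b * w) ^ (p ^ T) = 1 + int p ^ n * w'" "[w' = w] (mod int p)"
      using one_plus_power_prime_power[OF p b(1,2), where w = w] b(3) by auto
    obtain z' where z': "(1 + int p ^ n * w') ^ k0 = 1 + int k0 * (int p ^ n * w') + (int p ^ n * w')\<^sup>2 * z'"
      using power_add_expand[of 1 "int p ^ n * w'" k0] by auto
    define Z where "Z = z * (1 + int p ^ b * w)"
    have Zk: "Z ^ k = z ^ k * (1 + int p ^ n * (int k0 * w' + int p ^ n * (w'\<^sup>2 * z')))"
    proof -
      have "Z ^ k = z ^ k * ((1 + int p ^ b * w) ^ (p ^ T)) ^ k0"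
        by (simp add: Z_def power_mult_distrib k(1) power_mult)
      also have "\<dots> = z ^ k * (1 + int k0 * (int p ^ n * w') + (int p ^ n * w')\<^sup>2 * z')"
        by (simp only: w'(1) z')
      finally show ?thesis by (simp add: algebra_simps power2_eq_square)
    qed
    have nZ: "\<not> int p dvd Z"
    proof
      assume "int p dvd Z"
      then have "int p dvd 1 + int p ^ b * w" using z(1) pp by (simp add: Z_def prime_dvd_mult_iff)
      moreover have "int p dvd int p ^ b * w" using b(1) by simp
      ultimately have "int p dvd 1" by (metis dvd_add_left_iff)
      then show False using pp by simp
    qed
    have "int p dvd D - u * z ^ k * (int k0 * w' + int p ^ n * (w'\<^sup>2 * z'))"
    proof -
      have "[u * z ^ k * (int k0 * w' + int p ^ n * (w'\<^sup>2 * z')) = u * z ^ k * (int k0 * w + 0)] (mod int p)"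
        using w'(2) b G by (intro cong_mult cong_add cong_refl) (auto simp: cong_0_iff n_def)
      also have "u * z ^ k * (int k0 * w + 0) = (u * z ^ k * int k0 * w0) * D" by (simp add: w_def)
      also have "[(u * z ^ k * int k0 * w0) * D = 1 * D] (mod int p)" by (intro cong_mult w0 cong_refl)
      finally have "[D = u * z ^ k * (int k0 * w' + int p ^ n * (w'\<^sup>2 * z'))] (mod int p)" by (simp add: cong_sym)
      then show ?thesis by (simp add: cong_iff_dvd_diff)
    qed
    then obtain e where e: "D - u * z ^ k * (int k0 * w' + int p ^ n * (w'\<^sup>2 * z')) = int p * e" by (elim dvdE)
    have "Y - u * Z ^ k = int p ^ n * (D - u * z ^ k * (int k0 * w' + int p ^ n * (w'\<^sup>2 * z')))"
      by (simp add: D Zk algebra_simps)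
    also have "\<dots> = int p ^ (G + Suc m) * e" by (simp only: e) (simp add: n_def)
    finally have "[Y = u * Z ^ k] (mod int p ^ (G + Suc m))" by (simp add: cong_iff_dvd_diff)
    then show ?case using nZ by blast
  qed
  then obtain z where "[Y = u * z ^ k] (mod int p ^ (G + n))" by blast
  then have "[Y = u * z ^ k] (mod int p ^ n)" by (rule cong_dvd_modulus) (simp add: le_imp_power_dvd)
  then show ?thesis by blast
qed


text \<open>Relative to the term of exact order E at \<open>i0\<close>, the congruence has precision
  \<open>G\<close>, which is what \<open>kth_power_lift\<close> asks for. Leaving E free means that
  the coefficients need not be normalised.\<close>

definition psol :: "nat \<Rightarrow> nat \<Rightarrow> nat \<Rightarrow> nat \<Rightarrow> (nat \<Rightarrow> int) \<Rightarrow> bool" where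
  "psol p G k s c \<longleftrightarrow> (\<exists>x i0 E. i0 \<in> {1..s} \<and> int p ^ E dvd c i0 * x i0 ^ k \<and> \<not> int p ^ (E + 1) dvd c i0 * x i0 ^ k \<and>
     int p ^ (E + G) dvd (\<Sum>i=1..s. c i * x i ^ k))"

text \<open>The s - 1 variables other than \<open>i0\<close> can be moved freely by multiples of
  p^L. The variable at \<open>i0\<close> is then recovered by lifting, since its term is p^E times a
  unit and is prescribed correctly modulo p^(E+G).\<close>

lemma nsol_lower_bound:
  assumes p: "prime p" and k: "k = p ^ T * k0" "\<not> p dvd k0"
    and G: "G \<ge> T + 1" "p = 2 \<and> T > 0 \<Longrightarrow> G \<ge> T + 2"
    and sol: "psol p G k s c"
  shows "\<exists>L. \<forall>n\<ge>L. p ^ ((n - L) * (s - 1)) \<le> nsol k s c (p ^ n)"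
proof -
  have pp: "prime (int p)" "int p > 0" using p by (auto simp: prime_gt_0_nat)
  have p_nu: "\<not> is_unit (int p)" using pp(1) not_prime_unit by blast
  obtain x i0 E where x: "i0 \<in> {1..s}" "int p ^ E dvd c i0 * x i0 ^ k" "\<not> int p ^ (E + 1) dvd c i0 * x i0 ^ k"
    "int p ^ (E + G) dvd (\<Sum>i=1..s. c i * x i ^ k)"
    using sol unfolding psol_def by blast
  have k_pos: "k > 0" using k pp by (cases k0) auto
  have "c i0 * x i0 ^ k \<noteq> 0" using x(3) by force
  then have nz: "c i0 \<noteq> 0" "x i0 \<noteq> 0" using zero_power[OF k_pos, where 'a = int] by force+
  obtain u where u: "c i0 = int p ^ multiplicity (int p) (c i0) * u" "\<not> int p dvd u"
    using multiplicity_decompose'[OF nz(1) p_nu] by blast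
  obtain y where y: "x i0 = int p ^ multiplicity (int p) (x i0) * y" "\<not> int p dvd y"
    using multiplicity_decompose'[OF nz(2) p_nu] by blast
  define e f where "e = multiplicity (int p) (c i0)" and "f = multiplicity (int p) (x i0)"
  have cx: "c i0 * x i0 ^ k = int p ^ (e + f * k) * (u * y ^ k)"
    by (subst u(1), subst y(1)) (simp add: e_def f_def power_mult_distrib power_add power_mult)
  have nuy: "\<not> int p dvd u * y ^ k"
    using u(2) y(2) pp(1) by (metis prime_dvd_mult_iff prime_dvd_power)
  have E: "E = e + f * k"
  proof (rule antisym)
    show "E \<le> e + f * k"
    proof (rule ccontr)
      assume "\<not> E \<le> e + f * k"
      then have "int p ^ (e + f * k + 1) dvd int p ^ (e + f * k) * (u * y ^ k)"
        by (intro dvd_trans[OF le_imp_power_dvd x(2)[unfolded cx]]) simp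
      then show False using nuy pp(2) by simp
    qed
    show "e + f * k \<le> E"
    proof (rule ccontr)
      assume "\<not> e + f * k \<le> E"
      then have "int p ^ (E + 1) dvd int p ^ (e + f * k)" by (intro le_imp_power_dvd) auto
      then have "int p ^ (E + 1) dvd int p ^ (e + f * k) * (u * y ^ k)" by (rule dvd_mult2)
      then show False using x(3) unfolding cx by blast
    qed
  qed
  define L where "L = E + G"
  let ?I = "{1..s} - {i0}"
  have "p ^ ((n - L) * (s - 1)) \<le> nsol k s c (p ^ n)" if n: "n \<ge> L" for n
  proof -
    define Q where "Q = int p ^ n"
    have Q: "Q > 0" using pp by (simp add: Q_def)
    let ?B = "?I \<rightarrow>\<^sub>E {0..<int p ^ (n - L)}"
    let ?S = "{x \<in> {1..s} \<rightarrow>\<^sub>E {0..<int (p ^ n)}. int (p ^ n) dvd (\<Sum>i=1..s. c i * x i ^ k)}"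
    define X where "X v i = (x i + int p ^ L * v i) mod Q" for v i
    have "\<exists>z. Q dvd c i0 * z ^ k + (\<Sum>i\<in>?I. c i * X v i ^ k)" for v
    proof -
      \<comment> \<open>The value that the term at \<open>i0\<close> has to take. It agrees with
        \<open>c i0 * x i0 ^ k\<close> modulo p^L, so it is p^E times a number congruent to u y^k
        modulo p^G.\<close>
      let ?Y = "- (\<Sum>i\<in>?I. c i * X v i ^ k)"
      have Xc: "[X v i = x i] (mod int p ^ L)" for i
      proof -
        have "int p ^ L dvd Q" using n by (simp add: Q_def le_imp_power_dvd)
        then have "[X v i = x i + int p ^ L * v i] (mod int p ^ L)"
          unfolding X_def by (meson cong_dvd_modulus cong_mod_left cong_refl)
        also have "[x i + int p ^ L * v i = x i] (mod int p ^ L)" by (simp add: cong_def)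
        finally show ?thesis .
      qed
      have "[(\<Sum>i\<in>?I. c i * X v i ^ k) = (\<Sum>i\<in>?I. c i * x i ^ k)] (mod int p ^ L)"
        by (intro cong_sum cong_mult cong_refl cong_pow Xc)
      then have 1: "int p ^ L dvd (\<Sum>i\<in>?I. c i * X v i ^ k) - (\<Sum>i\<in>?I. c i * x i ^ k)" by (simp add: cong_iff_dvd_diff)
      have "(\<Sum>i=1..s. c i * x i ^ k) = c i0 * x i0 ^ k + (\<Sum>i\<in>?I. c i * x i ^ k)"
        using x(1) by (simp add: sum.remove)
      then have 2: "int p ^ L dvd c i0 * x i0 ^ k + (\<Sum>i\<in>?I. c i * x i ^ k)" using x(4) by (simp add: L_def)
      have "int p ^ L dvd c i0 * x i0 ^ k - ?Y" using dvd_add[OF 1 2] by (simp add: algebra_simps)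
      then have 3: "int p ^ E * int p ^ G dvd int p ^ E * (u * y ^ k) - ?Y" by (simp add: cx E L_def power_add)
      then have "int p ^ E dvd int p ^ E * (u * y ^ k) - ?Y" by (rule dvd_mult_left)
      then have "int p ^ E dvd ?Y" by (metis dvd_diff_commute dvd_triv_left dvd_diff_left_iff)
      then obtain Y' where Y': "?Y = int p ^ E * Y'" by (elim dvdE)
      have "int p ^ E * int p ^ G dvd int p ^ E * (u * y ^ k - Y')" using 3 by (simp only: Y' right_diff_distrib)
      then have "int p ^ G dvd u * y ^ k - Y'" using pp by simp
      then have "[Y' = u * y ^ k] (mod int p ^ G)" by (simp add: cong_iff_dvd_diff dvd_diff_commute)
      then obtain z where z: "[Y' = u * z ^ k] (mod int p ^ n)"
        using kth_power_lift[OF p k G u(2) y(2)] by blast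
      have "c i0 * (int p ^ f * z) ^ k = int p ^ E * (u * z ^ k)"
        by (subst u(1)) (simp add: e_def[symmetric] E power_mult_distrib power_add power_mult)
      then have "c i0 * (int p ^ f * z) ^ k - ?Y = int p ^ E * (u * z ^ k - Y')" by (simp only: Y' right_diff_distrib)
      moreover have "Q dvd u * z ^ k - Y'" using z by (simp add: Q_def cong_iff_dvd_diff dvd_diff_commute)
      ultimately have "Q dvd c i0 * (int p ^ f * z) ^ k - ?Y" by simp
      then show ?thesis by (intro exI[of _ "int p ^ f * z"]) simp
    qed
    then obtain Z where Z: "\<And>v. Q dvd c i0 * Z v ^ k + (\<Sum>i\<in>?I. c i * X v i ^ k)" by metis
    define F where "F v = (\<lambda>i\<in>{1..s}. if i = i0 then Z v mod Q else X v i)" for v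
    have sub: "F ` ?B \<subseteq> ?S"
    proof (rule image_subsetI)
      fix v
      have "[Z v mod Q = Z v] (mod Q)" by (simp add: cong_def)
      then have "[c i0 * (Z v mod Q) ^ k + (\<Sum>i\<in>?I. c i * X v i ^ k) = c i0 * Z v ^ k + (\<Sum>i\<in>?I. c i * X v i ^ k)] (mod Q)"
        by (intro cong_add cong_mult cong_refl cong_pow)
      then have "Q dvd c i0 * (Z v mod Q) ^ k + (\<Sum>i\<in>?I. c i * X v i ^ k)"
        using Z cong_dvd_iff by blast
      moreover have "(\<Sum>i=1..s. c i * F v i ^ k) = c i0 * F v i0 ^ k + (\<Sum>i\<in>?I. c i * F v i ^ k)"
        using x(1) by (simp add: sum.remove)
      then have "(\<Sum>i=1..s. c i * F v i ^ k) = c i0 * (Z v mod Q) ^ k + (\<Sum>i\<in>?I. c i * X v i ^ k)"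
        using x(1) by (simp add: F_def)
      ultimately have "Q dvd (\<Sum>i=1..s. c i * F v i ^ k)" by simp
      moreover have "F v \<in> {1..s} \<rightarrow>\<^sub>E {0..<Q}"
        unfolding F_def by (rule restrict_PiE_iff[THEN iffD2]) (use Q in \<open>auto simp: X_def\<close>)
      ultimately show "F v \<in> ?S" by (simp add: Q_def)
    qed
    have inj: "inj_on F ?B"
    proof (rule inj_onI)
      fix v w assume v: "v \<in> ?B" and w: "w \<in> ?B" and eq: "F v = F w"
      show "v = w"
      proof (rule PiE_ext[OF v w])
        fix i assume i: "i \<in> ?I"
        have "F v i = F w i" using eq by simp
        then have "X v i = X w i" using i by (simp add: F_def)
        then have "[x i + int p ^ L * v i = x i + int p ^ L * w i] (mod Q)" by (simp add: X_def cong_def)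
        then have "Q dvd int p ^ L * (v i - w i)" by (simp add: cong_iff_dvd_diff algebra_simps)
        moreover have "Q = int p ^ L * int p ^ (n - L)" using n by (simp add: Q_def power_add[symmetric])
        ultimately have "int p ^ (n - L) dvd v i - w i" using pp by simp
        then have "[v i = w i] (mod int p ^ (n - L))" by (simp add: cong_iff_dvd_diff)
        moreover have "v i \<in> {0..<int p ^ (n - L)}" "w i \<in> {0..<int p ^ (n - L)}" using v w i by (auto simp: PiE_iff)
        ultimately show "v i = w i" by (simp add: cong_def)
      qed
    qed
    have fin: "finite ?S" by (rule finite_subset[of _ "{1..s} \<rightarrow>\<^sub>E {0..<int (p ^ n)}"]) (blast, intro finite_PiE, auto)
    have "card ?B = p ^ ((n - L) * (s - 1))"
      using x(1) by (simp add: card_PiE power_mult nat_power_eq)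
    moreover have "card ?B \<le> card ?S" by (rule card_inj_on_le[OF inj sub fin])
    ultimately show ?thesis unfolding nsol_def by simp
  qed
  then show ?thesis by blast
qed

subsection \<open>Solubility of diagonal forms modulo prime powers\<close>

text \<open>The unit term at \<open>i0\<close> is the one that lifting will move. The other
  coefficients may be divisible by \<open>p\<close>, and a solution may use them to repair the sum
  modulo higher powers.\<close>

definition unit_sol :: "nat \<Rightarrow> nat \<Rightarrow> nat \<Rightarrow> 'a set \<Rightarrow> ('a \<Rightarrow> int) \<Rightarrow> bool" where
  "unit_sol p G k I w \<longleftrightarrow> (\<exists>y i0. i0 \<in> I \<and> \<not> int p dvd w i0 \<and> \<not> int p dvd y i0 \<and>
     int p ^ G dvd (\<Sum>i\<in>I. w i * y i ^ k))"

lemma unit_sol_mono: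
  assumes "unit_sol p G k J w" "J \<subseteq> I" "finite I" "k > 0"
  shows "unit_sol p G k I w"
proof -
  obtain y i0 where y: "i0 \<in> J" "\<not> int p dvd w i0" "\<not> int p dvd y i0" "int p ^ G dvd (\<Sum>i\<in>J. w i * y i ^ k)"
    using assms(1) unfolding unit_sol_def by blast
  define z where "z i = (if i \<in> J then y i else 0)" for i
  have "(\<Sum>i\<in>I. w i * z i ^ k) = (\<Sum>i\<in>J. w i * z i ^ k)"
    using assms by (intro sum.mono_neutral_right) (auto simp: z_def zero_power)
  also have "\<dots> = (\<Sum>i\<in>J. w i * y i ^ k)" by (intro sum.cong) (auto simp: z_def)
  finally have "int p ^ G dvd (\<Sum>i\<in>I. w i * z i ^ k)" using y(4) by simp
  moreover have "i0 \<in> I" "\<not> int p dvd z i0" using y assms(2) by (auto simp: z_def)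
  ultimately show ?thesis using y(2) unfolding unit_sol_def by blast
qed

text \<open>All variables are taken to be 0 or 1, so the degree disappears and only a zero-sum
  problem for the coefficients remains.\<close>

lemma unit_sol_subset_sum:
  assumes "prime p" "B \<subseteq> I" "finite I" "k > 0" "i0 \<in> B" "\<not> int p dvd w i0" "int p ^ G dvd (\<Sum>i\<in>B. w i)"
  shows "unit_sol p G k I w"
proof (rule unit_sol_mono[OF _ assms(2-4)])
  have "\<not> int p dvd 1" using assms(1) by (simp add: prime_nat_iff)
  then show "unit_sol p G k B w"
    using assms unfolding unit_sol_def by (intro exI[of _ "\<lambda>_. 1"] exI[of _ i0]) simp
qed

section \<open>Zero-sum subsets and growth of value sets\<close>

text \<open>Pigeonhole: two of the N + 1 prefix sums agree modulo N.\<close>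

lemma zero_sum_interval:
  fixes g :: "nat \<Rightarrow> int"
  assumes "N > 0"
  shows "\<exists>a b. a < b \<and> b \<le> N \<and> int N dvd (\<Sum>i\<in>{a..<b}. g i)"
proof -
  define S where "S n = (\<Sum>i\<in>{0..<n}. g i) mod int N" for n
  have "S ` {0..N} \<subseteq> {0..<int N}" using assms by (auto simp: S_def)
  then have "card (S ` {0..N}) \<le> card {0..<int N}" by (rule card_mono[rotated]) simp
  then have "\<not> inj_on S {0..N}" using card_image[of S "{0..N}"] by auto
  then obtain x y where xy: "x \<in> {0..N}" "y \<in> {0..N}" "S x = S y" "x \<noteq> y" unfolding inj_on_def by blast
  define a b where "a = min x y" and "b = max x y"
  have ab: "a < b" "b \<le> N" "S a = S b" using xy by (auto simp: a_def b_def min_def max_def)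
  have "[(\<Sum>i\<in>{0..<a}. g i) = (\<Sum>i\<in>{0..<b}. g i)] (mod int N)" using ab(3) by (simp add: S_def cong_def)
  moreover have "(\<Sum>i\<in>{0..<b}. g i) = (\<Sum>i\<in>{0..<a}. g i) + (\<Sum>i\<in>{a..<b}. g i)"
    using ab by (simp add: sum.atLeastLessThan_concat)
  ultimately have "int N dvd (\<Sum>i\<in>{a..<b}. g i)"
    by (simp add: cong_iff_dvd_diff dvd_diff_commute)
  then show ?thesis using ab by blast
qed

lemma zero_sum_subset:
  fixes g :: "'a \<Rightarrow> int"
  assumes "finite J" "card J \<ge> N" "N > 0"
  shows "\<exists>B\<subseteq>J. B \<noteq> {} \<and> int N dvd (\<Sum>i\<in>B. g i)"
proof -
  obtain f where f: "bij_betw f {0..<card J} J" using ex_bij_betw_nat_finite[OF assms(1)] by blast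
  obtain a b where ab: "a < b" "b \<le> N" "int N dvd (\<Sum>i\<in>{a..<b}. g (f i))"
    using zero_sum_interval[OF assms(3), of "g \<circ> f"] by auto
  have sub: "{a..<b} \<subseteq> {0..<card J}" using ab assms(2) by auto
  have "inj_on f {a..<b}" using f sub by (meson bij_betw_imp_inj_on inj_on_subset)
  then have "(\<Sum>i\<in>f ` {a..<b}. g i) = (\<Sum>i\<in>{a..<b}. g (f i))" by (simp add: sum.reindex)
  moreover have "f ` {a..<b} \<subseteq> J" using f sub by (auto simp: bij_betw_def)
  moreover have "f ` {a..<b} \<noteq> {}" using ab by simp
  ultimately show ?thesis using ab(3) by (intro exI[of _ "f ` {a..<b}"]) simp
qed

lemma unit_sol_many_units:
  assumes "prime p" "finite I" "J \<subseteq> I" "card J \<ge> p ^ G" "k > 0" "\<And>i. i \<in> J \<Longrightarrow> \<not> int p dvd w i"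
  shows "unit_sol p G k I w"
proof -
  have "finite J" "p ^ G > 0" using assms finite_subset by (auto simp: prime_gt_0_nat)
  then obtain B where B: "B \<subseteq> J" "B \<noteq> {}" "int (p ^ G) dvd (\<Sum>i\<in>B. w i)"
    using zero_sum_subset[of J "p ^ G" w] assms(4) by blast
  then obtain i0 where "i0 \<in> B" by blast
  then show ?thesis using unit_sol_subset_sum[of p B I k i0 w G] B assms by auto
qed

lemma fermat_int:
  assumes "prime p"
  shows "[x ^ p = x] (mod int p)"
proof -
  have pp: "int p > 0" "p > 0" using assms by (auto simp: prime_gt_0_nat)
  define n where "n = nat (x mod int p)"
  have n: "int n = x mod int p" using pp by (simp add: n_def)
  have "[n ^ p = n] (mod p)"
  proof (cases "p dvd n")
    case True
    then have "p dvd n ^ p" using pp by (simp add: dvd_power_same dvd_trans[OF True] dvd_power)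
    then show ?thesis using True by (simp add: cong_def dvd_eq_mod_eq_0)
  next
    case False
    then have "[n * n ^ (p - 1) = n * 1] (mod p)" using fermat_theorem[OF assms] by (intro cong_mult cong_refl)
    then show ?thesis using pp by (simp add: power_eq_if[of n p])
  qed
  then have "[int n ^ p = int n] (mod int p)" by (metis cong_int_iff of_nat_power)
  moreover have "[int n = x] (mod int p)" by (simp add: n cong_def)
  ultimately show ?thesis using cong_pow cong_sym cong_trans by meson
qed

text \<open>Modulo \<open>p\<close> only the p-free part \<open>k0\<close> of the exponent matters.
  This improves the number of k-th power residues from at least (p-1)/k to at least
  (p-1)/k0.\<close>

lemma fermat_int_power:
  assumes "prime p"
  shows "[x ^ (p ^ T * k0) = x ^ k0] (mod int p)"
proof (induction T)
  case (Suc T)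
  have "x ^ (p ^ Suc T * k0) = (x ^ p) ^ (p ^ T * k0)" by (simp add: power_mult[symmetric] mult_ac)
  also have "[\<dots> = x ^ (p ^ T * k0)] (mod int p)" by (intro cong_pow fermat_int assms)
  finally show ?case using Suc cong_trans by blast
qed simp

definition values_mod :: "int \<Rightarrow> nat \<Rightarrow> 'a set \<Rightarrow> ('a \<Rightarrow> int) \<Rightarrow> int set" where
  "values_mod N k I w = {y \<in> {0..<N}. \<exists>x. [y = (\<Sum>i\<in>I. w i * x i ^ k)] (mod N)}"

text \<open>The set of values is stable under multiplication by \<open>k\<close>-th powers of units, so each new
  nonzero value comes with a whole orbit; this replaces the Cauchy--Davenport inequality.\<close>

lemma card_values_mod:
  assumes p: "prime p" and "finite I" "k > 0" "\<And>i. i \<in> I \<Longrightarrow> \<not> int p dvd w i"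
  shows "min (p ^ G) (1 + card I * card ((\<lambda>x. x ^ k mod int p) ` {1..<int p})) \<le> card (values_mod (int p ^ G) k I w)"
  using assms(2,4)
proof (induction I rule: finite_induct)
  case empty
  have pp: "int p ^ G > 0" using p by (simp add: prime_gt_0_nat)
  have "x = 0" if "0 \<le> x" "x < int p ^ G" "int p ^ G dvd x" for x
    using zdvd_imp_le[of "int p ^ G" x] that by linarith
  then have "values_mod (int p ^ G) k {} w = {0}" using pp by (auto simp: values_mod_def cong_def)
  then show ?case by simp
next
  case (insert i I)
  define N where "N = int p ^ G"
  define m where "m = card ((\<lambda>x. x ^ k mod int p) ` {1..<int p})"
  have pp: "prime (int p)" "int p > 0" using p by (auto simp: prime_gt_0_nat)
  have N: "N > 0" using pp by (simp add: N_def)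
  have unit: "coprime x N" if "\<not> int p dvd x" for x
    using that prime_imp_coprime[OF pp(1), of x] by (simp add: N_def coprime_commute)
  define A B where "A = values_mod N k I w" and "B = values_mod N k (insert i I) w"
  have fin: "finite A" "finite B" by (rule finite_subset[of _ "{0..<N}"]; auto simp: A_def B_def values_mod_def)+
  have add: "(a + w i * z ^ k) mod N \<in> B" if a: "a \<in> A" for a z
  proof -
    obtain x where x: "[a = (\<Sum>j\<in>I. w j * x j ^ k)] (mod N)" using a by (auto simp: A_def values_mod_def)
    let ?x = "x(i := z)"
    have "(\<Sum>j\<in>insert i I. w j * ?x j ^ k) = w i * z ^ k + (\<Sum>j\<in>I. w j * x j ^ k)"
      using insert.hyps by (simp add: sum.insert) (intro sum.cong, auto)
    moreover have "[(a + w i * z ^ k) mod N = (\<Sum>j\<in>I. w j * x j ^ k) + w i * z ^ k] (mod N)"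
      using x by (simp add: cong_add_rcancel)
    ultimately have "[(a + w i * z ^ k) mod N = (\<Sum>j\<in>insert i I. w j * ?x j ^ k)] (mod N)" by (simp add: add.commute)
    moreover have "(a + w i * z ^ k) mod N \<in> {0..<N}" using N by simp
    ultimately show ?thesis unfolding B_def values_mod_def by blast
  qed
  have AB: "A \<subseteq> B"
  proof
    fix a assume a: "a \<in> A"
    then have "(a + w i * 0 ^ k) mod N \<in> B" by (rule add)
    moreover have "(a + w i * 0 ^ k) mod N = a" using a assms(3) by (auto simp: A_def values_mod_def zero_power)
    ultimately show "a \<in> B" by simp
  qed
  have zero: "0 \<in> A"
  proof -
    have "[0 = (\<Sum>j\<in>I. w j * 0 ^ k)] (mod N)" using assms(3) by (simp add: zero_power)
    then show ?thesis unfolding A_def values_mod_def using N by (auto intro!: exI[of _ "\<lambda>_. 0"])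
  qed
  have IH: "min (p ^ G) (1 + card I * m) \<le> card A" using insert by (simp add: A_def N_def m_def)
  show ?case
  proof (cases "B = A")
    case True
    \<comment> \<open>If the new variable gains nothing, the set is stable under adding the unit
      \<open>w i\<close>, hence it contains every residue.\<close>
    have wi: "coprime (w i) N" using insert.prems by (intro unit) auto
    have mult: "(int j * w i) mod N \<in> A" for j
    proof (induction j)
      case 0 then show ?case using zero by simp
    next
      case (Suc j)
      have "((int j * w i) mod N + w i * 1 ^ k) mod N \<in> A" using add[OF Suc, of 1] True by simp
      moreover have "((int j * w i) mod N + w i * 1 ^ k) mod N = (int (Suc j) * w i) mod N"
        by (simp only: mod_add_left_eq) (simp add: algebra_simps)
      ultimately show ?case by simp
    qed
    have "{0..<N} \<subseteq> A"
    proof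
      fix y assume y: "y \<in> {0..<N}"
      obtain v where v: "[w i * v = 1] (mod N)" using cong_solve_coprime_int[OF wi] by blast
      define j where "j = nat ((y * v) mod N)"
      have "int j = (y * v) mod N" using N by (simp add: j_def)
      then have "[int j * w i = (y * v) * w i] (mod N)" by (simp add: cong_def mod_mult_left_eq)
      also have "(y * v) * w i = y * (w i * v)" by (simp add: mult_ac)
      also have "[\<dots> = y * 1] (mod N)" by (intro cong_mult v cong_refl)
      finally have "(int j * w i) mod N = y" using y by (simp add: cong_def)
      then show "y \<in> A" using mult[of j] by simp
    qed
    then have "card {0..<N} \<le> card A" using fin by (intro card_mono)
    then have "p ^ G \<le> card A" by (simp add: N_def nat_power_eq)
    then show ?thesis using True by (simp add: A_def B_def N_def)
  next
    case False
    then obtain b where b: "b \<in> B" "b \<notin> A" using AB by blast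
    have b0: "b \<noteq> 0" "b \<in> {0..<N}" using b zero by (auto simp: B_def values_mod_def)
    have orbit: "(b * v ^ k) mod N \<in> B - A" if v: "\<not> int p dvd v" for v
    proof -
      obtain x where x: "[b = (\<Sum>j\<in>insert i I. w j * x j ^ k)] (mod N)" using b(1) by (auto simp: B_def values_mod_def)
      have "[b * v ^ k = (\<Sum>j\<in>insert i I. w j * x j ^ k) * v ^ k] (mod N)" by (intro cong_mult x cong_refl)
      also have "(\<Sum>j\<in>insert i I. w j * x j ^ k) * v ^ k = (\<Sum>j\<in>insert i I. w j * (x j * v) ^ k)"
        by (simp only: sum_distrib_right power_mult_distrib mult.assoc)
      finally have inB: "(b * v ^ k) mod N \<in> B" unfolding B_def values_mod_def using N by (auto intro!: exI[of _ "\<lambda>j. x j * v"])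
      have "(b * v ^ k) mod N \<notin> A"
      proof
        assume "(b * v ^ k) mod N \<in> A"
        then obtain x where x: "[b * v ^ k = (\<Sum>j\<in>I. w j * x j ^ k)] (mod N)" by (auto simp: A_def values_mod_def)
        obtain v' where v': "[v * v' = 1] (mod N)" using cong_solve_coprime_int[OF unit[OF v]] by blast
        have "[b * v ^ k * v' ^ k = (\<Sum>j\<in>I. w j * x j ^ k) * v' ^ k] (mod N)" by (intro cong_mult x cong_refl)
        also have "(\<Sum>j\<in>I. w j * x j ^ k) * v' ^ k = (\<Sum>j\<in>I. w j * (x j * v') ^ k)"
          by (simp only: sum_distrib_right power_mult_distrib mult.assoc)
        finally have 1: "[b * v ^ k * v' ^ k = (\<Sum>j\<in>I. w j * (x j * v') ^ k)] (mod N)" .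
        have "[b * (v * v') ^ k = b * 1 ^ k] (mod N)" by (intro cong_mult cong_pow v' cong_refl)
        then have "[b = b * v ^ k * v' ^ k] (mod N)" by (simp add: power_mult_distrib mult.assoc cong_sym)
        then have "[b = (\<Sum>j\<in>I. w j * (x j * v') ^ k)] (mod N)" using 1 by (rule cong_trans)
        then have "b \<in> A" unfolding A_def values_mod_def using b0(2) by (auto intro!: exI[of _ "\<lambda>j. x j * v'"])
        then show False using b(2) by blast
      qed
      then show ?thesis using inB by blast
    qed
    let ?f = "\<lambda>x. x ^ k mod int p"
    define K where "K = ?f ` {1..<int p}"
    define r where "r = inv_into {1..<int p} ?f"
    have r: "r \<kappa> \<in> {1..<int p}" "?f (r \<kappa>) = \<kappa>" if "\<kappa> \<in> K" for \<kappa>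
      using that unfolding K_def r_def by (rule inv_into_into, rule f_inv_into_f)
    have nd: "\<not> int p dvd r \<kappa>" if "\<kappa> \<in> K" for \<kappa> using r(1)[OF that] by (auto dest: zdvd_imp_le)
    \<comment> \<open>The chosen representatives have k-th powers that differ already modulo
      \<open>p\<close>, so the differences are units modulo N, and a nonzero \<open>b\<close> keeps
      the products apart.\<close>
    have inj: "inj_on (\<lambda>\<kappa>. (b * r \<kappa> ^ k) mod N) K"
    proof (rule inj_onI, rule ccontr)
      fix \<kappa> \<mu> assume k: "\<kappa> \<in> K" "\<mu> \<in> K" "(b * r \<kappa> ^ k) mod N = (b * r \<mu> ^ k) mod N" "\<kappa> \<noteq> \<mu>"
      have "N dvd b * (r \<kappa> ^ k - r \<mu> ^ k)" using k(3) by (simp add: mod_eq_dvd_iff right_diff_distrib)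
      moreover have "\<not> int p dvd r \<kappa> ^ k - r \<mu> ^ k"
        using r(2)[OF k(1)] r(2)[OF k(2)] k(4) by (metis mod_eq_dvd_iff)
      then have "coprime (r \<kappa> ^ k - r \<mu> ^ k) N" by (rule unit)
      ultimately have "N dvd b" by (simp add: coprime_commute coprime_dvd_mult_left_iff)
      then show False using b0 by (auto dest: zdvd_imp_le)
    qed
    have "(\<lambda>\<kappa>. (b * r \<kappa> ^ k) mod N) ` K \<subseteq> B - A" using orbit nd by blast
    then have "card K \<le> card (B - A)" using inj fin by (metis card_inj_on_le finite_Diff)
    also have "\<dots> = card B - card A" using AB fin by (simp add: card_Diff_subset)
    finally have "card A + m \<le> card B" using AB fin card_mono[OF fin(2) AB] by (simp add: K_def m_def)
    then have "min (p ^ G) (1 + card I * m) + m \<le> card B" using IH by linarith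
    then have "min (p ^ G) (1 + card (insert i I) * m) \<le> card B" using insert.hyps by simp
    then show ?thesis by (simp add: B_def N_def m_def)
  qed
qed

text \<open>The variable of one unit coefficient is set to 1. By \<open>card_values_mod\<close> the
  remaining card J - 1 unit coefficients represent every residue modulo p^G, in particular
  \<open>- w i0\<close>; the numerical hypothesis says that gains of at least (p-1)/k0 residues per
  variable fill up all p^G classes.\<close>

lemma unit_sol_growth:
  assumes p: "prime p" and k: "k = p ^ T * k0" "k > 0" and I: "finite I" "J \<subseteq> I" "\<And>i. i \<in> J \<Longrightarrow> \<not> int p dvd w i"
    and n: "k0 * (p ^ G - 1) \<le> (card J - 1) * (p - 1)" "G > 0"
  shows "unit_sol p G k I w"
proof (rule unit_sol_mono[OF _ I(2,1) k(2)])
  let ?m = "card ((\<lambda>x. x ^ k mod int p) ` {1..<int p})"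
  have pp: "prime (int p)" "int p > 0" "p > 1" using prime_gt_1_nat[OF p] p by auto
  have k0: "k0 > 0" using k by (cases k0) auto
  have finJ: "finite J" using I finite_subset by blast
  have "(\<lambda>x. x ^ k mod int p) = (\<lambda>x. x ^ k0 mod int p)"
    using fermat_int_power[OF p, of _ T k0] by (simp add: k(1) cong_def)
  then have "p - 1 \<le> k0 * ?m" using card_kth_powers_mod_prime[OF p k0] by (simp only:)
  then have "(card J - 1) * (p - 1) \<le> (card J - 1) * (k0 * ?m)" by (rule mult_left_mono) simp
  with n(1) have "k0 * (p ^ G - 1) \<le> (card J - 1) * (k0 * ?m)" by (rule order.trans)
  also have "\<dots> = k0 * ((card J - 1) * ?m)" by (rule mult.left_commute)
  finally have "k0 * (p ^ G - 1) \<le> k0 * ((card J - 1) * ?m)" .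
  then have m: "p ^ G - 1 \<le> (card J - 1) * ?m" using k0 by simp
  have "p ^ G > 1" by (rule one_less_power[OF pp(3) n(2)])
  then have "J \<noteq> {}" using m by auto
  then obtain i0 where i0: "i0 \<in> J" by blast
  let ?I = "J - {i0}"
  have cI: "card ?I = card J - 1" using i0 finJ by simp
  let ?N = "int p ^ G"
  have "min (p ^ G) (1 + card ?I * ?m) \<le> card (values_mod ?N k ?I w)"
    by (rule card_values_mod[OF p]) (use finJ I k in auto)
  moreover have "min (p ^ G) (1 + card ?I * ?m) = p ^ G" using m cI by simp
  ultimately have "card {0..<?N} \<le> card (values_mod ?N k ?I w)" by (simp add: nat_power_eq)
  moreover have "values_mod ?N k ?I w \<subseteq> {0..<?N}" by (auto simp: values_mod_def)
  ultimately have "values_mod ?N k ?I w = {0..<?N}" by (intro card_seteq) auto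
  moreover have "(- w i0) mod ?N \<in> {0..<?N}" using pp by simp
  ultimately obtain x where x: "[(- w i0) mod ?N = (\<Sum>i\<in>?I. w i * x i ^ k)] (mod ?N)"
    unfolding values_mod_def by blast
  then have "[- w i0 = (\<Sum>i\<in>?I. w i * x i ^ k)] (mod ?N)" by simp
  then have "?N dvd w i0 + (\<Sum>i\<in>?I. w i * x i ^ k)"
    by (simp add: cong_iff_dvd_diff) (metis dvd_minus_iff minus_diff_eq diff_minus_eq_add add.commute)
  moreover have "(\<Sum>i\<in>J. w i * (x(i0 := 1)) i ^ k) = w i0 + (\<Sum>i\<in>?I. w i * x i ^ k)"
    using i0 finJ by (simp add: sum.remove)
  ultimately have "?N dvd (\<Sum>i\<in>J. w i * (x(i0 := 1)) i ^ k)" by simp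
  moreover have "\<not> int p dvd (x(i0 := 1)) i0" using pp by simp
  ultimately show "unit_sol p G k J w" unfolding unit_sol_def using i0 I(3) by blast
qed

section \<open>Diagonal cubic forms\<close>

lemma mod_3_cases: "(x::int) mod 3 = 0 \<or> x mod 3 = 1 \<or> x mod 3 = 2" by presburger

text \<open>Modulo 9 the unit cubes are 1 and -1, so signs can be chosen that make all unit
  coefficients 1, 4 or 7. Among four of them two coincide and cancel. Two distinct ones differ by 3
  or 6, which a coefficient exactly divisible by 3 compensates with a suitable sign.\<close>

lemma unit_sol_cubes_3:
  assumes I: "finite I" "J \<subseteq> I" "\<And>i. i \<in> J \<Longrightarrow> \<not> 3 dvd w i"
    and c: "card J \<ge> 4 \<or> card J \<ge> 2 \<and> (\<exists>t\<in>I. 3 dvd w t \<and> \<not> 9 dvd w t)"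
  shows "unit_sol 3 2 3 I w"
proof -
  have finJ: "finite J" using I finite_subset by blast
  define \<sigma> where "\<sigma> i = (if w i mod 3 = 1 then 1 else - 1 :: int)" for i
  define r where "r i = \<sigma> i * w i" for i
  have r1: "r i mod 3 = 1" if "i \<in> J" for i
  proof -
    have "w i mod 3 \<noteq> 0" using I(3)[OF that] by presburger
    then have "w i mod 3 = 1 \<or> w i mod 3 = 2" using mod_3_cases[of "w i"] by blast
    then show ?thesis unfolding r_def \<sigma>_def by (auto) presburger
  qed
  have \<sigma>3: "\<sigma> i ^ 3 = \<sigma> i" for i by (simp add: \<sigma>_def)
  have \<sigma>n: "\<not> 3 dvd \<sigma> i" for i by (simp add: \<sigma>_def)
  have same: "unit_sol 3 2 3 I w" if ij: "i \<in> J" "j \<in> J" "i \<noteq> j" "r i mod 9 = r j mod 9" for i j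
  proof (rule unit_sol_mono[of 3 2 3 "{i, j}"])
    let ?y = "(\<lambda>x. \<sigma> x)(j := - \<sigma> j)"
    have "(\<Sum>x\<in>{i,j}. w x * ?y x ^ 3) = r i - r j" using ij(3) by (simp add: r_def \<sigma>3)
    moreover have "9 dvd r i - r j" using ij(4) by (simp add: mod_eq_dvd_iff)
    ultimately have "int 3 ^ 2 dvd (\<Sum>x\<in>{i,j}. w x * ?y x ^ 3)" by simp
    moreover have "\<not> int 3 dvd ?y i" using \<sigma>n ij(3) by simp
    ultimately show "unit_sol 3 2 3 {i, j} w" unfolding unit_sol_def using I(3)[OF ij(1)] by (intro exI[of _ ?y] exI[of _ i]) simp
  qed (use ij I in auto)
  have cases: "r i mod 9 \<in> {1, 4, 7}" if "i \<in> J" for i using r1[OF that] by simp presburger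
  from c show ?thesis
  proof
    assume "card J \<ge> 4"
    moreover have "card ((\<lambda>i. r i mod 9) ` J) \<le> card {1, 4, 7 :: int}"
      using cases by (intro card_mono) auto
    ultimately have "\<not> inj_on (\<lambda>i. r i mod 9) J" using card_image[of "\<lambda>i. r i mod 9" J] by auto
    then show ?thesis using same unfolding inj_on_def by blast
  next
    assume "card J \<ge> 2 \<and> (\<exists>t\<in>I. 3 dvd w t \<and> \<not> 9 dvd w t)"
    then obtain t where t: "t \<in> I" "3 dvd w t" "\<not> 9 dvd w t" and "card J \<ge> 2" by blast
    then obtain i j where ij: "i \<in> J" "j \<in> J" "i \<noteq> j"
      by (metis card_le_Suc0_iff_eq finJ not_less_eq_eq numeral_2_eq_2)
    show ?thesis
    proof (cases "r i mod 9 = r j mod 9")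
      case True then show ?thesis using same ij by blast
    next
      case False
      have tn: "t \<noteq> i" "t \<noteq> j" using t(2) I(3) ij by auto
      have "\<exists>e\<in>{1, - 1}. 9 dvd r i - r j + e * w t"
      proof -
        have wt: "w t mod 9 = 3 \<or> w t mod 9 = 6" using t(2,3) by presburger
        have "(r i - r j) mod 9 = 3 \<or> (r i - r j) mod 9 = 6"
          using cases[OF ij(1)] cases[OF ij(2)] False by simp presburger
        then have "9 dvd r i - r j + w t \<or> 9 dvd r i - r j - w t" using wt by presburger
        then show ?thesis by auto
      qed
      then obtain e where e: "e \<in> {1, - 1}" "9 dvd r i - r j + e * w t" by blast
      show ?thesis
      proof (rule unit_sol_mono[of 3 2 3 "{i, j, t}"])
        let ?y = "(\<lambda>x. \<sigma> x)(j := - \<sigma> j, t := e)"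
        have "e ^ 3 = e" using e(1) by auto
        then have "(\<Sum>x\<in>{i,j,t}. w x * ?y x ^ 3) = r i - r j + e * w t" using ij(3) tn by (simp add: r_def \<sigma>3)
        then have "int 3 ^ 2 dvd (\<Sum>x\<in>{i,j,t}. w x * ?y x ^ 3)" using e(2) by simp
        moreover have "\<not> int 3 dvd ?y i" using \<sigma>n ij(3) tn by simp
        ultimately show "unit_sol 3 2 3 {i, j, t} w" unfolding unit_sol_def using I(3)[OF ij(1)] by (intro exI[of _ ?y] exI[of _ i]) simp
      qed (use ij I t in auto)
    qed
  qed
qed

lemma primitive_root_rep:
  assumes "prime p"
  obtains g where "\<And>a. \<not> int p dvd a \<Longrightarrow> \<exists>i. [a = int g ^ i] (mod int p)" "[int g ^ (p - 1) = 1] (mod int p)"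
    "\<not> int p dvd int g" "bij_betw (\<lambda>i. int g ^ i mod int p) {..<p - 1} {1..<int p}"
proof -
  have p1: "p > 1" using prime_gt_1_nat[OF assms] .
  obtain g where g: "residue_primroot p g" using prime_primitive_root_exists[OF p1 assms] by blast
  have bij: "bij_betw (\<lambda>i. g ^ i mod p) {..<totient p} (totatives p)"
    using residue_primroot_is_generator[OF p1 g] .
  have tot: "totient p = p - 1" "totatives p = {0<..<p}" using assms by (auto simp: totient_prime totatives_prime)
  have bij2: "bij_betw int {0<..<p} {1..<int p}"
    by (rule bij_betw_byWitness[of _ nat]) auto
  have bij3: "bij_betw (\<lambda>i. int g ^ i mod int p) {..<p - 1} {1..<int p}"
    using bij_betw_trans[OF bij[unfolded tot] bij2] by (simp add: o_def zmod_int)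
  have cop: "coprime p g" using g by (simp add: residue_primroot_def)
  then have ng: "\<not> p dvd g" using p1 coprime_common_divisor_nat[of p g p] by auto
  have "[g ^ (p - 1) = 1] (mod p)" using fermat_theorem[OF assms ng] .
  then have "[int (g ^ (p - 1)) = int 1] (mod int p)" by (simp only: cong_int_iff)
  then have 2: "[int g ^ (p - 1) = 1] (mod int p)" by simp
  have 1: "\<exists>i. [a = int g ^ i] (mod int p)" if "\<not> int p dvd a" for a
  proof -
    have "a mod int p \<noteq> 0" using that by (simp add: dvd_eq_mod_eq_0)
    moreover have "0 \<le> a mod int p" "a mod int p < int p" using p1 by auto
    ultimately have "a mod int p \<in> {1..<int p}" by (simp add: order.order_iff_strict) linarith
    then have "a mod int p \<in> (\<lambda>i. int g ^ i mod int p) ` {..<p - 1}" using bij_betw_imp_surj_on[OF bij3] by simp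
    then show ?thesis unfolding cong_def by blast
  qed
  show ?thesis using that[OF 1 2 _ bij3] ng by simp
qed

text \<open>The quotient of the two coefficients is a cube modulo p, and as the degree is odd a sign
  makes the two terms cancel.\<close>

lemma unit_sol_cubes_pair:
  assumes p: "prime p" and I: "finite I" "i \<in> I" "j \<in> I" "i \<noteq> j" "\<not> int p dvd w i" "\<not> int p dvd g"
    and w: "[w i = g ^ \<alpha>] (mod int p)" "[w j = g ^ \<beta>] (mod int p)" and \<beta>: "\<beta> \<ge> \<alpha>" "3 dvd \<beta> - \<alpha>"
  shows "unit_sol p 1 3 I w"
proof (rule unit_sol_mono[of p 1 3 "{i, j}"])
  have pp: "prime (int p)" using p by simp
  obtain t where "\<beta> - \<alpha> = 3 * t" using \<beta>(2) by (elim dvdE)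
  then have t: "\<beta> = \<alpha> + 3 * t" using \<beta>(1) by simp
  let ?y = "(\<lambda>_. 1)(i := - (g ^ t))"
  have "(\<Sum>x\<in>{i,j}. w x * ?y x ^ 3) = w j - w i * g ^ (3 * t)"
  proof -
    have "(- (g ^ t)) ^ 3 = - ((g ^ t) ^ 3)" by (rule power_minus_odd) simp
    also have "(g ^ t) ^ 3 = g ^ (3 * t)" by (subst mult.commute) (rule power_mult[symmetric])
    finally show ?thesis using I(4) by simp
  qed
  moreover have "[w i * g ^ (3 * t) = g ^ \<alpha> * g ^ (3 * t)] (mod int p)" by (intro cong_mult w(1) cong_refl)
  then have "[w i * g ^ (3 * t) = g ^ \<beta>] (mod int p)" by (simp add: t power_add)
  then have "[w j = w i * g ^ (3 * t)] (mod int p)" using w(2) cong_sym cong_trans by blast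
  ultimately have "int p ^ 1 dvd (\<Sum>x\<in>{i,j}. w x * ?y x ^ 3)" by (simp add: cong_iff_dvd_diff)
  moreover have "\<not> int p dvd g ^ t" using prime_dvd_power[OF pp] I(6) by blast
  then have "\<not> int p dvd ?y i" by simp
  ultimately show "unit_sol p 1 3 {i, j} w" unfolding unit_sol_def using I(5) by (intro exI[of _ ?y] exI[of _ i]) simp
qed (use I in auto)

lemma sum_period_3:
  fixes f :: "nat \<Rightarrow> 'a::comm_semiring_1"
  assumes "\<And>i. f (i + 3) = f i"
  shows "(\<Sum>i<3 * n. f i) = of_nat n * (f 0 + f 1 + f 2)"
proof (induction n)
  case (Suc n)
  have shift: "f (3 * n + i) = f i" for n i
  proof (induction n)
    case (Suc n)
    then show ?case using assms[of "3 * n + i"] by (simp add: algebra_simps)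
  qed simp
  have "3 * Suc n = Suc (Suc (Suc (3 * n)))" by simp
  then have "(\<Sum>i<3 * Suc n. f i) = (\<Sum>i<3 * n. f i) + f (3 * n + 0) + f (3 * n + 1) + f (3 * n + 2)"
    by (simp del: mult_Suc_right add: numeral_2_eq_2)
  then show ?case by (simp only: shift Suc.IH) (simp add: algebra_simps)
qed simp

lemma distinct_mod_3_perm:
  assumes "(\<alpha>::nat) mod 3 \<noteq> \<beta> mod 3" "\<alpha> mod 3 \<noteq> \<gamma> mod 3" "\<beta> mod 3 \<noteq> \<gamma> mod 3"
  shows "{\<alpha> mod 3, \<beta> mod 3, \<gamma> mod 3} = {0, 1, 2}"
proof -
  have "\<alpha> mod 3 = 0 \<or> \<alpha> mod 3 = 1 \<or> \<alpha> mod 3 = 2" "\<beta> mod 3 = 0 \<or> \<beta> mod 3 = 1 \<or> \<beta> mod 3 = 2"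
    "\<gamma> mod 3 = 0 \<or> \<gamma> mod 3 = 1 \<or> \<gamma> mod 3 = 2" by presburger+
  then show ?thesis using assms by (elim disjE) auto
qed

lemma sum_cubes_of_sum_zero:
  fixes a b c :: "'a::comm_ring_1"
  assumes "a + b + c = 0"
  shows "a ^ 3 + b ^ 3 + c ^ 3 = 3 * (a * b * c)"
proof -
  have "c = - (a + b)" using assms by (simp only: add_eq_0_iff)
  then show ?thesis by (simp only:) (simp add: power3_eq_cube algebra_simps)
qed

text \<open>Three cubes with coefficients in distinct cosets of the cubes: the Gauss sums attached to
  the three cosets add up to zero, which shows that the number of solutions is the same as for
  coefficients \<open>1, 1, 1\<close>.\<close>

lemma nsol_cubes_distinct_cosets:
  assumes p: "prime p" and n: "p - 1 = 3 * n" and g: "[g ^ (p - 1) = 1] (mod int p)" "\<not> int p dvd g"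
    "bij_betw (\<lambda>i. g ^ i mod int p) {..<p - 1} {1..<int p}"
    and c: "\<And>i. i \<in> {1..3} \<Longrightarrow> [c i = g ^ \<alpha> i] (mod int p)" "inj_on (\<lambda>i. \<alpha> i mod 3) {1..3::nat}"
  shows "nsol 3 3 c p = nsol 3 3 (\<lambda>_. 1) p"
proof -
  have pp: "prime (int p)" "int p > 0" "p > 0" using p by (auto simp: prime_gt_0_nat)
  define \<sigma> where "\<sigma> i = gauss_S 3 p (g ^ i)" for i
  have per: "\<sigma> (i + 3) = \<sigma> i" for i
  proof -
    have "coprime g (int p)" using g(2) prime_imp_coprime[OF pp(1), of g] by (simp add: coprime_commute)
    then show ?thesis using gauss_S_mult_power[OF pp(3), of g 3 "g ^ i"] by (simp add: \<sigma>_def power_add)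
  qed
  have \<sigma>mod: "\<sigma> i = \<sigma> (i mod 3)" for i
  proof (induction i rule: less_induct)
    case (less i)
    show ?case
    proof (cases "i < 3")
      case False
      then have "\<sigma> i = \<sigma> (i - 3)" using per[of "i - 3"] by simp
      then show ?thesis using less[of "i - 3"] False by (simp add: le_mod_geq)
    qed simp
  qed
  have split: "(\<Sum>x\<in>{0..<int p}. F x) = F 0 + (\<Sum>i<3 * n. F (g ^ i mod int p))" for F :: "int \<Rightarrow> complex"
  proof -
    have "{0..<int p} = insert 0 {1..<int p}" using pp by auto
    then have "(\<Sum>x\<in>{0..<int p}. F x) = F 0 + (\<Sum>x\<in>{1..<int p}. F x)" by simp
    also have "(\<Sum>x\<in>{1..<int p}. F x) = (\<Sum>i<p - 1. F (g ^ i mod int p))"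
      by (rule sum.reindex_bij_betw[OF g(3), symmetric])
    finally show ?thesis by (simp only: n)
  qed
  have S: "gauss_S 3 p (g ^ i mod int p * b) = \<sigma> (i + \<beta>)" if "[b = g ^ \<beta>] (mod int p)" for i b \<beta>
    unfolding \<sigma>_def
  proof (rule gauss_S_cong[OF pp(3)])
    have "[g ^ i mod int p * b = g ^ i * g ^ \<beta>] (mod int p)" by (intro cong_mult that) (simp add: cong_def)
    then show "[g ^ i mod int p * b = g ^ (i + \<beta>)] (mod int p)" by (simp add: power_add)
  qed
  have "(\<Sum>x\<in>{0..<int p}. gauss_S 3 p x) = of_nat p"
    by (rule sum_gauss_S_prime[OF p]) simp
  moreover have "(\<Sum>i<3 * n. gauss_S 3 p (g ^ i mod int p)) = (\<Sum>i<3 * n. \<sigma> i)"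
    using S[of 1 0] by simp
  ultimately have "of_nat p + (\<Sum>i<3 * n. \<sigma> i) = of_nat p"
    by (simp add: split gauss_S_zero[OF pp(3)])
  then have "of_nat n * (\<sigma> 0 + \<sigma> 1 + \<sigma> 2) = 0" using sum_period_3[of \<sigma> n, OF per] by simp
  moreover have "n > 0" using n p prime_gt_1_nat[OF p] by (cases n) auto
  \<comment> \<open>The term x = 0 alone already accounts for the total p of
    \<open>sum_gauss_S_prime\<close>, so the nonzero residues, which give n times the sum of the
    three values, contribute nothing.\<close>
  ultimately have zero: "\<sigma> 0 + \<sigma> 1 + \<sigma> 2 = 0" by simp
  have set3: "{1..3::nat} = {1,2,3}" by auto
  have prod3: "(\<Prod>i=1..3::nat. f i) = f 1 * f 2 * f 3" for f :: "nat \<Rightarrow> complex"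
    unfolding set3 by (simp add: mult.assoc)
  \<comment> \<open>Multiplication by g^j permutes the three cosets, so for coefficients in distinct
    cosets every nonzero residue contributes the same product P, in all 3 n P. With coefficients 1
    the total is n times the sum of the cubes of \<sigma> 0, \<sigma> 1, \<sigma> 2, which is again
    3 n P because the three values add up to zero.\<close>
  define P where "P = \<sigma> 0 * \<sigma> 1 * \<sigma> 2"
  have cong3: "i \<in> {1..3::nat} \<Longrightarrow> gauss_S 3 p (g ^ j mod int p * c i) = \<sigma> (j + \<alpha> i)" for i j
    by (rule S[OF c(1)])
  have "(\<Prod>i=1..3. gauss_S 3 p (g ^ j mod int p * c i)) = P" for j
  proof -
    have "\<alpha> i mod 3 \<noteq> \<alpha> j mod 3" if "i \<in> {1..3}" "j \<in> {1..3}" "i \<noteq> j" for i j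
      using inj_onD[OF c(2), of i j] that by blast
    then have d: "\<alpha> 1 mod 3 \<noteq> \<alpha> 2 mod 3" "\<alpha> 1 mod 3 \<noteq> \<alpha> 3 mod 3" "\<alpha> 2 mod 3 \<noteq> \<alpha> 3 mod 3" by simp_all
    have ne: "(j + a) mod 3 \<noteq> (j + b) mod 3" if "a mod 3 \<noteq> b mod 3" for a b :: nat
      using that by presburger
    have "(\<Prod>i=1..3. gauss_S 3 p (g ^ j mod int p * c i)) = \<sigma> ((j + \<alpha> 1) mod 3) * \<sigma> ((j + \<alpha> 2) mod 3) * \<sigma> ((j + \<alpha> 3) mod 3)"
      using cong3[of 1 j] cong3[of 2 j] cong3[of 3 j] unfolding prod3 by (simp add: \<sigma>mod[symmetric])
    also have "\<dots> = (\<Prod>i\<in>{(j + \<alpha> 1) mod 3, (j + \<alpha> 2) mod 3, (j + \<alpha> 3) mod 3}. \<sigma> i)"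
      using ne[OF d(1)] ne[OF d(2)] ne[OF d(3)] by (simp add: mult.assoc)
    also have "\<dots> = (\<Prod>i\<in>{0,1,2}. \<sigma> i)"
      using distinct_mod_3_perm[OF ne[OF d(1)] ne[OF d(2)] ne[OF d(3)]] by simp
    finally show ?thesis by (simp add: P_def mult.assoc)
  qed
  then have 1: "(\<Sum>x\<in>{0..<int p}. \<Prod>i=1..3. gauss_S 3 p (x * c i)) = of_nat p ^ 3 + of_nat (3 * n) * P"
    by (simp add: split gauss_S_zero[OF pp(3)])
  have "(\<Prod>i=1..3::nat. gauss_S 3 p (g ^ j mod int p * 1)) = \<sigma> j ^ 3" for j
    using S[of 1 0 j] by simp
  then have "(\<Sum>x\<in>{0..<int p}. \<Prod>i=1..3::nat. gauss_S 3 p (x * 1)) = of_nat p ^ 3 + (\<Sum>j<3 * n. \<sigma> j ^ 3)"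
    by (simp only: split) (simp add: gauss_S_zero[OF pp(3)])
  also have "(\<Sum>j<3 * n. \<sigma> j ^ 3) = of_nat n * (\<sigma> 0 ^ 3 + \<sigma> 1 ^ 3 + \<sigma> 2 ^ 3)"
    by (rule sum_period_3) (simp add: per)
  also have "\<sigma> 0 ^ 3 + \<sigma> 1 ^ 3 + \<sigma> 2 ^ 3 = 3 * P"
    unfolding P_def by (rule sum_cubes_of_sum_zero[OF zero])
  finally have 2: "(\<Sum>x\<in>{0..<int p}. \<Prod>i=1..3::nat. gauss_S 3 p (x * 1)) = of_nat p ^ 3 + of_nat (3 * n) * P"
    by simp
  have "of_nat (p * nsol 3 3 c p) = (of_nat (p * nsol 3 3 (\<lambda>_. 1) p) :: complex)"
    using 1 2 sum_prod_gauss_S[OF pp(3), where k = 3 and s = 3 and c = c]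
      sum_prod_gauss_S[OF pp(3), where k = 3 and s = 3 and c = "\<lambda>_. 1"] by simp
  then have "p * nsol 3 3 c p = p * nsol 3 3 (\<lambda>_. 1) p" by (simp only: of_nat_eq_iff)
  then show ?thesis using pp by simp
qed

lemma card_ge_2E:
  assumes "finite J" "card J \<ge> 2"
  obtains a b where "a \<in> J" "b \<in> J" "a \<noteq> b"
proof -
  have "J \<noteq> {}" using assms(2) by auto
  then obtain a where a: "a \<in> J" by blast
  have "card (J - {a}) = card J - 1" using a by simp
  then have "card (J - {a}) \<noteq> 0" using assms(2) by linarith
  then have "J - {a} \<noteq> {}" by (metis card.empty)
  then obtain b where "b \<in> J" "b \<noteq> a" by blast
  then show ?thesis using that a by blast
qed

lemma mod_3_hit:
  assumes "(q::nat) mod 3 \<noteq> 0"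
  shows "(b + q * 0) mod 3 = a mod 3 \<or> (b + q * 1) mod 3 = a mod 3 \<or> (b + q * 2) mod 3 = a mod 3"
proof -
  have e: "(b + q * 0) mod 3 = b mod 3" "(b + q * 1) mod 3 = (b mod 3 + q mod 3) mod 3"
    "(b + q * 2) mod 3 = (b mod 3 + (q mod 3) * 2) mod 3"
    by (simp, simp add: mod_add_eq, metis mod_add_left_eq mod_add_right_eq mod_mult_left_eq)
  have "x = 0 \<or> x = 1 \<or> x = 2" if "x < 3" for x :: nat using that by linarith
  then have "a mod 3 = 0 \<or> a mod 3 = 1 \<or> a mod 3 = 2" "b mod 3 = 0 \<or> b mod 3 = 1 \<or> b mod 3 = 2"
    "q mod 3 = 1 \<or> q mod 3 = 2" using assms by (metis mod_less_divisor zero_less_numeral)+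
  then show ?thesis unfolding e by (elim disjE) simp_all
qed

lemma unit_sol_cubes_pair':
  assumes p: "prime p" and I: "finite I" "i \<in> I" "j \<in> I" "i \<noteq> j" "\<not> int p dvd w i" "\<not> int p dvd g"
    and w: "[w i = g ^ \<alpha>] (mod int p)" "[w j = g ^ \<beta>] (mod int p)" and g: "[g ^ (p - 1) = 1] (mod int p)"
    and j0: "(\<beta> + (p - 1) * j0) mod 3 = \<alpha> mod 3"
  shows "unit_sol p 1 3 I w"
proof -
  \<comment> \<open>The exponent of a primitive root may be changed by multiples of p - 1. The
    summand 3 \<alpha> makes the new exponent at least \<alpha> without changing it modulo
    3.\<close>
  define \<beta>' where "\<beta>' = \<beta> + (p - 1) * (j0 + 3 * \<alpha>)"
  have "g ^ \<beta>' = g ^ \<beta> * (g ^ (p - 1)) ^ (j0 + 3 * \<alpha>)" by (simp add: \<beta>'_def power_add power_mult)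
  also have "[\<dots> = g ^ \<beta> * 1 ^ (j0 + 3 * \<alpha>)] (mod int p)" by (intro cong_mult cong_pow g cong_refl)
  finally have "[g ^ \<beta>' = g ^ \<beta>] (mod int p)" by simp
  then have 1: "[w j = g ^ \<beta>'] (mod int p)" using w(2) cong_sym cong_trans by blast
  have "1 * \<alpha> \<le> (p - 1) * (j0 + 3 * \<alpha>)" using prime_gt_1_nat[OF p] by (intro mult_mono) auto
  then have le: "\<alpha> \<le> \<beta>'" by (simp add: \<beta>'_def)
  have "\<beta>' = (\<beta> + (p - 1) * j0) + 3 * ((p - 1) * \<alpha>)" by (simp add: \<beta>'_def algebra_simps)
  then have "\<beta>' mod 3 = \<alpha> mod 3" using j0 by simp
  then have "3 dvd \<beta>' - \<alpha>" using le by (simp add: mod_eq_dvd_iff_nat)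
  then show ?thesis using unit_sol_cubes_pair[of p I i j w g \<alpha> \<beta>'] p I w(1) 1 le by blast
qed

lemma nsol_cubes_ge_2:
  assumes "p > 1"
  shows "nsol 3 3 (\<lambda>_. 1) p \<ge> 2"
proof -
  define X where "X = {x \<in> {1..3::nat} \<rightarrow>\<^sub>E {0..<int p}. int p dvd (\<Sum>i=1..3. 1 * x i ^ 3)}"
  define x0 where "x0 = (\<lambda>i\<in>{1..3::nat}. 0::int)"
  define x1 where "x1 = (\<lambda>i\<in>{1..3::nat}. if i = 1 then 1 else if i = 2 then int p - 1 else 0)"
  have set3: "{1..3::nat} = {1,2,3}" by auto
  have "x0 \<in> X" using assms by (auto simp: X_def x0_def)
  moreover have "x1 \<in> X"
  proof -
    have "x1 \<in> {1..3} \<rightarrow>\<^sub>E {0..<int p}" using assms by (auto simp: x1_def)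
    moreover have "(\<Sum>i=1..3. 1 * x1 i ^ 3) = 1 + (int p - 1) ^ 3"
      unfolding set3 by (simp add: x1_def)
    moreover have "1 + (int p - 1) ^ 3 = int p * (int p * int p - 3 * int p + 3)"
      by (simp add: power3_eq_cube algebra_simps)
    ultimately show ?thesis by (simp add: X_def)
  qed
  moreover have "x0 \<noteq> x1"
  proof
    assume "x0 = x1"
    then have "x0 1 = x1 1" by simp
    then show False by (simp add: x0_def x1_def)
  qed
  ultimately have "card {x0, x1} = 2" "{x0, x1} \<subseteq> X" by auto
  moreover have "finite X" unfolding X_def by (rule finite_subset[of _ "{1..3} \<rightarrow>\<^sub>E {0..<int p}"]) (blast, intro finite_PiE, auto)
  ultimately have "2 \<le> card X" using card_mono[of X "{x0, x1}"] by simp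
  then show ?thesis by (simp add: nsol_def X_def)
qed

text \<open>If 3 does not divide p - 1, or if two coefficients lie in the same coset of the cubes,
  two variables are enough. Otherwise the three cosets are distinct, and comparison with the form
  with coefficients 1, which has the solution (1, -1, 0), shows that a nonzero solution
  exists.\<close>

lemma unit_sol_cubes:
  assumes p: "prime p" and I: "finite I" "J \<subseteq> I" "\<And>i. i \<in> J \<Longrightarrow> \<not> int p dvd w i" "card J \<ge> 3"
  shows "unit_sol p 1 3 I w"
proof -
  have finJ: "finite J" using I finite_subset by blast
  have pp: "int p > 0" "p > 1" using prime_gt_1_nat[OF p] by auto
  obtain \<iota> where "bij_betw \<iota> {0..<card J} J" using ex_bij_betw_nat_finite[OF finJ] by blast
  \<comment> \<open>The enumeration starts at 1 to match the index set \<open>{1..3}\<close> in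
    \<open>nsol 3 3\<close>.\<close>
  define \<kappa> where "\<kappa> n = \<iota> (n - 1)" for n
  have \<kappa>J: "\<kappa> n \<in> J" if "n \<in> {1..3}" for n
    using \<open>bij_betw \<iota> _ J\<close> that I(4) by (auto simp: \<kappa>_def bij_betw_def)
  have \<kappa>inj: "inj_on \<kappa> {1..3}"
  proof (rule inj_onI)
    fix x y assume xy: "x \<in> {1..3}" "y \<in> {1..3}" "\<kappa> x = \<kappa> y"
    have "x - 1 \<in> {0..<card J}" "y - 1 \<in> {0..<card J}" using xy I(4) by auto
    then have "x - 1 = y - 1" using xy(3) \<open>bij_betw \<iota> _ J\<close> unfolding \<kappa>_def by (meson bij_betw_imp_inj_on inj_onD)
    then show "x = y" using xy by auto
  qed
  obtain g where g: "\<And>a. \<not> int p dvd a \<Longrightarrow> \<exists>i. [a = int g ^ i] (mod int p)" "[int g ^ (p - 1) = 1] (mod int p)"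
    "\<not> int p dvd int g" "bij_betw (\<lambda>i. int g ^ i mod int p) {..<p - 1} {1..<int p}"
    using primitive_root_rep[OF p] by blast
  define \<alpha> where "\<alpha> n = (SOME i. [w (\<kappa> n) = int g ^ i] (mod int p))" for n
  have \<alpha>: "[w (\<kappa> n) = int g ^ \<alpha> n] (mod int p)" if "n \<in> {1..3}" for n
    unfolding \<alpha>_def by (rule someI_ex[OF g(1)]) (use I(3) \<kappa>J[OF that] in blast)
  have pair: "unit_sol p 1 3 I w" if "m \<in> {1..3}" "n \<in> {1..3}" "m \<noteq> n" "(\<alpha> n + (p - 1) * j0) mod 3 = \<alpha> m mod 3" for m n j0
  proof (rule unit_sol_cubes_pair'[OF p I(1) _ _ _ _ g(3) \<alpha>[OF that(1)] \<alpha>[OF that(2)] g(2) that(4)])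
    show "\<kappa> m \<in> I" "\<kappa> n \<in> I" using \<kappa>J that I(2) by auto
    show "\<kappa> m \<noteq> \<kappa> n" using inj_onD[OF \<kappa>inj] that by blast
    show "\<not> int p dvd w (\<kappa> m)" using I(3) \<kappa>J that by blast
  qed
  show ?thesis
  proof (cases "3 dvd p - 1")
    case False
    then have "(p - 1) mod 3 \<noteq> 0" by (simp add: dvd_eq_mod_eq_0)
    from mod_3_hit[OF this, of "\<alpha> 2" "\<alpha> 1"] show ?thesis
      using pair[of 1 2 0] pair[of 1 2 1] pair[of 1 2 2] by fastforce
  next
    case True
    then obtain n where n: "p - 1 = 3 * n" by (elim dvdE)
    show ?thesis
    proof (cases "inj_on (\<lambda>i. \<alpha> i mod 3) {1..3::nat}")
      case False
      then obtain a b where "a \<in> {1..3}" "b \<in> {1..3}" "a \<noteq> b" "\<alpha> a mod 3 = \<alpha> b mod 3" unfolding inj_on_def by blast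
      then show ?thesis using pair[of a b 0] by simp
    next
      case True
      define X where "X = {x \<in> {1..3::nat} \<rightarrow>\<^sub>E {0..<int p}. int p dvd (\<Sum>i=1..3. w (\<kappa> i) * x i ^ 3)}"
      have "nsol 3 3 (\<lambda>n. w (\<kappa> n)) p = nsol 3 3 (\<lambda>_. 1) p"
        by (rule nsol_cubes_distinct_cosets[OF p n g(2,3,4) \<alpha> True])
      then have "card X \<ge> 2" using nsol_cubes_ge_2[OF pp(2)] by (simp add: nsol_def X_def)
      moreover have "finite X" unfolding X_def by (rule finite_subset[of _ "{1..3} \<rightarrow>\<^sub>E {0..<int p}"]) (blast, intro finite_PiE, auto)
      ultimately obtain x y where xy: "x \<in> X" "y \<in> X" "x \<noteq> y" using card_ge_2E by blast
      have "\<exists>x\<in>X. \<exists>n\<in>{1..3}. x n \<noteq> 0"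
      proof (rule ccontr)
        assume "\<not> ?thesis"
        then have z: "\<And>x n. x \<in> X \<Longrightarrow> n \<in> {1..3} \<Longrightarrow> x n = 0" by blast
        then have "x n = y n" if "n \<in> {1..3}" for n using z[OF xy(1) that] z[OF xy(2) that] by simp
        then have "x = y" using xy(1,2) by (intro PiE_ext[of x "{1..3}" "\<lambda>_. {0..<int p}"]) (auto simp: X_def)
        then show False using xy(3) by blast
      qed
      then obtain x n where x: "x \<in> X" "n \<in> {1..3}" "x n \<noteq> 0" by blast
      have "x n \<in> {0..<int p}" using x by (auto simp: X_def)
      then have nd: "\<not> int p dvd x n" using x(3) by (auto dest: zdvd_imp_le)
      define y where "y i = x (inv_into {1..3} \<kappa> i)" for i
      have y: "y (\<kappa> m) = x m" if "m \<in> {1..3}" for m using \<kappa>inj that by (simp add: y_def)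
      have "(\<Sum>i\<in>\<kappa> ` {1..3}. w i * y i ^ 3) = (\<Sum>m=1..3. w (\<kappa> m) * x m ^ 3)"
        by (simp only: sum.reindex[OF \<kappa>inj] o_def) (intro sum.cong refl, simp only: y)
      then have "int p ^ 1 dvd (\<Sum>i\<in>\<kappa> ` {1..3}. w i * y i ^ 3)" using x(1) by (simp add: X_def)
      moreover have "\<not> int p dvd y (\<kappa> n)" "\<not> int p dvd w (\<kappa> n)" using nd y x(2) I(3) \<kappa>J by auto
      ultimately have "unit_sol p 1 3 (\<kappa> ` {1..3}) w" unfolding unit_sol_def using x(2) by blast
      moreover have "\<kappa> ` {1..3} \<subseteq> I" using \<kappa>J I(2) by blast
      ultimately show ?thesis by (rule unit_sol_mono) (use I(1) in simp_all)
    qed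
  qed
qed

text \<open>A contraction step at the prime \<open>2\<close>, needed when \<open>k\<close> is a power of \<open>2\<close>: each block behaves like one
  variable whose coefficient is divisible by \<open>4\<close>, and it still involves a variable with odd coefficient.\<close>

lemma even_blocks:
  fixes w :: "'a \<Rightarrow> int"
  assumes "finite J0" "finite J1" "\<And>i. i \<in> J0 \<Longrightarrow> odd (w i)" "\<And>i. i \<in> J1 \<Longrightarrow> w i mod 4 = 2"
    "J0 \<inter> J1 = {}" "card J0 \<ge> 2 * m" "card J0 + 2 * card J1 \<ge> 4 * m"
  shows "\<exists>B :: nat \<Rightarrow> 'a set. (\<forall>j<m. B j \<subseteq> J0 \<union> J1 \<and> B j \<inter> J0 \<noteq> {} \<and> 4 dvd (\<Sum>i\<in>B j. w i)) \<and>
    (\<forall>i<m. \<forall>j<m. i \<noteq> j \<longrightarrow> B i \<inter> B j = {})"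
  using assms
proof (induction m arbitrary: J0 J1)
  case (Suc m)
  let ?goal = "\<exists>B :: nat \<Rightarrow> 'a set. (\<forall>j<Suc m. B j \<subseteq> J0 \<union> J1 \<and> B j \<inter> J0 \<noteq> {} \<and> 4 dvd (\<Sum>i\<in>B j. w i)) \<and>
    (\<forall>i<Suc m. \<forall>j<Suc m. i \<noteq> j \<longrightarrow> B i \<inter> B j = {})"
  \<comment> \<open>Count an odd coefficient with weight 1 and one that is 2 modulo 4 with weight 2.
    A block takes weight at most 4 and two odd coefficients; it takes four odd ones only when
    \<open>J1\<close> is exhausted, and then the weight bound alone leaves enough of them.\<close>
  have step: ?goal if C: "C \<subseteq> J0 \<union> J1" "C \<inter> J0 \<noteq> {}" "4 dvd (\<Sum>i\<in>C. w i)"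
    "card (J0 - C) \<ge> 2 * m" "card (J0 - C) + 2 * card (J1 - C) \<ge> 4 * m" for C
  proof -
    have "\<exists>B :: nat \<Rightarrow> 'a set. (\<forall>j<m. B j \<subseteq> (J0 - C) \<union> (J1 - C) \<and> B j \<inter> (J0 - C) \<noteq> {} \<and> 4 dvd (\<Sum>i\<in>B j. w i)) \<and>
      (\<forall>i<m. \<forall>j<m. i \<noteq> j \<longrightarrow> B i \<inter> B j = {})"
      by (rule Suc.IH) (use Suc.prems C in auto)
    then obtain B :: "nat \<Rightarrow> 'a set" where B0: "\<forall>j<m. B j \<subseteq> (J0 - C) \<union> (J1 - C) \<and> B j \<inter> (J0 - C) \<noteq> {} \<and> 4 dvd (\<Sum>i\<in>B j. w i)"
      and B1: "\<forall>i<m. \<forall>j<m. i \<noteq> j \<longrightarrow> B i \<inter> B j = {}" by (elim exE conjE)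
    have B: "\<And>j. j < m \<Longrightarrow> B j \<subseteq> (J0 - C) \<union> (J1 - C)" "\<And>j. j < m \<Longrightarrow> B j \<inter> (J0 - C) \<noteq> {}"
      "\<And>j. j < m \<Longrightarrow> 4 dvd (\<Sum>i\<in>B j. w i)" "\<And>i j. i < m \<Longrightarrow> j < m \<Longrightarrow> i \<noteq> j \<Longrightarrow> B i \<inter> B j = {}"
      using B0 B1 by simp_all
    define B' where "B' = B(m := C)"
    have "B' j \<subseteq> J0 \<union> J1 \<and> B' j \<inter> J0 \<noteq> {} \<and> 4 dvd (\<Sum>i\<in>B' j. w i)" if "j < Suc m" for j
    proof (cases "j = m")
      case True then show ?thesis using C by (simp add: B'_def)
    next
      case False
      then have "j < m" using that by simp
      then show ?thesis using B(1)[of j] B(2)[of j] B(3)[of j] False unfolding B'_def by auto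
    qed
    moreover have "B' i \<inter> B' j = {}" if "i < Suc m" "j < Suc m" "i \<noteq> j" for i j
      using that B(1)[of i] B(1)[of j] B(4)[of i j] by (cases "i = m"; cases "j = m") (auto simp: B'_def)
    ultimately show ?thesis by blast
  qed
  have J: "card J0 \<ge> 2 * m + 2" "card J0 + 2 * card J1 \<ge> 4 * m + 4" using Suc.prems by auto
  obtain a b where ab: "a \<in> J0" "b \<in> J0" "a \<noteq> b" using card_ge_2E[of J0] Suc.prems(1) J by auto
  have ab1: "a \<notin> J1" "b \<notin> J1" using ab Suc.prems(5) by auto
  have even: "4 dvd w x + w y \<or> (w x + w y) mod 4 = 2" if "x \<in> J0" "y \<in> J0" for x y
    using Suc.prems(3)[OF that(1)] Suc.prems(3)[OF that(2)] by presburger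
  have c2: "card (J0 - {x, y}) = card J0 - 2" if "x \<in> J0" "y \<in> J0" "x \<noteq> y" for x y
    using that Suc.prems(1) by (simp add: card_Diff_subset)
  show ?case
  proof (cases "4 dvd w a + w b")
    case True
    show ?thesis
    proof (rule step[of "{a, b}"])
      have "J1 - {a, b} = J1" using ab1 by auto
      then show "card (J0 - {a, b}) + 2 * card (J1 - {a, b}) \<ge> 4 * m" using c2[OF ab] J by simp
    qed (use ab True c2[OF ab] J in auto)
  next
    case nab: False
    then have ab2: "(w a + w b) mod 4 = 2" using even ab by blast
    show ?thesis
    proof (cases "J1 = {}")
      case False
      then obtain t where t: "t \<in> J1" by blast
      have tn: "t \<noteq> a" "t \<noteq> b" "t \<notin> J0" using t ab1 Suc.prems(5) by auto
      show ?thesis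
      proof (rule step[of "{a, b, t}"])
        show "4 dvd (\<Sum>i\<in>{a, b, t}. w i)"
        proof -
          have "w t mod 4 = 2" using t Suc.prems(4) by blast
          then have "4 dvd w a + (w b + w t)" using ab2 by presburger
          then show ?thesis using ab tn by simp
        qed
        have 1: "J0 - {a, b, t} = J0 - {a, b}" "J1 - {a, b, t} = J1 - {t}" using tn ab1 by auto
        have 2: "card (J1 - {t}) = card J1 - 1" "card J1 \<ge> 1" using t Suc.prems(2) card_gt_0_iff[of J1] by auto
        show "2 * m \<le> card (J0 - {a, b, t})" unfolding 1 using c2[OF ab] J by simp
        show "4 * m \<le> card (J0 - {a, b, t}) + 2 * card (J1 - {a, b, t})" unfolding 1 using c2[OF ab] 2 J by simp
      qed (use ab t in auto)
    next
      case True
      then have J4: "card J0 \<ge> 4 * m + 4" using J by simp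
      then have "card (J0 - {a, b}) \<ge> 2" using c2[OF ab] by simp
      then obtain c d where cd: "c \<in> J0 - {a, b}" "d \<in> J0 - {a, b}" "c \<noteq> d" using card_ge_2E[of "J0 - {a, b}"] Suc.prems(1) by auto
      show ?thesis
      proof (cases "4 dvd w c + w d")
        case True
        show ?thesis
          by (rule step[of "{c, d}"]) (use cd True c2[of c d] J4 \<open>J1 = {}\<close> in auto)
      next
        case False
        then have cd2: "(w c + w d) mod 4 = 2" using even cd by blast
        show ?thesis
        proof (rule step[of "{a, b, c, d}"])
          show "4 dvd (\<Sum>i\<in>{a, b, c, d}. w i)"
          proof -
            have "4 dvd w a + (w b + (w c + w d))" using ab2 cd2 by presburger
            moreover have "a \<noteq> c" "a \<noteq> d" "b \<noteq> c" "b \<noteq> d" using cd by auto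
            then have "(\<Sum>i\<in>{a, b, c, d}. w i) = w a + (w b + (w c + w d))" using ab(3) cd(3) by simp
            ultimately show ?thesis by simp
          qed
          have "card (J0 - {a, b, c, d}) = card J0 - card {a, b, c, d}"
            using ab cd Suc.prems(1) by (intro card_Diff_subset) auto
          also have "card {a, b, c, d} = 4" using ab cd by auto
          finally have "card (J0 - {a, b, c, d}) = card J0 - 4" .
          then show "2 * m \<le> card (J0 - {a, b, c, d})" "4 * m \<le> card (J0 - {a, b, c, d}) + 2 * card (J1 - {a, b, c, d})"
            using J4 by auto
        qed (use ab cd in auto)
      qed
    qed
  qed
qed auto

text \<open>The sums of the 2^T blocks are divisible by 4. Among their quotients by 4 there is a
  nonempty subset with sum zero modulo 2^T, which gains the missing T powers of 2.\<close>

lemma unit_sol_blocks: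
  assumes I: "finite I" "J0 \<subseteq> I" "J1 \<subseteq> I" "\<And>i. i \<in> J0 \<Longrightarrow> odd (w i)" "\<And>i. i \<in> J1 \<Longrightarrow> w i mod 4 = 2"
    and card: "card J0 \<ge> 2 * 2 ^ T" "card J0 + 2 * card J1 \<ge> 4 * 2 ^ T" and k: "k > 0"
  shows "unit_sol 2 (T + 2) k I w"
proof -
  let ?m = "2 ^ T :: nat"
  have fin: "finite J0" "finite J1" using finite_subset[OF I(2) I(1)] finite_subset[OF I(3) I(1)] by auto
  have disj: "J0 \<inter> J1 = {}"
  proof -
    have "odd x \<Longrightarrow> x mod 4 \<noteq> 2" for x :: int by presburger
    then show ?thesis using I(4,5) by blast
  qed
  have ex: "\<exists>B :: nat \<Rightarrow> 'a set. (\<forall>j<?m. B j \<subseteq> J0 \<union> J1 \<and> B j \<inter> J0 \<noteq> {} \<and> 4 dvd (\<Sum>i\<in>B j. w i)) \<and>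
    (\<forall>i<?m. \<forall>j<?m. i \<noteq> j \<longrightarrow> B i \<inter> B j = {})"
    by (rule even_blocks[OF fin _ _ disj card]) (use I in auto)
  obtain B :: "nat \<Rightarrow> 'a set" where B0: "\<forall>j<?m. B j \<subseteq> J0 \<union> J1 \<and> B j \<inter> J0 \<noteq> {} \<and> 4 dvd (\<Sum>i\<in>B j. w i)"
    and B1: "\<forall>i<?m. \<forall>j<?m. i \<noteq> j \<longrightarrow> B i \<inter> B j = {}"
    using ex by (elim exE conjE)
  have B: "\<And>j. j < ?m \<Longrightarrow> B j \<subseteq> J0 \<union> J1" "\<And>j. j < ?m \<Longrightarrow> B j \<inter> J0 \<noteq> {}"
      "\<And>j. j < ?m \<Longrightarrow> 4 dvd (\<Sum>i\<in>B j. w i)" "\<And>i j. i < ?m \<Longrightarrow> j < ?m \<Longrightarrow> i \<noteq> j \<Longrightarrow> B i \<inter> B j = {}"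
    using B0 B1 by simp_all
  define g where "g j = (\<Sum>i\<in>B j. w i) div 4" for j
  obtain S where S: "S \<subseteq> {..<?m}" "S \<noteq> {}" "int ?m dvd (\<Sum>j\<in>S. g j)"
    using zero_sum_subset[of "{..<?m}" ?m g] by auto
  have finS: "finite S" using S(1) finite_subset by blast
  let ?U = "\<Union>j\<in>S. B j"
  have finB: "finite (B j)" if "j \<in> S" for j
    using B(1)[of j] that S(1) fin by (meson finite_UnI finite_subset lessThan_iff subsetD)
  have "(\<Sum>i\<in>?U. w i) = (\<Sum>j\<in>S. \<Sum>i\<in>B j. w i)"
    by (rule sum.UNION_disjoint[OF finS]) (use finB B(4) S(1) in blast)+
  also have "\<dots> = (\<Sum>j\<in>S. 4 * g j)"
    by (intro sum.cong refl) (use B(3) S(1) in \<open>auto simp: g_def\<close>)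
  also have "\<dots> = 4 * (\<Sum>j\<in>S. g j)" by (simp add: sum_distrib_left)
  finally have "int 2 ^ (T + 2) dvd (\<Sum>i\<in>?U. w i)" using S(3) by (simp add: power_add mult.commute)
  moreover obtain j i0 where j: "j \<in> S" "i0 \<in> B j" "i0 \<in> J0"
    using S(1,2) B(2) by blast
  moreover have "?U \<subseteq> I" using B(1) S(1) I(2,3) by blast
  ultimately show ?thesis using I(4)[of i0] unit_sol_subset_sum[OF two_is_prime_nat, of ?U I k i0 w "T + 2"] I(1) k by auto
qed

text \<open>Modulo 16 two blocks are enough when higher levels help. Two coefficients that are 4
  modulo 8 make both block sums divisible by 8, and then one of these sums or their total is
  divisible by 16. With one coefficient that is 8 modulo 16, a block or the union of both has a sum
  divisible by 8, and the coefficient repairs it modulo 16.\<close>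

lemma unit_sol_quartic_2:
  fixes w :: "'a \<Rightarrow> int"
  assumes I: "finite I" "J0 \<subseteq> I" "J1 \<subseteq> I" "\<And>i. i \<in> J0 \<Longrightarrow> odd (w i)" "\<And>i. i \<in> J1 \<Longrightarrow> w i mod 4 = 2"
    and card: "card J0 \<ge> 4" "card J0 + 2 * card J1 \<ge> 8" and k: "k > 0"
    and t: "(\<exists>t1\<in>I. \<exists>t2\<in>I. t1 \<noteq> t2 \<and> w t1 mod 8 = 4 \<and> w t2 mod 8 = 4) \<or> (\<exists>t\<in>I. w t mod 16 = 8)"
  shows "unit_sol 2 4 k I w"
proof -
  have fin: "finite J0" "finite J1" using finite_subset[OF I(2) I(1)] finite_subset[OF I(3) I(1)] by auto
  have disj: "J0 \<inter> J1 = {}"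
  proof -
    have "odd x \<Longrightarrow> x mod 4 \<noteq> 2" for x :: int by presburger
    then show ?thesis using I(4,5) by blast
  qed
  have ex: "\<exists>B :: nat \<Rightarrow> 'a set. (\<forall>j<2. B j \<subseteq> J0 \<union> J1 \<and> B j \<inter> J0 \<noteq> {} \<and> 4 dvd (\<Sum>i\<in>B j. w i)) \<and>
    (\<forall>i<2. \<forall>j<2. i \<noteq> j \<longrightarrow> B i \<inter> B j = {})"
    by (rule even_blocks[OF fin _ _ disj]) (use I card in auto)
  obtain B :: "nat \<Rightarrow> 'a set" where B0: "\<forall>j<2. B j \<subseteq> J0 \<union> J1 \<and> B j \<inter> J0 \<noteq> {} \<and> 4 dvd (\<Sum>i\<in>B j. w i)"
    and B1: "\<forall>i<2. \<forall>j<2. i \<noteq> j \<longrightarrow> B i \<inter> B j = {}"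
    using ex by (elim exE conjE)
  define X Y where "X = B 0" and "Y = B 1"
  have X: "X \<subseteq> J0 \<union> J1" "X \<inter> J0 \<noteq> {}" "4 dvd (\<Sum>i\<in>X. w i)" and Y: "Y \<subseteq> J0 \<union> J1" "Y \<inter> J0 \<noteq> {}" "4 dvd (\<Sum>i\<in>Y. w i)"
    using B0 by (simp_all add: X_def Y_def)
  have XY: "X \<inter> Y = {}" using B1[rule_format, of 0 1] by (simp add: X_def Y_def)
  have finXY: "finite X" "finite Y" using X(1) Y(1) fin finite_subset by blast+
  \<comment> \<open>The blocks contain only odd coefficients and coefficients that are 2 modulo 4,
    so the repairing ones can be added to a block without occurring twice.\<close>
  have low: "w i mod 8 \<noteq> 4 \<and> w i mod 16 \<noteq> 8" if "i \<in> X \<union> Y" for i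
  proof -
    have "odd (w i) \<or> w i mod 4 = 2" using that X(1) Y(1) I(4,5) by blast
    then show ?thesis by presburger
  qed
  have fsol: "unit_sol 2 4 k I w" if C: "C \<subseteq> I" "C \<inter> J0 \<noteq> {}" "16 dvd (\<Sum>i\<in>C. w i)" for C
  proof -
    obtain i0 where "i0 \<in> C" "i0 \<in> J0" using C(2) by blast
    then show ?thesis using unit_sol_subset_sum[OF two_is_prime_nat, of C I k i0 w 4] C I(1,4) k by auto
  qed
  have XI: "X \<subseteq> I" "Y \<subseteq> I" using X(1) Y(1) I by auto
  from t show ?thesis
  proof
    assume "\<exists>t1\<in>I. \<exists>t2\<in>I. t1 \<noteq> t2 \<and> w t1 mod 8 = 4 \<and> w t2 mod 8 = 4"
    then obtain t1 t2 where t: "t1 \<in> I" "t2 \<in> I" "t1 \<noteq> t2" "w t1 mod 8 = 4" "w t2 mod 8 = 4" by blast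
    have tn: "t1 \<notin> X" "t1 \<notin> Y" "t2 \<notin> X" "t2 \<notin> Y" using low t by blast+
    define X' where "X' = (if 8 dvd (\<Sum>i\<in>X. w i) then X else insert t1 X)"
    define Y' where "Y' = (if 8 dvd (\<Sum>i\<in>Y. w i) then Y else insert t2 Y)"
    have X': "8 dvd (\<Sum>i\<in>X'. w i)"
    proof (cases "8 dvd (\<Sum>i\<in>X. w i)")
      case False
      then have "8 dvd w t1 + (\<Sum>i\<in>X. w i)" using X(3) t(4) by presburger
      then show ?thesis using False tn finXY by (simp add: X'_def)
    qed (simp add: X'_def)
    have Y': "8 dvd (\<Sum>i\<in>Y'. w i)"
    proof (cases "8 dvd (\<Sum>i\<in>Y. w i)")
      case False
      then have "8 dvd w t2 + (\<Sum>i\<in>Y. w i)" using Y(3) t(5) by presburger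
      then show ?thesis using False tn finXY by (simp add: Y'_def)
    qed (simp add: Y'_def)
    have sub: "X' \<subseteq> I" "Y' \<subseteq> I" "X' \<inter> J0 \<noteq> {}" "Y' \<inter> J0 \<noteq> {}" using XI t X(2) Y(2) by (auto simp: X'_def Y'_def)
    have d: "X' \<inter> Y' = {}" "finite X'" "finite Y'" using XY tn t(3) finXY by (auto simp: X'_def Y'_def)
    show ?thesis
    proof (cases "16 dvd (\<Sum>i\<in>X'. w i) \<or> 16 dvd (\<Sum>i\<in>Y'. w i)")
      case True then show ?thesis using fsol sub by blast
    next
      case False
      have "16 dvd a + b" if "8 dvd a" "8 dvd b" "\<not> 16 dvd a" "\<not> 16 dvd b" for a b :: int
        using that by presburger
      then have "16 dvd (\<Sum>i\<in>X'. w i) + (\<Sum>i\<in>Y'. w i)" using X' Y' False by blast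
      then have "16 dvd (\<Sum>i\<in>X' \<union> Y'. w i)" using d by (simp add: sum.union_disjoint)
      then show ?thesis using fsol[of "X' \<union> Y'"] sub by blast
    qed
  next
    assume "\<exists>t\<in>I. w t mod 16 = 8"
    then obtain t where t: "t \<in> I" "w t mod 16 = 8" by blast
    have "\<exists>C. C \<subseteq> X \<union> Y \<and> C \<inter> J0 \<noteq> {} \<and> 8 dvd (\<Sum>i\<in>C. w i)"
    proof (cases "8 dvd (\<Sum>i\<in>X. w i) \<or> 8 dvd (\<Sum>i\<in>Y. w i)")
      case True then show ?thesis using X(2) Y(2) by blast
    next
      case False
      have "8 dvd a + b" if "4 dvd a" "4 dvd b" "\<not> 8 dvd a" "\<not> 8 dvd b" for a b :: int
        using that by presburger
      then have "8 dvd (\<Sum>i\<in>X. w i) + (\<Sum>i\<in>Y. w i)" using X(3) Y(3) False by blast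
      then have "8 dvd (\<Sum>i\<in>X \<union> Y. w i)" using XY finXY by (simp add: sum.union_disjoint)
      then show ?thesis using X(2) by blast
    qed
    then obtain C where C: "C \<subseteq> X \<union> Y" "C \<inter> J0 \<noteq> {}" "8 dvd (\<Sum>i\<in>C. w i)" by blast
    have tC: "t \<notin> C" "finite C" using low t(2) C(1) finXY by (blast, meson finite_UnI finite_subset)
    show ?thesis
    proof (cases "16 dvd (\<Sum>i\<in>C. w i)")
      case True then show ?thesis using fsol[of C] C XI by blast
    next
      case False
      then have "16 dvd w t + (\<Sum>i\<in>C. w i)" using C(3) t(2) by presburger
      then have "16 dvd (\<Sum>i\<in>insert t C. w i)" using tC by simp
      then show ?thesis using fsol[of "insert t C"] C XI t(1) by blast
    qed
  qed
qed

section \<open>Normalisation of the valuations and solubility in general\<close>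

text \<open>The cycle lemma: start where the excess \<open>S\<close> of the partial sums over their
  mean growth is minimal. From there every initial segment of length j holds at least its share j s
  / k.\<close>

lemma cyclic_start:
  fixes V :: "nat \<Rightarrow> nat"
  assumes k: "k > 0" and per: "\<And>j. V (j + k) = V j" and s: "(\<Sum>j<k. V j) = s"
  shows "\<exists>l. \<forall>j. j * s \<le> k * (\<Sum>i<j. V (l + i))"
proof -
  define S where "S n = int k * int (\<Sum>i<n. V i) - int n * int s" for n
  have add: "(\<Sum>i<a + b. V i) = (\<Sum>i<a. V i) + (\<Sum>i<b. V (a + i))" for a b
    by (induction b) auto
  have "(\<Sum>i<n + k. V i) = (\<Sum>i<n. V i) + s" for n
  proof -
    have "V (k + i) = V i" for i using per[of i] by (simp add: add.commute)
    then have "(\<Sum>i<k + n. V i) = s + (\<Sum>i<n. V i)" using add[of k n] s by simp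
    then show ?thesis by (simp add: add.commute)
  qed
  then have perS: "S (n + k) = S n" for n
    unfolding S_def by (simp only:) (simp add: algebra_simps)
  obtain l where l: "l < k" "\<And>n. n < k \<Longrightarrow> S l \<le> S n"
    using ex_min_if_finite[of "S ` {..<k}"] k by (metis (no_types, lifting) arg_min_if_finite(1) arg_min_least finite_lessThan lessThan_empty_iff lessThan_iff not_gr_zero)
  have min: "S l \<le> S n" for n
  proof (induction n rule: less_induct)
    case (less n)
    show ?case
    proof (cases "n < k")
      case False
      then show ?thesis using less[of "n - k"] perS[of "n - k"] k by simp
    qed (use l in auto)
  qed
  have "j * s \<le> k * (\<Sum>i<j. V (l + i))" for j
  proof -
    have "S (l + j) - S l = int k * int (\<Sum>i<j. V (l + i)) - int j * int s"
      by (simp only: S_def add) (simp add: algebra_simps)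
    then have "int (j * s) \<le> int (k * (\<Sum>i<j. V (l + i)))" using min[of "l + j"] by simp
    then show ?thesis by (simp only: of_nat_le_iff)
  qed
  then show ?thesis by blast
qed

text \<open>The expression is e - l modulo k; adding k l first keeps the subtraction of natural
  numbers from being truncated.\<close>

lemma level_cong_iff:
  fixes e k l j :: nat
  assumes "j < k"
  shows "(e + k * l - l) mod k = j \<longleftrightarrow> e mod k = (l + j) mod k"
proof -
  have kl: "l \<le> k * l" using assms by (cases k) auto
  have x: "(e + k * l - l) + l = e + k * l" by (rule le_add_diff_inverse2) (rule trans_le_add2[OF kl])
  have "(e + k * l - l) mod k = j \<longleftrightarrow> [e + k * l - l = j] (mod k)" using assms by (simp add: cong_def)
  also have "\<dots> \<longleftrightarrow> [(e + k * l - l) + l = j + l] (mod k)" by (simp add: cong_add_rcancel_nat)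
  also have "\<dots> \<longleftrightarrow> e mod k = (l + j) mod k" unfolding x by (simp add: cong_def add.commute)
  finally show ?thesis .
qed

text \<open>Replacing x_i by p^(f_i) y_i adds k f_i to the valuation of the i-th coefficient. All
  valuations can be raised to the common value N = l + k W plus the level of the coefficient, and a
  unit solution for the levels becomes a solution with E = N.\<close>

lemma psol_of_unit_sol:
  fixes e :: "nat \<Rightarrow> nat" and u :: "nat \<Rightarrow> int"
  assumes p: "prime p" and k: "k > 0" and c: "\<And>i. i \<in> {1..s} \<Longrightarrow> c i = int p ^ e i * u i" "\<And>i. i \<in> {1..s} \<Longrightarrow> \<not> int p dvd u i"
    and sol: "unit_sol p G k {1..s} (\<lambda>i. int p ^ ((e i + k * l - l) mod k) * u i)"
  shows "psol p G k s c"
proof -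
  have pp: "prime (int p)" "int p > 0" using p by (auto simp: prime_gt_0_nat)
  define lev q where "lev i = (e i + k * l - l) mod k" and "q i = (e i + k * l - l) div k" for i
  \<comment> \<open>Large enough for \<open>W + l - q i\<close> to be a genuine difference.\<close>
  define W where "W = (\<Sum>i=1..s. e i)"
  define f where "f i = W + l - q i" for i
  have kl: "l \<le> k * l" using k by (cases k) auto
  have exp: "e i + k * f i = (l + k * W) + lev i" if i: "i \<in> {1..s}" for i
  proof -
    have "e i + k * l - l = k * q i + lev i" by (simp add: lev_def q_def)
    then have 1: "e i + k * l = l + k * q i + lev i" using kl by linarith
    have "e i \<le> W" unfolding W_def by (rule member_le_sum[OF i]) auto
    have "k * q i \<le> e i + k * l" using 1 by simp
    also have "\<dots> \<le> k * W + k * l" using \<open>e i \<le> W\<close> k by (simp add: trans_le_add1 le_trans[OF \<open>e i \<le> W\<close>])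
    finally have "q i \<le> W + l" using k by (simp add: distrib_left[symmetric])
    then have "k * f i + k * q i = k * W + k * l" by (simp add: f_def distrib_left[symmetric])
    then show ?thesis using 1 by linarith
  qed
  obtain y i0 where y: "i0 \<in> {1..s}" "\<not> int p dvd int p ^ lev i0 * u i0" "\<not> int p dvd y i0"
    "int p ^ G dvd (\<Sum>i=1..s. int p ^ lev i * u i * y i ^ k)"
    using sol unfolding unit_sol_def lev_def by blast
  define N where "N = l + k * W"
  define x where "x i = int p ^ f i * y i" for i
  have cx: "c i * x i ^ k = int p ^ N * (int p ^ lev i * u i * y i ^ k)" if i: "i \<in> {1..s}" for i
  proof -
    have "c i * x i ^ k = int p ^ (e i + k * f i) * (u i * y i ^ k)"
      by (simp add: c(1)[OF i] x_def power_mult_distrib power_add power_mult[symmetric] mult.commute[of "f i"] mult_ac)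
    then show ?thesis by (simp only: exp[OF i]) (simp add: N_def power_add mult_ac)
  qed
  have "(\<Sum>i=1..s. c i * x i ^ k) = int p ^ N * (\<Sum>i=1..s. int p ^ lev i * u i * y i ^ k)"
    unfolding sum_distrib_left by (intro sum.cong refl cx)
  then have "int p ^ (N + G) dvd (\<Sum>i=1..s. c i * x i ^ k)" using y(4) by (simp add: power_add)
  moreover have "int p ^ N dvd c i0 * x i0 ^ k" by (simp add: cx[OF y(1)])
  moreover have "\<not> int p ^ (N + 1) dvd c i0 * x i0 ^ k"
  proof
    assume "int p ^ (N + 1) dvd c i0 * x i0 ^ k"
    then have "int p ^ N * int p dvd int p ^ N * (int p ^ lev i0 * u i0 * y i0 ^ k)" by (simp add: cx[OF y(1)] mult.commute)
    then have "int p dvd int p ^ lev i0 * u i0 * y i0 ^ k" using pp by simp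
    then show False using y(2,3) pp(1) by (meson prime_dvd_mult_iff prime_dvd_power)
  qed
  ultimately show ?thesis unfolding psol_def using y(1) by blast
qed


lemma sum_card_residue_classes:
  fixes e :: "nat \<Rightarrow> nat"
  assumes "k > 0" "finite A"
  shows "(\<Sum>j<k. card {i \<in> A. e i mod k = j mod k}) = card A"
proof -
  have "(\<Sum>j<k. card {i \<in> A. e i mod k = j mod k}) = (\<Sum>j<k. \<Sum>i\<in>{i \<in> A. e i mod k = j}. 1)"
    by (intro sum.cong refl) auto
  also have "\<dots> = (\<Sum>i\<in>A. 1)"
    by (rule sum.group) (use assms in auto)
  finally show ?thesis by simp
qed

text \<open>Up to k = 6 the number 2^k + 1 is the smaller of the two bounds, from k = 7 on it is 2
  k^2 - 2; each range records what both alternatives imply.\<close>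

lemma diagonal_size_bounds:
  fixes k s :: nat
  assumes "k \<ge> 3" and s: "s \<ge> 2 ^ k + 1 \<or> int s \<ge> 2 * int k ^ 2 - 2"
  shows "k = 3 \<Longrightarrow> s \<ge> 9" "k = 4 \<Longrightarrow> s \<ge> 17" "k = 5 \<Longrightarrow> s \<ge> 33" "k = 6 \<Longrightarrow> s \<ge> 65"
    "k \<ge> 7 \<Longrightarrow> s + 2 \<ge> 2 * k * k" "s \<ge> 3 * k"
proof -
  show 3: "k = 3 \<Longrightarrow> s \<ge> 9" and 4: "k = 4 \<Longrightarrow> s \<ge> 17" and 5: "k = 5 \<Longrightarrow> s \<ge> 33" and 6: "k = 6 \<Longrightarrow> s \<ge> 65"
    using s by auto
  show 7: "s + 2 \<ge> 2 * k * k" if k: "k \<ge> 7"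
  proof -
    have "2 * k * k \<le> 2 ^ k + 3" using k
    proof (induction k rule: nat_induct_at_least)
      case (Suc n)
      have "2 * Suc n * Suc n = 2 * n * n + 4 * n + 2" by simp
      also have "\<dots> \<le> 2 ^ n + 3 + (4 * n + 2)" using Suc by simp
      also have "4 * n + 2 \<le> 2 ^ n"
        using Suc(1) by (induction n rule: nat_induct_at_least) auto
      finally show ?case by simp
    qed simp
    moreover have "2 * k * k \<le> s + 2" if "int s \<ge> 2 * int k ^ 2 - 2"
    proof -
      have "int (2 * k * k) \<le> int (s + 2)" using that by (simp add: power2_eq_square)
      then show ?thesis by (simp only: of_nat_le_iff)
    qed
    ultimately show ?thesis using s by linarith
  qed
  show "s \<ge> 3 * k"
  proof -
    consider "k = 3" | "k = 4" | "k = 5" | "k = 6" | "k \<ge> 7" using assms(1) by linarith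
    then show ?thesis
    proof cases
      case 5
      have "2 * 7 * k \<le> 2 * k * k" using 5 by (intro mult_mono) auto
      then show ?thesis using 7[OF 5] 5 by linarith
    qed (use 3 4 5 6 in auto)
  qed
qed

text \<open>This is the demand of \<open>unit_sol_growth\<close> with G = T + 1. For T = 0 it
  reduces to k \<le> v - 1. For T > 0, p is an odd divisor of k and the left side is k p - k0: for k
  = p = 5 and v = 7 both sides are 24, and for k \<ge> 7 the inequality p \<le> k suffices.\<close>

lemma growth_condition:
  fixes p k T k0 v :: nat
  assumes p: "prime p" and k: "k = p ^ T * k0" "k \<ge> 4" and odd: "p > 2 \<or> T = 0"
    and v: "v \<ge> k + 1" "k = 5 \<Longrightarrow> v \<ge> 7" "k = 6 \<Longrightarrow> v \<ge> 11" "k \<ge> 7 \<Longrightarrow> v \<ge> 2 * k"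
  shows "k0 * (p ^ (T + 1) - 1) \<le> (v - 1) * (p - 1)"
proof (cases "T = 0")
  case True
  then show ?thesis using k v(1) by (auto intro!: mult_mono)
next
  case False
  then have p3: "p \<ge> 3" using odd by auto
  have k0: "k0 > 0" using k by (cases k0) auto
  have pk: "p dvd k" using False k(1) by (simp add: dvd_mult2)
  have rhs: "k0 * (p ^ (T + 1) - 1) = k * p - k0" using k(1) by (simp add: diff_mult_distrib2 mult_ac)
  have "p \<le> k" using pk k(2) by (intro dvd_imp_le) auto
  consider "k = 4" | "k = 5" | "k = 6" | "k \<ge> 7" using k(2) by linarith
  then show ?thesis
  proof cases
    case 1
    then have "p dvd 2 ^ 2" using pk by simp
    then have "p dvd 2" using p prime_dvd_power by blast
    then have "p \<le> 2" by (rule dvd_imp_le) simp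
    then show ?thesis using p3 by simp
  next
    case 2
    then have "p = 3 \<or> p = 4 \<or> p = 5" using p3 \<open>p \<le> k\<close> by linarith
    then have "p = 5" using pk 2 by auto
    moreover have "v - 1 \<ge> 6" using v(2) 2 by simp
    then have "(v - 1) * (p - 1) \<ge> 6 * (p - 1)" by (rule mult_right_mono) simp
    ultimately show ?thesis unfolding rhs using 2 k0 by simp
  next
    case 3
    then have "p = 3 \<or> p = 4 \<or> p = 5 \<or> p = 6" using p3 \<open>p \<le> k\<close> by linarith
    then have p36: "p = 3 \<or> p = 6" using pk 3 by auto
    have "v - 1 \<ge> 10" using v(3) 3 by simp
    then have "(v - 1) * (p - 1) \<ge> 10 * (p - 1)" by (rule mult_right_mono) simp
    then show ?thesis unfolding rhs using 3 k0 p36 by auto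
  next
    case 4
    have "k * p + (k * (p - 2) + 1) = (2 * k - 1) * (p - 1) + p"
    proof -
      obtain q where q: "p = q + 2" using p3 by (metis add.commute le_Suc_ex numeral_2_eq_2 numeral_3_eq_3 Suc_leD)
      obtain r where r: "k = r + 1" using k(2) by (metis add.commute le_Suc_ex one_le_numeral order.trans)
      show ?thesis by (simp add: q r algebra_simps)
    qed
    moreover have "p \<le> k * (p - 2)" using \<open>p \<le> k\<close> p3 by (metis diff_is_0_eq' le_trans mult.right_neutral mult_le_mono2 not_less_eq_eq numeral_2_eq_2 numeral_3_eq_3 One_nat_def Suc_le_eq zero_less_diff)
    ultimately have "k * p \<le> (2 * k - 1) * (p - 1)" by linarith
    also have "\<dots> \<le> (v - 1) * (p - 1)" using v(4)[OF 4] by (intro mult_right_mono) auto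
    finally show ?thesis unfolding rhs by linarith
  qed
qed


text \<open>Coefficients are sorted by their valuation modulo \<open>k\<close>, and the cyclic order
  of these classes is started where the lowest levels are well filled. For k \<ge> 4, growth on the
  lowest level suffices if p is odd or does not divide k. The case k = 3 and the prime 2 dividing k
  are left to the special lemmas, which may draw on higher levels.\<close>

lemma psol_exists:
  assumes p: "prime p" and k: "k \<ge> 3" and s: "s \<ge> 2 ^ k + 1 \<or> int s \<ge> 2 * int k ^ 2 - 2"
    and c: "\<And>i. i \<in> {1..s} \<Longrightarrow> c i \<noteq> 0"
  shows "\<exists>T k0 G. k = p ^ T * k0 \<and> \<not> p dvd k0 \<and> T + 1 \<le> G \<and> (p = 2 \<and> T > 0 \<longrightarrow> T + 2 \<le> G) \<and> psol p G k s c"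
proof -
  note size = diagonal_size_bounds[OF k s]
  have k_pos: "k > 0" using k by simp
  have p_nu: "\<not> is_unit p" "\<not> is_unit (int p)" using p not_prime_unit by auto
  define T where "T = multiplicity p k"
  obtain k0 where k0: "k = p ^ T * k0" "\<not> p dvd k0"
    unfolding T_def using multiplicity_decompose'[OF _ p_nu(1), of k] k by auto
  have k0_pos: "k0 > 0" using k0(2) by (cases k0) auto
  define e where "e i = multiplicity (int p) (c i)" for i
  have "\<exists>u. c i = int p ^ e i * u \<and> \<not> int p dvd u" if "i \<in> {1..s}" for i
    unfolding e_def using multiplicity_decompose'[OF c[OF that] p_nu(2)] by metis
  then obtain u where u: "\<And>i. i \<in> {1..s} \<Longrightarrow> c i = int p ^ e i * u i" "\<And>i. i \<in> {1..s} \<Longrightarrow> \<not> int p dvd u i"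
    by metis
  \<comment> \<open>Defined for every j, with period k, so that the levels can be read off from any
    starting class.\<close>
  define V where "V j = card {i \<in> {1..s}. e i mod k = j mod k}" for j
  have V_per: "V (j + k) = V j" for j by (simp add: V_def)
  have V_sum: "(\<Sum>j<k. V j) = s" unfolding V_def using sum_card_residue_classes[OF k_pos, of "{1..s}" e] by simp
  define lev where "lev l i = (e i + k * l - l) mod k" for l i
  define w where "w l i = int p ^ lev l i * u i" for l i
  define J where "J l j = {i \<in> {1..s}. lev l i = j}" for l j
  have cJ: "card (J l j) = V (l + j)" if "j < k" for l j
    unfolding J_def V_def lev_def level_cong_iff[OF that] ..
  have Jsub: "J l j \<subseteq> {1..s}" for l j by (auto simp: J_def)
  have w0: "\<not> int p dvd w l i" if "i \<in> J l 0" for l i using that u(2) by (auto simp: J_def w_def)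
  have red: ?thesis if "unit_sol p G k {1..s} (w l)" "T + 1 \<le> G" "p = 2 \<and> T > 0 \<longrightarrow> T + 2 \<le> G" for l G
  proof -
    have "psol p G k s c" by (rule psol_of_unit_sol[OF p k_pos u]) (use that(1) in \<open>simp_all add: w_def[abs_def] lev_def\<close>)
    then show ?thesis using k0 that(2,3) by blast
  qed
  obtain l where l: "\<And>j. j * s \<le> k * (\<Sum>i<j. V (l + i))" using cyclic_start[OF k_pos V_per V_sum] by blast
  have v0: "s \<le> k * V l" using l[of 1] by simp
  have v1: "2 * s \<le> k * (V l + V (l + 1))" using l[of 2] by (simp add: numeral_2_eq_2)
  have big: "V l \<ge> 2 * k" "V l + V (l + 1) \<ge> 4 * k" if "k \<ge> 7"
  proof -
    show "V l \<ge> 2 * k"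
    proof (rule ccontr)
      assume "\<not> ?thesis"
      then have "k * (V l + 1) \<le> k * (2 * k)" by (intro mult_left_mono) auto
      then show False using v0 size(5)[OF that] that by (simp add: algebra_simps)
    qed
    show "V l + V (l + 1) \<ge> 4 * k"
    proof (rule ccontr)
      assume "\<not> ?thesis"
      then have "k * (V l + V (l + 1) + 1) \<le> k * (4 * k)" by (intro mult_left_mono) auto
      then show False using v1 size(5)[OF that] that by (simp add: algebra_simps)
    qed
  qed
  have cJ0: "card (J l 0) = V l" using cJ[of 0 l] k by simp
  show ?thesis
  proof (cases "k = 3")
    case k3: True
    then have V3: "V l \<ge> 3" "V l + V (l + 1) \<ge> 6" using v0 v1 size(1) by auto
    show ?thesis
    proof (cases "p = 3")
      case True
      have T1: "T = 1"
        using k0 k3 True k0_pos by (cases T; cases "T - 1") auto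
      have "unit_sol 3 2 3 {1..s} (w l)"
      proof (rule unit_sol_cubes_3[OF _ Jsub[of l 0]])
        show "card (J l 0) \<ge> 4 \<or> card (J l 0) \<ge> 2 \<and> (\<exists>t\<in>{1..s}. 3 dvd w l t \<and> \<not> 9 dvd w l t)"
        proof (cases "V l \<ge> 4")
          case False
          then have "card (J l 1) > 0" using V3 cJ[of 1 l] k3 by simp
          then obtain t where t: "t \<in> J l 1" by (metis card_gt_0_iff equals0I)
          then have "w l t = 3 * u t" "\<not> 3 dvd u t" "t \<in> {1..s}" using u(2) True by (auto simp: J_def w_def)
          then have "3 dvd w l t" "\<not> 9 dvd w l t" "t \<in> {1..s}" by presburger+
          then show ?thesis using V3 cJ0 by auto
        qed (use cJ0 in auto)
      qed (use w0 True in auto)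
      then show ?thesis using red[of 2 l] True k3 T1 by simp
    next
      case False
      have T0: "T = 0"
      proof (rule ccontr)
        assume "T \<noteq> 0"
        then have "p dvd p ^ T * k0" by (simp add: dvd_mult2)
        then have "p dvd 3" using k0(1) k3 by simp
        then have "p \<le> 3" by (rule dvd_imp_le) simp
        then have "p = 2" using False prime_ge_2_nat[OF p] by linarith
        then show False using \<open>p dvd 3\<close> by simp
      qed
      have "unit_sol p 1 3 {1..s} (w l)"
        by (rule unit_sol_cubes[OF p _ Jsub w0]) (use V3 cJ0 in auto)
      then show ?thesis using red[of 1 l] k3 T0 by simp
    qed
  next
    case False
    then have k4: "k \<ge> 4" using k by simp
    have V1: "V l \<ge> k + 1" "k = 5 \<Longrightarrow> V l \<ge> 7" "k = 6 \<Longrightarrow> V l \<ge> 11" "k \<ge> 7 \<Longrightarrow> V l \<ge> 2 * k"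
    proof -
      consider "k = 4" | "k = 5" | "k = 6" | "k \<ge> 7" using k4 by linarith
      then show "V l \<ge> k + 1"
      proof cases
        case 1 then show ?thesis using v0 size(2) by simp
      next
        case 2 then show ?thesis using v0 size(3) by simp
      next
        case 3 then show ?thesis using v0 size(4) by simp
      next
        case 4 then show ?thesis using big(1) by simp
      qed
    qed (use v0 size(3,4) big(1) in auto)
    show ?thesis
    proof (cases "p = 2 \<and> T > 0")
      case False
      then have "p > 2 \<or> T = 0" using prime_ge_2_nat[OF p] by linarith
      then have "k0 * (p ^ (T + 1) - 1) \<le> (V l - 1) * (p - 1)"
        by (rule growth_condition[OF p k0(1) k4 _ V1])
      then have "unit_sol p (T + 1) k {1..s} (w l)"
        by (intro unit_sol_growth[OF p k0(1) k_pos _ Jsub w0]) (auto simp: cJ0)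
      then show ?thesis using red[of "T + 1" l] False by simp
    next
      case True
      then have p2: "p = 2" and T: "T > 0" by auto
      show ?thesis
      proof (cases "V l \<ge> 2 ^ (T + 2)")
        case True
        have "unit_sol p (T + 2) k {1..s} (w l)"
          by (rule unit_sol_many_units[OF p _ Jsub[of l 0] _ k_pos w0]) (use True cJ0 p2 in auto)
        then show ?thesis using red[of "T + 2" l] by simp
      next
        case few: False
        \<comment> \<open>An odd factor k0 \<ge> 3 would mean 3 * 2^T \<le> k, and then the lower
          bounds for \<open>V l\<close> would already provide 2^(T+2) odd coefficients. So k is a
          power of 2.\<close>
        have k0_1: "k0 = 1"
        proof (rule ccontr)
          assume "k0 \<noteq> 1"
          then have k03: "k0 \<ge> 3" using k0(2) p2 k0_pos by (cases "k0 = 2") auto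
          then have "2 ^ T * 3 \<le> k" unfolding k0(1) p2 by simp
          have "even k" using k0(1) p2 T by simp
          then have "k = 4 \<or> k = 6 \<or> k \<ge> 7" using k4 by (cases "k = 5") auto
          then show False
          proof (elim disjE)
            assume "k = 4"
            then show False using \<open>2 ^ T * 3 \<le> k\<close> power_increasing[of 1 T "2::nat"] T by simp
          next
            assume k6: "k = 6"
            have "T = 1"
            proof (rule ccontr)
              assume "T \<noteq> 1"
              then have "(2::nat) ^ 2 \<le> 2 ^ T" using T by (intro power_increasing) auto
              then show False using \<open>2 ^ T * 3 \<le> k\<close> k6 by simp
            qed
            then show False using few V1(3)[OF k6] by simp
          next
            assume "k \<ge> 7"
            then show False using few V1(4) \<open>2 ^ T * 3 \<le> k\<close> by simp
          qed
        qed
        have kT: "k = 2 ^ T" using k0(1) k0_1 p2 by simp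
        have odd_w: "odd (w l i)" if "i \<in> J l 0" for l i using w0[OF that] p2 by simp
        have odd_u: "odd (u i)" if "i \<in> J l j" for l i j
        proof -
          have "i \<in> {1..s}" using that Jsub by blast
          then show ?thesis using u(2)[of i] p2 by simp
        qed
        have w1: "w l i mod 4 = 2" if "i \<in> J l 1" for l i
        proof -
          have "w l i = 2 * u i" using that p2 by (auto simp: J_def w_def)
          then show ?thesis using odd_u[OF that] by presburger
        qed
        have w2: "w l i mod 8 = 4" if "i \<in> J l 2" for l i
        proof -
          have "w l i = 4 * u i" using that p2 by (auto simp: J_def w_def)
          then show ?thesis using odd_u[OF that] by presburger
        qed
        have w3: "w l i mod 16 = 8" if "i \<in> J l 3" for l i
        proof -
          have "w l i = 8 * u i" using that p2 by (auto simp: J_def w_def)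
          then show ?thesis using odd_u[OF that] by presburger
        qed
        have blocks: ?thesis if "V l \<ge> 2 * k" "V l + 2 * V (l + 1) \<ge> 4 * k" for l
        proof -
          have "unit_sol 2 (T + 2) k {1..s} (w l)"
            by (rule unit_sol_blocks[OF _ Jsub[of l 0] Jsub[of l 1] odd_w w1])
              (use that cJ[of 0 l] cJ[of 1 l] k in \<open>auto simp flip: kT\<close>)
          then show ?thesis using red[of "T + 2" l] p2 by simp
        qed
        show ?thesis
        proof (cases "k = 4")
          case False
          have "k \<ge> 7"
          proof (rule ccontr)
            assume "\<not> k \<ge> 7"
            then have "k = 5 \<or> k = 6" using k4 False by linarith
            moreover have "T \<le> 2 \<or> k \<ge> 2 ^ 3" unfolding kT using power_increasing[of 3 T "2::nat"] by linarith
            then have "T = 1 \<or> T = 2" using T \<open>\<not> k \<ge> 7\<close> by auto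
            ultimately show False using kT by auto
          qed
          then show ?thesis using big by (intro blocks[of l]) auto
        next
          case k4': True
          have "T \<le> 2"
          proof (rule ccontr)
            assume "\<not> T \<le> 2"
            then have "(2::nat) ^ 3 \<le> 2 ^ T" by (intro power_increasing) auto
            then show False using kT k4' by simp
          qed
          moreover have "T \<noteq> 1" using kT k4' by auto
          ultimately have T2: "T = 2" using T by linarith
          have s17: "s \<ge> 17" using size(2) k4' by simp
          have V4: "V l \<ge> 5" "V l + V (l + 1) \<ge> 9" "V l + V (l + 1) + V (l + 2) + V (l + 3) \<ge> 17"
            using v0 v1 l[of 4] s17 k4' by (auto simp: eval_nat_numeral)
          have quartic: ?thesis if "V l \<ge> 4" "V l + 2 * V (l + 1) \<ge> 8" "V (l + 2) \<ge> 2 \<or> V (l + 3) \<ge> 1" for l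
          proof -
            have cards: "card (J l 0) = V l" "card (J l 1) = V (l + 1)" "card (J l 2) = V (l + 2)" "card (J l 3) = V (l + 3)"
              using cJ[of 0 l] cJ[of 1 l] cJ[of 2 l] cJ[of 3 l] k4' by auto
            have finJ: "finite (J l j)" for j by (rule finite_subset[OF Jsub]) simp
            have "(\<exists>t1\<in>{1..s}. \<exists>t2\<in>{1..s}. t1 \<noteq> t2 \<and> w l t1 mod 8 = 4 \<and> w l t2 mod 8 = 4) \<or> (\<exists>t\<in>{1..s}. w l t mod 16 = 8)"
              using that(3)
            proof
              assume "V (l + 2) \<ge> 2"
              then obtain a b where "a \<in> J l 2" "b \<in> J l 2" "a \<noteq> b" using card_ge_2E[OF finJ[of 2]] cards by auto
              then show ?thesis using w2 Jsub by blast
            next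
              assume "V (l + 3) \<ge> 1"
              then have "card (J l 3) > 0" using cards by simp
              then obtain t where "t \<in> J l 3" by (metis card_gt_0_iff equals0I)
              then show ?thesis using w3 Jsub by blast
            qed
            then have "unit_sol 2 4 k {1..s} (w l)"
              by (intro unit_sol_quartic_2[OF _ Jsub[of l 0] Jsub[of l 1] odd_w w1]) (use that cards k4' in auto)
            then show ?thesis using red[of 4 l] p2 T2 by simp
          qed
          show ?thesis
          proof (cases "V (l + 2) \<ge> 2 \<or> V (l + 3) \<ge> 1")
            case True
            then show ?thesis using V4 by (intro quartic[of l]) auto
          next
            case no: False
            show ?thesis
            proof (cases "V l \<ge> 8")
              case True
              then show ?thesis using V4 no k4' by (intro blocks[of l]) auto
            next
              case False
              \<comment> \<open>Levels 2 and 3 together hold at most one coefficient and level 0 at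
                most seven, so level 1 holds at least nine of the seventeen. Starting at l + 1
                instead, the old level 0 becomes level 3 and supplies the repairing
                coefficient.\<close>
              have "V (l + 1 + 3) = V l" using V_per[of l] k4' by (simp add: eval_nat_numeral)
              then show ?thesis using V4 no False by (intro quartic[of "l + 1"]) auto
            qed
          qed
        qed
      qed
    qed
  qed
qed

subsection \<open>Euler products\<close>

text \<open>The index set left over after the primes in \<open>P\<close> have been split off. It
  excludes 0, so \<open>rough {}\<close> is the range of summation of the singular series.\<close>

definition rough :: "nat set \<Rightarrow> nat set" where
  "rough P = {q. q > 0 \<and> (\<forall>p\<in>P. \<not> p dvd q)}"

lemma norm_infsum_subset_le:
  fixes f :: "nat \<Rightarrow> complex"
  assumes "(\<lambda>q. norm (f q)) summable_on B" "A \<subseteq> B"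
  shows "norm (infsum f A) \<le> infsum (\<lambda>q. norm (f q)) B"
proof -
  have A: "(\<lambda>q. norm (f q)) summable_on A" by (rule summable_on_subset_banach[OF assms])
  have "norm (infsum f A) \<le> infsum (\<lambda>q. norm (f q)) A" by (rule norm_infsum_bound[OF A])
  also have "\<dots> \<le> infsum (\<lambda>q. norm (f q)) B"
    by (rule infsum_mono_neutral[OF A assms(1)]) (use assms(2) in auto)
  finally show ?thesis .
qed

text \<open>Every q in question is p^j r with r prime to p in exactly one way; absolute summability
  allows the double sum to be iterated.\<close>

lemma euler_step:
  fixes f :: "nat \<Rightarrow> complex"
  assumes mult: "\<And>q r. q > 0 \<Longrightarrow> r > 0 \<Longrightarrow> coprime q r \<Longrightarrow> f (q * r) = f q * f r"
    and sm: "(\<lambda>q. norm (f q)) summable_on UNIV" and p: "prime p" "p \<notin> P" "\<And>p'. p' \<in> P \<Longrightarrow> prime p'"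
  shows "infsum f (rough P) = infsum (\<lambda>j. f (p ^ j)) UNIV * infsum f (rough (insert p P))"
proof -
  let ?R = "rough (insert p P)"
  let ?g = "\<lambda>(j, r). p ^ j * r"
  have p0: "p > 0" "p > 1" using p prime_gt_0_nat prime_gt_1_nat by auto
  have bij: "bij_betw ?g (UNIV \<times> ?R) (rough P)"
  proof (rule bij_betw_imageI)
    show "inj_on ?g (UNIV \<times> ?R)"
    proof (rule inj_onI)
      fix x y assume x: "x \<in> UNIV \<times> ?R" and y: "y \<in> UNIV \<times> ?R" and eq: "?g x = ?g y"
      obtain i a j b where ab: "x = (i, a)" "y = (j, b)" by (metis surj_pair)
      have na: "\<not> p dvd a" "\<not> p dvd b" using x y ab by (auto simp: rough_def)
      have "multiplicity p (p ^ i * a) = i" "multiplicity p (p ^ j * b) = j"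
        using na p0 p(1) by (auto intro!: multiplicity_eqI simp: power_add)
      then have "i = j" using eq ab by simp
      then show "x = y" using eq ab p0 by simp
    qed
    show "?g ` (UNIV \<times> ?R) = rough P"
    proof (intro equalityI subsetI)
      fix q assume "q \<in> ?g ` (UNIV \<times> ?R)"
      then obtain j r where r: "q = p ^ j * r" "r \<in> ?R" by auto
      have "\<not> p' dvd q" if p': "p' \<in> P" for p'
      proof
        assume "p' dvd q"
        then have "p' dvd p ^ j \<or> p' dvd r" using p(3)[OF p'] r(1) by (simp add: prime_dvd_mult_iff)
        then have "p' dvd p" using r(2) p' prime_dvd_power[OF p(3)[OF p']] by (auto simp: rough_def)
        then have "p' = p" using p(1) p(3)[OF p'] primes_dvd_imp_eq by blast
        then show False using p' p(2) by blast
      qed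
      then show "q \<in> rough P" using r p0 by (auto simp: rough_def)
    next
      fix q assume q: "q \<in> rough P"
      then have "q \<noteq> 0" "\<not> is_unit p" using p(1) not_prime_unit by (auto simp: rough_def)
      then obtain r where r: "q = p ^ multiplicity p q * r" "\<not> p dvd r" using multiplicity_decompose' by blast
      have "r dvd q" using r(1) by (metis dvd_triv_right)
      then have "\<not> p' dvd r" if "p' \<in> P" for p' using q that dvd_trans by (auto simp: rough_def)
      moreover have "r > 0" using r(2) by (cases r) auto
      ultimately have "r \<in> ?R" using r(2) by (auto simp: rough_def)
      then show "q \<in> ?g ` (UNIV \<times> ?R)" using r(1) by (intro image_eqI[of _ _ "(multiplicity p q, r)"]) auto
    qed
  qed
  have fm: "f (?g x) = (\<lambda>(j, r). f (p ^ j) * f r) x" if x: "x \<in> UNIV \<times> ?R" for x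
  proof -
    obtain j r where jr: "x = (j, r)" by (metis surj_pair)
    have "r > 0" "\<not> p dvd r" using x jr by (auto simp: rough_def)
    moreover have "coprime (p ^ j) r" using p(1) \<open>\<not> p dvd r\<close> by (simp add: prime_imp_coprime coprime_power_left_iff)
    ultimately show ?thesis using mult[of "p ^ j" r] p0 jr by simp
  qed
  have "f summable_on rough P"
    by (rule abs_summable_summable, rule summable_on_subset_banach[OF sm]) simp
  then have "(\<lambda>x. f (?g x)) summable_on (UNIV \<times> ?R)"
    using summable_on_reindex_bij_betw[OF bij] by blast
  moreover have "(\<lambda>(j, r). f (p ^ j) * f r) summable_on (UNIV \<times> ?R) \<longleftrightarrow> (\<lambda>x. f (?g x)) summable_on (UNIV \<times> ?R)"
    by (rule summable_on_cong) (rule fm[symmetric])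
  ultimately have sm2: "(\<lambda>(j, r). f (p ^ j) * f r) summable_on (UNIV \<times> ?R)" by blast
  have "infsum f (rough P) = infsum (\<lambda>x. f (?g x)) (UNIV \<times> ?R)"
    by (rule infsum_reindex_bij_betw[OF bij, symmetric])
  also have "\<dots> = infsum (\<lambda>(j, r). f (p ^ j) * f r) (UNIV \<times> ?R)"
    by (rule infsum_cong[OF fm])
  also have "\<dots> = infsum (\<lambda>j. infsum (\<lambda>r. f (p ^ j) * f r) ?R) UNIV"
    by (rule infsum_Sigma'_banach[OF sm2, symmetric])
  also have "\<dots> = infsum (\<lambda>j. f (p ^ j)) UNIV * infsum f ?R"
    by (simp add: infsum_cmult_right' infsum_cmult_left')
  finally show ?thesis .
qed

text \<open>After all primes below N + 2 have been split off, what remains is 1 plus a sum over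
  integers at least N, of norm less than 1 by the choice of N. The finitely many factors split off
  are nonzero, so infinite products are avoided.\<close>

lemma euler_nonzero:
  fixes f :: "nat \<Rightarrow> complex"
  assumes f1: "f 1 = 1" and mult: "\<And>q r. q > 0 \<Longrightarrow> r > 0 \<Longrightarrow> coprime q r \<Longrightarrow> f (q * r) = f q * f r"
    and sm: "(\<lambda>q. norm (f q)) summable_on UNIV" and P: "\<And>p'. p' \<in> P \<Longrightarrow> prime p'"
    and nz: "\<And>p. prime p \<Longrightarrow> infsum (\<lambda>j. f (p ^ j)) UNIV \<noteq> 0"
  shows "infsum f (rough P) \<noteq> 0"
proof -
  have "summable (\<lambda>q. norm (f q))" using sm by (rule summable_on_imp_summable)
  then obtain N where N: "norm (\<Sum>q. norm (f (q + N))) < 1"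
    using suminf_exist_split[of 1 "\<lambda>q. norm (f q)"] by (meson order_refl zero_less_one)
  define Q where "Q = {p. prime p \<and> p < N + 2}"
  have nzPQ: "infsum f (rough (P \<union> Q)) \<noteq> 0"
  proof -
    let ?B = "{N..}" and ?A = "rough (P \<union> Q) - {1}"
    have "1 \<notin> P" using P[of 1] by auto
    then have one: "1 \<in> rough (P \<union> Q)" by (auto simp: rough_def Q_def)
    have AB: "?A \<subseteq> ?B"
    proof
      fix q assume q: "q \<in> ?A"
      show "q \<in> ?B"
      proof (rule ccontr)
        assume "q \<notin> ?B"
        then have "q < N" by simp
        have "q \<noteq> 1" using q by simp
        then obtain p where p: "prime p" "p dvd q" using prime_factor_nat by blast
        then have "p \<le> q" using q by (intro dvd_imp_le) (auto simp: rough_def)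
        then have "p \<in> Q" using \<open>q < N\<close> p by (simp add: Q_def)
        then show False using q p(2) by (auto simp: rough_def)
      qed
    qed
    have smB: "(\<lambda>q. norm (f q)) summable_on ?B" by (rule summable_on_subset_banach[OF sm]) simp
    have smA: "f summable_on ?A" by (rule abs_summable_summable, rule summable_on_subset_banach[OF smB AB])
    have "infsum (\<lambda>q. norm (f q)) ?B = infsum (\<lambda>q. norm (f (q + N))) UNIV"
      by (rule infsum_reindex_bij_betw[symmetric]) (rule bij_betw_byWitness[of _ "\<lambda>q. q - N"]; auto)
    also have "\<dots> = (\<Sum>q. norm (f (q + N)))"
    proof -
      have "summable (\<lambda>q. norm (f (q + N)))" using \<open>summable (\<lambda>q. norm (f q))\<close> by (rule summable_ignore_initial_segment)
      then show ?thesis using norm_summable_imp_has_sum[of "\<lambda>q. norm (f (q + N))"]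
        by (intro infsumI) (auto simp: summable_sums)
    qed
    finally have "infsum (\<lambda>q. norm (f q)) ?B < 1" using N by simp
    then have lt: "norm (infsum f ?A) < 1" using norm_infsum_subset_le[OF smB AB] by linarith
    have "rough (P \<union> Q) = insert 1 ?A" using one by blast
    then have "infsum f (rough (P \<union> Q)) = f 1 + infsum f ?A"
      using infsum_insert[OF smA, of 1] by (metis Diff_iff insertI1)
    then show ?thesis using lt f1 by (metis add_eq_0_iff norm_minus_cancel norm_one order_less_irrefl)
  qed
  have finQ: "finite Q" by (rule finite_subset[of _ "{..<N + 2}"]) (auto simp: Q_def)
  have remove: "infsum f (rough P) \<noteq> 0" if "finite S" "\<And>p. p \<in> S \<Longrightarrow> prime p" "infsum f (rough (P \<union> S)) \<noteq> 0" for S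
    using that
  proof (induction S rule: finite_induct)
    case (insert p S)
    have "infsum f (rough (P \<union> S)) \<noteq> 0"
    proof (cases "p \<in> P \<union> S")
      case True
      then have "P \<union> insert p S = P \<union> S" by auto
      then show ?thesis using insert.prems(2) by simp
    next
      case False
      have "infsum f (rough (P \<union> S)) = infsum (\<lambda>j. f (p ^ j)) UNIV * infsum f (rough (insert p (P \<union> S)))"
        by (rule euler_step[OF mult sm _ False]) (use P insert.prems(1) in auto)
      then show ?thesis using nz[of p] insert.prems by simp
    qed
    then show ?case using insert by auto
  qed simp
  show ?thesis by (rule remove[OF finQ _ nzPQ]) (simp add: Q_def)
qed

section \<open>Local densities and their nonvanishing\<close>

lemma sterm_0 [simp]: "sterm k s c 0 = 0"
  by (simp add: sterm_def)

lemma summable_bound_powr: "summable (\<lambda>q. C * real q powr (- 5/3))"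
  by (intro summable_mult) (simp add: summable_real_powr_iff)

text \<open>For one fixed tuple of nonzero coefficients the product of their absolute values serves
  as the common multiple of the gcds.\<close>

lemma sterm_bound_nonzero:
  assumes k: "k \<ge> 3" and s: "s \<ge> 3 * k" and c: "\<And>i. i \<in> {1..s} \<Longrightarrow> c i \<noteq> 0"
  shows "\<exists>C. \<forall>q. norm (sterm k s c q) \<le> C * real q powr (- 5/3)"
proof -
  define R where "R = (\<Prod>i=1..s. \<bar>c i\<bar>)"
  have R: "R > 0" unfolding R_def by (rule prod_pos) (use c in auto)
  have dvd: "gcd (c i) (c j) dvd R" if "i \<in> {1..s}" for i j
  proof -
    have "c i dvd \<bar>c i\<bar>" by simp
    also have "\<bar>c i\<bar> dvd R" unfolding R_def by (rule dvd_prodI) (use that in auto)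
    finally show ?thesis by (meson dvd_trans gcd_dvd1)
  qed
  obtain C where "C \<ge> 0" and C: "\<And>c q. q > 0 \<Longrightarrow> (\<And>i j. i \<in> {1..s} \<Longrightarrow> j \<in> {1..s} \<Longrightarrow> i \<noteq> j \<Longrightarrow> gcd (c i) (c j) dvd R) \<Longrightarrow>
    norm (sterm k s c q) \<le> C * real q powr (- 5/3)"
    using sterm_bound[OF k s R] by blast
  have "norm (sterm k s c q) \<le> C * real q powr (- 5/3)" for q
    using C[of q c] dvd by (cases "q = 0") auto
  then show ?thesis by blast
qed

lemma sterm_abs_summable:
  assumes k: "k \<ge> 3" and s: "s \<ge> 3 * k" and c: "\<And>i. i \<in> {1..s} \<Longrightarrow> c i \<noteq> 0"
  shows "(\<lambda>q. norm (sterm k s c q)) summable_on UNIV"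
proof -
  obtain C where C: "\<forall>q. norm (sterm k s c q) \<le> C * real q powr (- 5/3)"
    using sterm_bound_nonzero[of k s c] k s c by blast
  have "summable (\<lambda>q. norm (sterm k s c q))"
    by (rule summable_comparison_test'[OF summable_bound_powr[of C]]) (use C in auto)
  then show ?thesis using norm_summable_imp_summable_on[of "\<lambda>q. norm (sterm k s c q)"] by simp
qed

text \<open>Given as a series over the powers of p; through \<open>sum_sterm_prime_powers\<close>
  its partial sums are the normalised solution counts that usually define the density.\<close>

definition padic_density :: "nat \<Rightarrow> nat \<Rightarrow> (nat \<Rightarrow> int) \<Rightarrow> nat \<Rightarrow> complex" where
  "padic_density k s c p = infsum (\<lambda>j. sterm k s c (p ^ j)) UNIV"

lemma padic_density_sums:
  assumes k: "k \<ge> 3" and s: "s \<ge> 3 * k" and c: "\<And>i. i \<in> {1..s} \<Longrightarrow> c i \<noteq> 0" and p: "prime p"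
  shows "(\<lambda>j. sterm k s c (p ^ j)) sums padic_density k s c p"
    and "summable (\<lambda>j. norm (sterm k s c (p ^ j)))"
proof -
  have inj: "inj (\<lambda>j. p ^ j)" using prime_gt_1_nat[OF p] by (auto intro!: injI)
  have "(\<lambda>q. norm (sterm k s c q)) summable_on range (\<lambda>j. p ^ j)"
    by (rule summable_on_subset_banach[OF sterm_abs_summable[OF k s c]]) auto
  then have sm: "(\<lambda>j. norm (sterm k s c (p ^ j))) summable_on UNIV"
    using summable_on_reindex[OF inj, of "\<lambda>q. norm (sterm k s c q)"] by (simp add: o_def)
  then show "summable (\<lambda>j. norm (sterm k s c (p ^ j)))" by (rule summable_on_imp_summable)
  have "(\<lambda>j. sterm k s c (p ^ j)) summable_on UNIV" using sm by (rule abs_summable_summable)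
  then have "((\<lambda>j. sterm k s c (p ^ j)) has_sum padic_density k s c p) UNIV"
    unfolding padic_density_def by (rule has_sum_infsum)
  then show "(\<lambda>j. sterm k s c (p ^ j)) sums padic_density k s c p" by (rule has_sum_imp_sums)
qed

text \<open>The p^((n-L)(s-1)) solutions of \<open>nsol_lower_bound\<close> keep every partial sum
  from n = L on above the fixed positive number p^(-L(s-1)).\<close>

lemma padic_density_nonzero:
  assumes k: "k \<ge> 3" and s: "s \<ge> 2 ^ k + 1 \<or> int s \<ge> 2 * int k ^ 2 - 2"
    and c: "\<And>i. i \<in> {1..s} \<Longrightarrow> c i \<noteq> 0" and p: "prime p"
  shows "padic_density k s c p \<noteq> 0"
proof -
  have s3: "s \<ge> 3 * k" by (rule diagonal_size_bounds(6)[OF k s])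
  have pp: "p > 0" using p prime_gt_0_nat by auto
  obtain T k0 G where T: "k = p ^ T * k0" "\<not> p dvd k0" "T + 1 \<le> G" "p = 2 \<and> T > 0 \<longrightarrow> T + 2 \<le> G" "psol p G k s c"
    using psol_exists[of p k s c] p k s c by blast
  obtain L where L: "\<forall>n\<ge>L. p ^ ((n - L) * (s - 1)) \<le> nsol k s c (p ^ n)"
    using nsol_lower_bound[OF p T(1,2,3) _ T(5)] T(4) by blast
  have "1 / real p ^ (L * (s - 1)) \<le> Re (padic_density k s c p)"
  proof (rule LIMSEQ_le_const)
    show "(\<lambda>n. Re (\<Sum>j\<le>n. sterm k s c (p ^ j))) \<longlonglongrightarrow> Re (padic_density k s c p)"
      using padic_density_sums(1)[OF k s3 c p] by (intro tendsto_Re) (simp add: sums_def_le)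
    show "\<exists>N. \<forall>n\<ge>N. 1 / real p ^ (L * (s - 1)) \<le> Re (\<Sum>j\<le>n. sterm k s c (p ^ j))"
    proof (intro exI[of _ L] allI impI)
      fix n assume n: "n \<ge> L"
      have "n * s = (n - L) * (s - 1) + L * (s - 1) + n"
      proof -
        obtain m where m: "n = L + m" using n le_Suc_ex by blast
        obtain s' where s': "s = Suc s'" using s3 k by (cases s) auto
        show ?thesis by (simp add: m s' algebra_simps)
      qed
      then have "real p ^ (n * s) = real p ^ ((n - L) * (s - 1)) * real p ^ (L * (s - 1)) * real p ^ n"
        by (simp only: power_add)
      moreover have "real (p ^ ((n - L) * (s - 1))) \<le> real (nsol k s c (p ^ n))" using L n by (simp only: of_nat_le_iff)
      ultimately have "real p ^ (n * s) \<le> real (nsol k s c (p ^ n)) * real p ^ (L * (s - 1)) * real p ^ n"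
        by (simp add: mult_right_mono)
      then have "1 / real p ^ (L * (s - 1)) \<le> real (p ^ n) * real (nsol k s c (p ^ n)) / real p ^ (n * s)"
        using pp by (simp add: field_simps)
      then show "1 / real p ^ (L * (s - 1)) \<le> Re (\<Sum>j\<le>n. sterm k s c (p ^ j))"
        by (simp only: sum_sterm_prime_powers[OF p] Re_complex_of_real)
    qed
  qed
  moreover have "1 / real p ^ (L * (s - 1)) > 0" using pp by simp
  ultimately have "Re (padic_density k s c p) > 0" by linarith
  then show ?thesis by auto
qed

text \<open>Stated for all sets of primes because the sum over integers prime to one p must later be
  cancelled.\<close>

lemma sterm_infsum_rough_nonzero:
  assumes k: "k \<ge> 3" and s: "s \<ge> 2 ^ k + 1 \<or> int s \<ge> 2 * int k ^ 2 - 2"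
    and c: "\<And>i. i \<in> {1..s} \<Longrightarrow> c i \<noteq> 0" and P: "\<And>p. p \<in> P \<Longrightarrow> prime p"
  shows "infsum (sterm k s c) (rough P) \<noteq> 0"
proof (rule euler_nonzero)
  have s3: "s \<ge> 3 * k" by (rule diagonal_size_bounds(6)[OF k s])
  show "(\<lambda>q. norm (sterm k s c q)) summable_on UNIV" by (rule sterm_abs_summable[OF k s3 c])
  show "sterm k s c (q * r) = sterm k s c q * sterm k s c r" if "q > 0" "r > 0" "coprime q r" for q r
    using sterm_mult[OF that] k by simp
  show "infsum (\<lambda>j. sterm k s c (p ^ j)) UNIV \<noteq> 0" if "prime p" for p
    using padic_density_nonzero[OF k s c that] by (simp add: padic_density_def)
  show "sterm k s c 1 = 1" by (rule sterm_1)
qed (rule P)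

subsection \<open>A prime at which the local density varies\<close>

lemma sum_coprime_prime_power:
  assumes p: "prime p" and j: "j > 0"
  shows "(\<Sum>a\<in>{0..<int (p ^ j)}. if coprime a (int (p ^ j)) then z else (0::complex)) = (of_nat p ^ j - of_nat p ^ (j - 1)) * z"
proof -
  have pp: "int p > 0" using p by (auto simp: prime_gt_0_nat)
  have e: "int (p ^ j) = int p * int p ^ (j - 1)" using j by (cases j) auto
  have "(\<Sum>a\<in>{0..<int (p ^ j)}. if coprime a (int (p ^ j)) then z else 0) =
      (\<Sum>a\<in>{0..<int (p ^ j)}. z - (if int p dvd a then z else 0))"
    by (intro sum.cong refl) (simp add: coprime_prime_power_iff[OF p j, simplified])
  also have "\<dots> = of_nat (p ^ j) * z - (\<Sum>a\<in>{0..<int p * int p ^ (j - 1)}. if int p dvd a then z else 0)"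
    unfolding sum_subtractf e[symmetric] by (simp add: nat_power_eq)
  also have "(\<Sum>a\<in>{0..<int p * int p ^ (j - 1)}. if int p dvd a then z else 0) = of_nat p ^ (j - 1) * z"
    using sum_multiples_prime[of "int p" "int p ^ (j - 1)" "\<lambda>_. z"] pp by (simp add: nat_power_eq)
  finally show ?thesis by (simp add: algebra_simps)
qed

lemma sterm_const:
  assumes p: "prime p" and j: "j > 0"
    and g: "\<And>a i. \<not> int p dvd a \<Longrightarrow> i \<in> {1..s} \<Longrightarrow> gauss_S k (p ^ j) (a * c i) = g i"
  shows "sterm k s c (p ^ j) = (\<Prod>i=1..s. g i) * (of_nat p ^ j - of_nat p ^ (j - 1)) / of_nat p ^ (j * s)"
proof -
  have "(\<Sum>a\<in>{0..<int (p ^ j)}. if coprime a (int (p ^ j)) then \<Prod>i=1..s. gauss_S k (p ^ j) (a * c i) else 0) =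
      (\<Sum>a\<in>{0..<int (p ^ j)}. if coprime a (int (p ^ j)) then \<Prod>i=1..s. g i else 0)"
    by (intro sum.cong refl if_cong prod.cong) (use g coprime_prime_power_iff[OF p j] in auto)
  then show ?thesis unfolding sterm_def sum_coprime_prime_power[OF p j]
    by (simp add: power_mult mult.commute)
qed

text \<open>Coprimality to p^(j+k) and to p^j mean the same only for j > 0. The longer sum over
  \<open>a\<close> consists of p^k copies of the shorter one.\<close>

lemma sterm_shift:
  assumes p: "prime p" and j: "j > 0"
    and g: "\<And>a i. \<not> int p dvd a \<Longrightarrow> i \<in> {1..s} \<Longrightarrow> gauss_S k (p ^ (j + k)) (a * c i) = g i * gauss_S k (p ^ j) (a * c' i)"
  shows "sterm k s c (p ^ (j + k)) = (\<Prod>i=1..s. g i) * of_nat p ^ k / of_nat p ^ (k * s) * sterm k s c' (p ^ j)"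
proof -
  have pp: "int p > 0" "p > 0" using p by (auto simp: prime_gt_0_nat)
  let ?f = "\<lambda>a. if coprime a (int (p ^ j)) then \<Prod>i=1..s. gauss_S k (p ^ j) (a * c' i) else 0"
  have cop: "coprime a (int (p ^ (j + k))) \<longleftrightarrow> coprime a (int (p ^ j))" for a
    using coprime_prime_power_iff[OF p, of j a] coprime_prime_power_iff[OF p, of "j + k" a] j by simp
  have "(\<Sum>a\<in>{0..<int (p ^ (j + k))}. if coprime a (int (p ^ (j + k))) then \<Prod>i=1..s. gauss_S k (p ^ (j + k)) (a * c i) else 0) =
      (\<Sum>a\<in>{0..<int (p ^ (j + k))}. (\<Prod>i=1..s. g i) * ?f a)"
  proof (intro sum.cong refl)
    fix a
    show "(if coprime a (int (p ^ (j + k))) then \<Prod>i=1..s. gauss_S k (p ^ (j + k)) (a * c i) else 0) = (\<Prod>i=1..s. g i) * ?f a"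
    proof (cases "int p dvd a")
      case True
      then show ?thesis using cop coprime_prime_power_iff[OF p j, of a] by simp
    next
      case False
      then have "coprime a (int (p ^ j))" using coprime_prime_power_iff[OF p j, of a] by simp
      then show ?thesis unfolding cop using g[OF False] by (simp add: prod.distrib[symmetric])
    qed
  qed
  also have "\<dots> = (\<Prod>i=1..s. g i) * (\<Sum>a\<in>{0..<int (p ^ j) * int (p ^ k)}. ?f a)"
    by (simp only: sum_distrib_left power_add of_nat_mult)
  also have "(\<Sum>a\<in>{0..<int (p ^ j) * int (p ^ k)}. ?f a) = of_int (int (p ^ k)) * (\<Sum>a\<in>{0..<int (p ^ j)}. ?f a)"
    by (rule sum_residues_periodic[OF periodic_coprime_prod]) (use pp in auto)
  finally have sum: "(\<Sum>a\<in>{0..<int (p ^ (j + k))}. if coprime a (int (p ^ (j + k))) then \<Prod>i=1..s. gauss_S k (p ^ (j + k)) (a * c i) else 0) =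
    (\<Prod>i=1..s. g i) * (of_int (int (p ^ k)) * (\<Sum>a\<in>{0..<int (p ^ j)}. ?f a))" .
  have e: "(of_nat (p ^ (j + k)) :: complex) ^ s = of_nat p ^ (k * s) * of_nat (p ^ j) ^ s"
    by (simp only: power_add of_nat_mult of_nat_power power_mult_distrib power_mult mult.commute)
  show ?thesis unfolding sterm_def sum e by simp
qed

lemma sum_phi_telescope:
  fixes P :: "'a::comm_ring_1"
  assumes "m \<le> k" "m > 0"
  shows "(\<Sum>j=m..k. P ^ j - P ^ (j - 1)) = P ^ k - P ^ (m - 1)"
  using assms
proof (induction k rule: dec_induct)
  case base then show ?case by simp
next
  case (step n) then show ?case by simp
qed

text \<open>When the terms beyond index \<open>k\<close> are \<open>z\<close> times those of a
  second series, the two sums are linearly related. The shift does not cover index 0, hence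
  \<open>E - g 0\<close>.\<close>

lemma suminf_shift_relation:
  fixes f g :: "nat \<Rightarrow> complex"
  assumes f: "f sums D" and g: "g sums E" and shift: "\<And>j. j > 0 \<Longrightarrow> f (j + k) = z * g j"
  shows "D = (\<Sum>j\<le>k. f j) + z * (E - g 0)"
proof -
  have 1: "(\<lambda>j. f (j + Suc k)) sums (D - (\<Sum>j<Suc k. f j))" using f by (subst sums_iff_shift) simp
  have 2: "(\<lambda>j. f (j + Suc k)) = (\<lambda>j. z * g (Suc j))" using shift[of "Suc _"] by simp
  have 3: "(\<lambda>j. z * g (Suc j)) sums (z * (E - g 0))" using g by (intro sums_mult) (simp add: sums_Suc_iff)
  have "D - (\<Sum>j<Suc k. f j) = z * (E - g 0)" by (rule sums_unique2[OF 1[unfolded 2] 3])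
  then have "D = z * (E - g 0) + (\<Sum>j<Suc k. f j)" by (simp only: diff_eq_eq)
  then show ?thesis by (simp only: lessThan_Suc_atMost add.commute)
qed

context
  fixes p k s :: nat
  assumes p: "prime p" and k: "k \<ge> 3" and pk: "\<not> p dvd k" and s: "s \<ge> 3 * k"
begin

lemma gauss_S_unit_shift:
  assumes "\<not> int p dvd a" "j > 0"
  shows "gauss_S k (p ^ (j + k)) a = of_nat p ^ (k - 1) * gauss_S k (p ^ j) a"
  using gauss_S_prime_power_rec[OF p assms(1), of k 0 k "j + k"] assms(2) k pk by simp

lemma gauss_S_prime_power_mult: "gauss_S k (p ^ (j + n)) (int p ^ n * a) = of_nat p ^ n * gauss_S k (p ^ j) a"
  using gauss_S_scale[of "p ^ n" "p ^ j" k a] p by (simp add: prime_gt_0_nat power_add mult.commute)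

text \<open>Taking out the factor p lowers the exponent of the modulus by one, and the recursion for
  unit arguments then applies unless j = 1. In that case both sides are p^k by direct
  evaluation.\<close>

lemma gauss_S_one_shift:
  assumes "\<not> int p dvd a" "j > 0"
  shows "gauss_S k (p ^ (j + k)) (int p * a) = of_nat p ^ (k - 1) * gauss_S k (p ^ j) (int p * a)"
proof (cases "j = 1")
  case True
  have "gauss_S k (p ^ (1 + k)) (int p * a) = of_nat p * gauss_S k (p ^ k) a"
    using gauss_S_prime_power_mult[of k 1 a] by (simp add: add.commute)
  also have "\<dots> = of_nat p * of_nat p ^ (k - 1)"
    using gauss_S_prime_power_small[OF p assms(1) pk, of k] k by simp
  also have "of_nat p * of_nat p ^ (k - 1) = of_nat p ^ (k - 1) * gauss_S k (p ^ 1) (int p * a)"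
    using gauss_S_prime_power_mult[of 0 1 a] by (simp del: One_nat_def)
  finally show ?thesis using True by simp
next
  case False
  obtain i where "j = Suc i" using assms(2) by (cases j) auto
  then have i: "j = i + 1" "i > 0" using False by auto
  have "gauss_S k (p ^ (j + k)) (int p * a) = of_nat p * gauss_S k (p ^ (i + k)) a"
    using gauss_S_prime_power_mult[of "i + k" 1 a] by (simp add: i add_ac)
  also have "\<dots> = of_nat p ^ (k - 1) * (of_nat p * gauss_S k (p ^ i) a)"
    by (simp add: gauss_S_unit_shift[OF assms(1) i(2)])
  also have "of_nat p * gauss_S k (p ^ i) a = gauss_S k (p ^ j) (int p * a)"
    using gauss_S_prime_power_mult[of i 1 a] by (simp add: i)
  finally show ?thesis .
qed

lemma not_dvd_mult: "\<not> int p dvd a \<Longrightarrow> \<not> int p dvd b \<Longrightarrow> \<not> int p dvd a * b"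
  using p by (simp add: prime_dvd_mult_iff)

lemma prod_special: "(\<Prod>i=1..s. if i = 1 then x else y) = x * y ^ (s - 1)" for x y :: complex
proof -
  have "{1..s} = insert 1 {2..s}" using s k by auto
  then have "(\<Prod>i=1..s. if i = 1 then x else y) = x * (\<Prod>i\<in>{2..s}. if i = 1 then x else y)" by simp
  also have "(\<Prod>i\<in>{2..s}. if i = 1 then x else y) = (\<Prod>i\<in>{2..s}. y)" by (intro prod.cong) auto
  finally show ?thesis by simp
qed

text \<open>The terms repeat with period \<open>k\<close> up to the factor p^(k-s), so D satisfies a
  linear equation. In the first period the term at p^2 vanishes and those at p^3, ..., p^k
  telescope; the coefficients enter only through the term at p, that is, modulo p.\<close>

lemma density_val_1:
  assumes c1: "c 1 = int p * u" "\<not> int p dvd u" and ci: "\<And>i. i \<in> {2..s} \<Longrightarrow> \<not> int p dvd c i"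
  defines "D \<equiv> padic_density k s c p" and "P \<equiv> of_nat p :: complex"
  shows "D - 1 = sterm k s c p + (P ^ k - P\<^sup>2) / P ^ s + P ^ k / P ^ s * (D - 1)"
proof -
  have pp: "p > 0" "int p > 0" using p by (auto simp: prime_gt_0_nat)
  have P0: "P \<noteq> 0" using pp by (simp add: P_def)
  have s1: "s \<ge> 1" using s k by simp
  have c0: "c i \<noteq> 0" if "i \<in> {1..s}" for i
  proof (cases "i = 1")
    case True then show ?thesis using c1 pp by auto
  next
    case False
    then have "\<not> int p dvd c i" using ci that by simp
    then show ?thesis by auto
  qed
  have D: "(\<lambda>j. sterm k s c (p ^ j)) sums D" unfolding D_def by (rule padic_density_sums(1)[OF k s c0 p])
  have shift: "sterm k s c (p ^ (j + k)) = P ^ k / P ^ s * sterm k s c (p ^ j)" if j: "j > 0" for j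
  proof -
    have "sterm k s c (p ^ (j + k)) = (\<Prod>i=1..s. P ^ (k - 1)) * P ^ k / P ^ (k * s) * sterm k s c (p ^ j)"
      unfolding P_def
    proof (rule sterm_shift[OF p j])
      fix a i assume a: "\<not> int p dvd a" and i: "i \<in> {1..s}"
      show "gauss_S k (p ^ (j + k)) (a * c i) = of_nat p ^ (k - 1) * gauss_S k (p ^ j) (a * c i)"
      proof (cases "i = 1")
        case True
        have ac: "a * c i = int p * (a * u)" unfolding True c1(1) by (rule mult.left_commute)
        show ?thesis unfolding ac by (rule gauss_S_one_shift[OF not_dvd_mult[OF a c1(2)] j])
      next
        case False
        then show ?thesis using gauss_S_unit_shift[OF not_dvd_mult[OF a ci] j] i by simp
      qed
    qed
    also have "(\<Prod>i=1..s. P ^ (k - 1)) * P ^ k / P ^ (k * s) = P ^ k / P ^ s"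
    proof -
      have "P ^ (k * s) = P ^ ((k - 1) * s) * P ^ s" using k by (simp add: power_add[symmetric] diff_mult_distrib)
      then show ?thesis using P0 by (simp add: power_mult[symmetric] field_simps)
    qed
    finally show ?thesis .
  qed
  have val: "sterm k s c (p ^ j) = (P ^ j - P ^ (j - 1)) / P ^ s" if j: "j \<in> {3..k}" for j
  proof -
    have "sterm k s c (p ^ j) = (\<Prod>i=1..s. P ^ (j - 1)) * (P ^ j - P ^ (j - 1)) / P ^ (j * s)"
      unfolding P_def
    proof (rule sterm_const[OF p])
      fix a i assume a: "\<not> int p dvd a" and i: "i \<in> {1..s}"
      show "gauss_S k (p ^ j) (a * c i) = of_nat p ^ (j - 1)"
      proof (cases "i = 1")
        case True
        have "gauss_S k (p ^ (j - 1 + 1)) (int p ^ 1 * (a * u)) = of_nat p ^ 1 * gauss_S k (p ^ (j - 1)) (a * u)"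
          by (rule gauss_S_prime_power_mult)
        also have "gauss_S k (p ^ (j - 1)) (a * u) = of_nat p ^ (j - 1 - 1)"
          by (rule gauss_S_prime_power_small[OF p not_dvd_mult[OF a c1(2)] pk]) (use j in auto)
        also have "of_nat p ^ 1 * of_nat p ^ (j - 1 - 1) = (of_nat p ^ (1 + (j - 1 - 1)) :: complex)" by (simp only: power_add)
        also have "1 + (j - 1 - 1) = j - 1" using j by (simp only: atLeastAtMost_iff) linarith
        also have "int p ^ 1 * (a * u) = a * c i" unfolding True c1(1) by simp
        also have "j - 1 + 1 = j" using j by (simp only: atLeastAtMost_iff) linarith
        finally show ?thesis .
      next
        case False
        then show ?thesis using gauss_S_prime_power_small[OF p not_dvd_mult[OF a ci] pk, of i j] i j by simp
      qed
    qed (use j in auto)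
    also have "\<dots> = (P ^ j - P ^ (j - 1)) / P ^ s"
    proof -
      have "P ^ (j * s) = P ^ ((j - 1) * s) * P ^ s" using j by (simp add: power_add[symmetric] diff_mult_distrib)
      then show ?thesis using P0 by (simp add: power_mult[symmetric] field_simps)
    qed
    finally show ?thesis .
  qed
  \<comment> \<open>All Gauss sums but the first are constant in \<open>a\<close>, and the first one
    averages to zero over the units: the sum of S(p, a u) over all residues is p, which is exactly
    the term a = 0.\<close>
  have val2: "sterm k s c (p ^ 2) = 0"
  proof -
    let ?S = "\<lambda>a. if coprime a (int (p ^ 1)) then gauss_S k p (a * u) else 0"
    have "(\<Sum>a\<in>{0..<int (p ^ 2)}. if coprime a (int (p ^ 2)) then \<Prod>i=1..s. gauss_S k (p ^ 2) (a * c i) else 0) =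
        (\<Sum>a\<in>{0..<int p * int p}. (P * P ^ (s - 1)) * ?S a)"
    proof (rule sum.cong)
      fix a
      show "(if coprime a (int (p ^ 2)) then \<Prod>i=1..s. gauss_S k (p ^ 2) (a * c i) else 0) = (P * P ^ (s - 1)) * ?S a"
      proof (cases "int p dvd a")
        case True
        then show ?thesis using coprime_prime_power_iff[OF p, of 2 a] coprime_prime_power_iff[OF p, of 1 a] by simp
      next
        case False
        have "(\<Prod>i=1..s. gauss_S k (p ^ 2) (a * c i)) = (\<Prod>i=1..s. if i = 1 then P * gauss_S k p (a * u) else P)"
        proof (intro prod.cong refl)
          fix i assume i: "i \<in> {1..s}"
          show "gauss_S k (p ^ 2) (a * c i) = (if i = 1 then P * gauss_S k p (a * u) else P)"
          proof (cases "i = 1")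
            case True
            have ac: "a * c i = int p ^ 1 * (a * u)" unfolding True c1(1) by simp
            show ?thesis unfolding ac using gauss_S_prime_power_mult[of 1 1 "a * u"] True
              by (simp add: P_def eval_nat_numeral)
          next
            case False
            then show ?thesis using gauss_S_prime_power_small[OF p not_dvd_mult[OF \<open>\<not> int p dvd a\<close> ci] pk, of i 2] i k
              by (simp add: P_def)
          qed
        qed
        then show ?thesis using False coprime_prime_power_iff[OF p, of 2 a] coprime_prime_power_iff[OF p, of 1 a]
          by (simp only: prod_special) simp
      qed
    qed (simp add: power2_eq_square)
    also have "\<dots> = (P * P ^ (s - 1)) * (\<Sum>a\<in>{0..<int p * int p}. ?S a)"
      by (simp only: sum_distrib_left)
    also have "(\<Sum>a\<in>{0..<int p * int p}. ?S a) = of_int (int p) * (\<Sum>a\<in>{0..<int p}. ?S a)"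
    proof (rule sum_residues_periodic)
      show "periodic (int p) ?S"
        using periodic_coprime_prod[where q = p and s = "1::nat" and k = k and c = "\<lambda>_. u"] pp by (simp cong: if_cong)
    qed (use pp in auto)
    also have "(\<Sum>a\<in>{0..<int p}. ?S a) = 0"
    proof -
      have "(\<Sum>a\<in>{0..<int p}. ?S a) = (\<Sum>a\<in>{0..<int p}. gauss_S k p (a * u) - (if int p dvd a then gauss_S k p (a * u) else 0))"
        by (intro sum.cong refl) (use coprime_prime_power_iff[OF p, of 1] in auto)
      also have "\<dots> = (\<Sum>a\<in>{0..<int p}. gauss_S k p (a * u)) - (\<Sum>a\<in>{0..<int p * 1}. if int p dvd a then gauss_S k p (a * u) else 0)"
        by (simp add: sum_subtractf)
      also have "(\<Sum>a\<in>{0..<int p * 1}. if int p dvd a then gauss_S k p (a * u) else 0) = (\<Sum>v\<in>{0..<1}. gauss_S k p (int p * v * u))"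
        by (rule sum_multiples_prime) (use pp in auto)
      also have "\<dots> = of_nat p"
      proof -
        have "{0..<1::int} = {0}" by auto
        then show ?thesis using gauss_S_zero[OF pp(1), of k] by simp
      qed
      also have "(\<Sum>a\<in>{0..<int p}. gauss_S k p (a * u)) = (\<Sum>a\<in>{0..<int p}. gauss_S k p (u * a + 0))"
        by (simp add: mult.commute)
      also have "\<dots> = (\<Sum>a\<in>{0..<int p}. gauss_S k p a)"
      proof (rule sum_residues_affine)
        show "periodic (int p) (gauss_S k p)" by (rule periodicI) (rule gauss_S_cong[OF pp(1)])
        show "coprime u (int p)" using coprime_prime_power_iff[OF p, of 1 u] c1(2) by simp
      qed (use pp in auto)
      also have "\<dots> = of_nat p" by (rule sum_gauss_S_prime[OF p]) (use k in simp)
      finally show ?thesis by simp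
    qed
    finally show ?thesis by (simp add: sterm_def)
  qed
  have "D = (\<Sum>j\<le>k. sterm k s c (p ^ j)) + P ^ k / P ^ s * (D - sterm k s c (p ^ 0))"
    by (rule suminf_shift_relation[OF D D shift])
  also have "(\<Sum>j\<le>k. sterm k s c (p ^ j)) = 1 + sterm k s c p + (P ^ k - P\<^sup>2) / P ^ s"
  proof -
    have "{..k} = {0,1,2} \<union> {3..k}" using k by auto
    then have "(\<Sum>j\<le>k. sterm k s c (p ^ j)) = (\<Sum>j\<in>{0,1,2}. sterm k s c (p ^ j)) + (\<Sum>j\<in>{3..k}. sterm k s c (p ^ j))"
      by (simp only:) (rule sum.union_disjoint, auto)
    also have "(\<Sum>j\<in>{3..k}. sterm k s c (p ^ j)) = (\<Sum>j=3..k. P ^ j - P ^ (j - 1)) / P ^ s"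
      unfolding sum_divide_distrib by (intro sum.cong refl val)
    also have "(\<Sum>j=3..k. P ^ j - P ^ (j - 1)) = P ^ k - P\<^sup>2"
      using sum_phi_telescope[of 3 k P] k by simp
    also have "(\<Sum>j\<in>{0,1,2}. sterm k s c (p ^ j)) = 1 + sterm k s c p"
      using val2 sterm_1[of k s c] by simp
    finally show ?thesis .
  qed
  also have "sterm k s c (p ^ 0) = 1" by (simp only: power_0 sterm_1)
  finally have eq: "D = 1 + sterm k s c p + (P ^ k - P\<^sup>2) / P ^ s + P ^ k / P ^ s * (D - 1)" .
  have "x - 1 = a + b + y" if "x = 1 + a + b + y" for x a b y :: complex using that by simp
  from this[OF eq] show ?thesis .
qed

text \<open>Up to p^k the first Gauss sum has the trivial value p^j, one factor P more than the
  others. Beyond p^k, taking p^k out of the first coefficient leaves it divisible by p exactly once,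
  and the remaining series is that of E.\<close>

lemma density_val_Suc_k:
  assumes c1: "c 1 = int p ^ (k + 1) * u" "\<not> int p dvd u" and ci: "\<And>i. i \<in> {2..s} \<Longrightarrow> \<not> int p dvd c i"
  defines "D \<equiv> padic_density k s c p" and "E \<equiv> padic_density k s (c(1 := int p * u)) p" and "P \<equiv> of_nat p :: complex"
  shows "D = 1 + sterm k s c p + P * (P ^ k - P) / P ^ s + P * (P ^ k / P ^ s) * (E - 1)"
proof -
  have pp: "p > 0" "int p > 0" using p by (auto simp: prime_gt_0_nat)
  have P0: "P \<noteq> 0" using pp by (simp add: P_def)
  have s1: "s \<ge> 1" using s k by simp
  let ?c = "c(1 := int p * u)"
  have c0: "c i \<noteq> 0" "?c i \<noteq> 0" if "i \<in> {1..s}" for i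
  proof -
    have "c i \<noteq> 0 \<and> ?c i \<noteq> 0"
    proof (cases "i = 1")
      case True then show ?thesis using c1 pp by auto
    next
      case False
      then have "\<not> int p dvd c i" using ci that by simp
      then show ?thesis using False by auto
    qed
    then show "c i \<noteq> 0" "?c i \<noteq> 0" by auto
  qed
  have D: "(\<lambda>j. sterm k s c (p ^ j)) sums D" unfolding D_def by (rule padic_density_sums(1)[OF k s c0(1) p])
  have E: "(\<lambda>j. sterm k s ?c (p ^ j)) sums E" unfolding E_def by (rule padic_density_sums(1)[OF k s c0(2) p])
  have shift: "sterm k s c (p ^ (j + k)) = P * (P ^ k / P ^ s) * sterm k s ?c (p ^ j)" if j: "j > 0" for j
  proof -
    have "sterm k s c (p ^ (j + k)) = (\<Prod>i=1..s. if i = 1 then P ^ k else P ^ (k - 1)) * P ^ k / P ^ (k * s) * sterm k s ?c (p ^ j)"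
      unfolding P_def
    proof (rule sterm_shift[OF p j])
      fix a i assume a: "\<not> int p dvd a" and i: "i \<in> {1..s}"
      show "gauss_S k (p ^ (j + k)) (a * c i) = (if i = 1 then of_nat p ^ k else of_nat p ^ (k - 1)) * gauss_S k (p ^ j) (a * ?c i)"
      proof (cases "i = 1")
        case True
        have ac: "a * c i = int p ^ k * (a * (int p * u))" unfolding True c1(1) by (simp add: mult_ac)
        show ?thesis unfolding ac using True gauss_S_prime_power_mult[of j k "a * (int p * u)"] by simp
      next
        case False
        then show ?thesis using gauss_S_unit_shift[OF not_dvd_mult[OF a ci] j] i by simp
      qed
    qed
    also have "(\<Prod>i=1..s. if i = 1 then P ^ k else P ^ (k - 1)) * P ^ k / P ^ (k * s) = P * (P ^ k / P ^ s)"
    proof -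
      obtain k' s' where ks: "k = Suc k'" "s = Suc s'" using k s1 by (metis One_nat_def Suc_le_D numeral_3_eq_3)
      show ?thesis using P0 unfolding prod_special unfolding ks by (simp add: power_mult[symmetric] power_add field_simps)
    qed
    finally show ?thesis .
  qed
  have val: "sterm k s c (p ^ j) = P * (P ^ j - P ^ (j - 1)) / P ^ s" if j: "j \<in> {2..k}" for j
  proof -
    have "sterm k s c (p ^ j) = (\<Prod>i=1..s. if i = 1 then P ^ j else P ^ (j - 1)) * (P ^ j - P ^ (j - 1)) / P ^ (j * s)"
      unfolding P_def
    proof (rule sterm_const[OF p])
      fix a i assume a: "\<not> int p dvd a" and i: "i \<in> {1..s}"
      show "gauss_S k (p ^ j) (a * c i) = (if i = 1 then of_nat p ^ j else of_nat p ^ (j - 1))"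
      proof (cases "i = 1")
        case True
        have "int p ^ (k + 1) = int p ^ j * int p ^ (k + 1 - j)" using j by (simp add: power_add[symmetric])
        then have ac: "a * c i = int p ^ j * (a * (int p ^ (k + 1 - j) * u))" unfolding True c1(1) by (simp only: mult_ac)
        show ?thesis unfolding ac using True gauss_S_prime_power_mult[of 0 j "a * (int p ^ (k + 1 - j) * u)"] by (simp flip: One_nat_def)
      next
        case False
        then show ?thesis using gauss_S_prime_power_small[OF p not_dvd_mult[OF a ci] pk, of i j] i j by simp
      qed
    qed (use j in auto)
    also have "\<dots> = P * (P ^ j - P ^ (j - 1)) / P ^ s"
    proof -
      obtain j' s' where js: "j = Suc j'" "s = Suc s'" using j s1 by (cases j; cases s) auto
      show ?thesis using P0 unfolding prod_special unfolding js by (simp add: power_mult[symmetric] power_add field_simps)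
    qed
    finally show ?thesis .
  qed
  have "D = (\<Sum>j\<le>k. sterm k s c (p ^ j)) + P * (P ^ k / P ^ s) * (E - sterm k s ?c (p ^ 0))"
    by (rule suminf_shift_relation[OF D E shift])
  also have "(\<Sum>j\<le>k. sterm k s c (p ^ j)) = 1 + sterm k s c p + P * (P ^ k - P) / P ^ s"
  proof -
    have "{..k} = {0,1} \<union> {2..k}" using k by auto
    then have "(\<Sum>j\<le>k. sterm k s c (p ^ j)) = (\<Sum>j\<in>{0,1}. sterm k s c (p ^ j)) + (\<Sum>j\<in>{2..k}. sterm k s c (p ^ j))"
      by (simp only:) (rule sum.union_disjoint, auto)
    also have "(\<Sum>j\<in>{2..k}. sterm k s c (p ^ j)) = (\<Sum>j=2..k. P * (P ^ j - P ^ (j - 1)) / P ^ s)"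
      by (intro sum.cong refl val)
    also have "\<dots> = P * (\<Sum>j=2..k. P ^ j - P ^ (j - 1)) / P ^ s"
      by (simp only: sum_divide_distrib sum_distrib_left)
    also have "(\<Sum>j=2..k. P ^ j - P ^ (j - 1)) = P ^ k - P"
      using sum_phi_telescope[of 2 k P] k by simp
    also have "(\<Sum>j\<in>{0,1}. sterm k s c (p ^ j)) = 1 + sterm k s c p"
      using sterm_1[of k s c] by simp
    finally show ?thesis .
  qed
  also have "sterm k s ?c (p ^ 0) = 1" by (simp only: power_0 sterm_1)
  finally show ?thesis .
qed

end


text \<open>D and E solve the same linear equation, in which \<theta> \<noteq> 1, and are therefore
  equal. Substitution into the formula for D' gives D' - D = (P - 1) \<theta> D, and D is nonzero by
  \<open>padic_density_nonzero\<close>.\<close>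

lemma local_density_varies:
  assumes p: "prime p" and k: "k \<ge> 3" and pk: "\<not> p dvd k" and s: "s \<ge> 2 ^ k + 1 \<or> int s \<ge> 2 * int k ^ 2 - 2"
    and c: "c 1 = int p * u" "\<not> int p dvd u" "\<And>i. i \<in> {2..s} \<Longrightarrow> \<not> int p dvd c i"
    and c': "c' 1 = int p ^ (k + 1) * u'" "\<not> int p dvd u'" "\<And>i. i \<in> {2..s} \<Longrightarrow> [c i = c' i] (mod int p)"
  shows "padic_density k s c p \<noteq> padic_density k s c' p"
proof -
  have s3: "s \<ge> 3 * k" by (rule diagonal_size_bounds(6)[OF k s])
  have pp: "prime (int p)" "p > 1" using prime_gt_1_nat[OF p] p by auto
  have ci': "\<not> int p dvd c' i" if "i \<in> {2..s}" for i
    using c(3)[OF that] c'(3)[OF that] by (simp add: cong_dvd_iff)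
  define P where "P = (of_nat p :: complex)"
  define D D' E where "D = padic_density k s c p" and "D' = padic_density k s c' p"
    and "E = padic_density k s (c'(1 := int p * u')) p"
  define \<theta> where "\<theta> = P ^ k / P ^ s"
  have P: "P \<noteq> 0" "P \<noteq> 1" using pp by (auto simp: P_def)
  have Ps: "P ^ s \<noteq> 0" using P by simp
  have "\<theta> \<noteq> 1"
  proof
    assume "\<theta> = 1"
    then have "P ^ k = P ^ s" using Ps by (simp add: \<theta>_def)
    then have "(of_nat (p ^ k) :: complex) = of_nat (p ^ s)" by (simp add: P_def)
    then have "p ^ k = p ^ s" by (simp only: of_nat_eq_iff)
    then have "k = s" using pp(2) by simp
    then show False using s3 k by simp
  qed
  have t: "sterm k s c p = sterm k s (c'(1 := int p * u')) p" "sterm k s c p = sterm k s c' p"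
  proof -
    have "[c i = (c'(1 := int p * u')) i] (mod int p) \<and> [c i = c' i] (mod int p)" if "i \<in> {1..s}" for i
    proof (cases "i = 1")
      case True
      have "int p dvd c 1" "int p dvd int p * u'" "int p dvd c' 1" unfolding c(1) c'(1) by simp_all
      then show ?thesis using True by (simp add: cong_def dvd_eq_mod_eq_0)
    next
      case False
      then show ?thesis using c'(3)[of i] that by simp
    qed
    then show "sterm k s c p = sterm k s (c'(1 := int p * u')) p" "sterm k s c p = sterm k s c' p"
      using pp by (intro sterm_cong; simp)+
  qed
  have D: "D - 1 = sterm k s c p + (P ^ k - P\<^sup>2) / P ^ s + \<theta> * (D - 1)"
    unfolding D_def P_def \<theta>_def by (rule density_val_1[where c = c and u = u, OF p k pk s3 c])
  have E: "E - 1 = sterm k s c p + (P ^ k - P\<^sup>2) / P ^ s + \<theta> * (E - 1)"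
    unfolding E_def P_def \<theta>_def t(1) by (rule density_val_1[where c = "c'(1 := int p * u')" and u = u', OF p k pk s3]) (use c' ci' in auto)
  have D': "D' = 1 + sterm k s c p + P * (P ^ k - P) / P ^ s + P * \<theta> * (E - 1)"
    unfolding D'_def P_def \<theta>_def E_def t(2) by (rule density_val_Suc_k[where c = c' and u = u', OF p k pk s3 c'(1,2) ci'])
  have "(1 - \<theta>) * (D - E) = (D - 1 - \<theta> * (D - 1)) - (E - 1 - \<theta> * (E - 1))" by (simp add: algebra_simps)
  also have "\<dots> = 0" using D E by (simp add: algebra_simps)
  finally have DE: "E = D" using \<open>\<theta> \<noteq> 1\<close> by simp
  have a1: "P * (P ^ k - P) / P ^ s - (P ^ k - P\<^sup>2) / P ^ s = (P - 1) * \<theta>"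
    by (simp add: \<theta>_def diff_divide_distrib[symmetric] power2_eq_square algebra_simps)
  have "D' - D = (P * (P ^ k - P) / P ^ s - (P ^ k - P\<^sup>2) / P ^ s) + (P * \<theta> * (D - 1) - \<theta> * (D - 1))"
  proof -
    have "D = 1 + (sterm k s c p + (P ^ k - P\<^sup>2) / P ^ s + \<theta> * (D - 1))" using D by (simp add: algebra_simps)
    moreover have "D' = 1 + sterm k s c p + P * (P ^ k - P) / P ^ s + P * \<theta> * (D - 1)" using D' DE by simp
    moreover have "x - y = (b - c) + (e - f)" if "x = 1 + a + b + e" "y = 1 + (a + c + f)" for x y a b c e f :: complex
      using that by simp
    ultimately show ?thesis by blast
  qed
  also have "\<dots> = (P - 1) * \<theta> * D" unfolding a1 by (simp add: algebra_simps)
  finally have "D' - D = (P - 1) * \<theta> * D" .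
  moreover have "D \<noteq> 0" unfolding D_def
  proof (rule padic_density_nonzero[OF k s _ p])
    fix i assume i: "i \<in> {1..s}"
    show "c i \<noteq> 0"
    proof (cases "i = 1")
      case True then show ?thesis using c(1,2) pp by auto
    next
      case False
      then have "\<not> int p dvd c i" using c(3)[of i] i by simp
      then show ?thesis by auto
    qed
  qed
  moreover have "\<theta> \<noteq> 0" using P by (simp add: \<theta>_def)
  ultimately show ?thesis using P by (auto simp: D_def D'_def)
qed

subsection \<open>Values of integer polynomials\<close>

lemma poly_add_expand:
  fixes f :: "int poly"
  shows "\<exists>z. poly f (x + y) = poly f x + poly (pderiv f) x * y + y\<^sup>2 * z"
proof (induction f)
  case (pCons a f)
  then obtain z where z: "poly f (x + y) = poly f x + poly (pderiv f) x * y + y\<^sup>2 * z" by blast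
  have "poly (pCons a f) (x + y) = poly (pCons a f) x + poly (pderiv (pCons a f)) x * y + y\<^sup>2 * (poly (pderiv f) x + (x + y) * z)"
    by (simp add: z pderiv_pCons algebra_simps power2_eq_square)
  then show ?case by blast
qed (auto intro: exI[of _ 0])

lemma poly_cong_int:
  fixes f :: "int poly"
  assumes "[x = y] (mod m)"
  shows "[poly f x = poly f y] (mod m)"
proof (induction f)
  case (pCons a f)
  have "[a + x * poly f x = a + y * poly f y] (mod m)" by (intro cong_add cong_mult cong_refl assms pCons)
  then show ?case by simp
qed simp

text \<open>Newton steps from a simple zero modulo p. The target \<open>v\<close> may be any
  multiple of p, not only 0, since values with a prescribed exact power of p are wanted.\<close>

lemma poly_hensel:
  fixes f :: "int poly"
  assumes p: "prime p" and t0: "int p dvd poly f t0" "\<not> int p dvd poly (pderiv f) t0" and v: "int p dvd v"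
  shows "\<exists>t. [t = t0] (mod int p) \<and> [poly f t = v] (mod int p ^ Suc j)"
proof (induction j)
  case 0
  have "[poly f t0 = v] (mod int p)" using t0(1) v by (simp add: cong_def dvd_eq_mod_eq_0)
  then show ?case by (intro exI[of _ t0]) simp
next
  case (Suc j)
  then obtain t where t: "[t = t0] (mod int p)" "[poly f t = v] (mod int p ^ Suc j)" by blast
  have pp: "prime (int p)" using p by simp
  have "\<not> int p dvd poly (pderiv f) t" using poly_cong_int[OF t(1), of "pderiv f"] t0(2) by (simp add: cong_dvd_iff)
  then have "coprime (poly (pderiv f) t) (int p)" using prime_imp_coprime[OF pp, of "poly (pderiv f) t"] by (simp add: coprime_commute)
  then obtain w where w: "[poly (pderiv f) t * w = 1] (mod int p)" using cong_solve_coprime_int by blast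
  have "int p ^ Suc j dvd v - poly f t" using t(2) by (simp add: cong_iff_dvd_diff dvd_diff_commute)
  then obtain D where D: "v - poly f t = int p ^ Suc j * D" by (elim dvdE)
  define y where "y = int p ^ Suc j * (w * D)"
  obtain z where z: "poly f (t + y) = poly f t + poly (pderiv f) t * y + y\<^sup>2 * z" using poly_add_expand by blast
  have "int p dvd poly (pderiv f) t * w - 1" using w by (simp add: cong_iff_dvd_diff)
  then obtain r where r: "poly (pderiv f) t * w - 1 = int p * r" by (elim dvdE)
  have "poly f (t + y) - v = - (v - poly f t) + poly (pderiv f) t * y + y\<^sup>2 * z" by (simp only: z)
  also have "\<dots> = int p ^ Suc j * (D * (poly (pderiv f) t * w - 1)) + y\<^sup>2 * z"
    by (simp only: D) (simp add: y_def algebra_simps)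
  also have "\<dots> = int p ^ Suc (Suc j) * (D * r + int p ^ j * ((w * D)\<^sup>2 * z))"
    by (simp only: r) (simp add: y_def algebra_simps power2_eq_square)
  finally have "[poly f (t + y) = v] (mod int p ^ Suc (Suc j))" by (simp add: cong_iff_dvd_diff)
  moreover have "[t + y = t0 + 0] (mod int p)" by (intro cong_add t(1)) (simp add: y_def cong_0_iff)
  ultimately show ?case by (intro exI[of _ "t + y"]) simp
qed

text \<open>Euclid's argument: with a the constant coefficient, f(a M n) = a (1 + M (...)), and
  every prime factor of the cofactor is prime to \<open>M\<close>. As f takes the values a and -a
  only finitely often, some n makes the cofactor different from 1 and -1.\<close>

lemma poly_prime_divisor_coprime:
  fixes f :: "int poly"
  assumes deg: "degree f > 0" and nz: "\<And>x. poly f x \<noteq> 0" and M: "M > 0"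
  shows "\<exists>p t. prime p \<and> \<not> int p dvd M \<and> int p dvd poly f t"
proof -
  obtain a g where f: "f = pCons a g" by (cases f)
  have a: "a \<noteq> 0" using nz[of 0] by (simp add: f)
  have fin: "finite {x. poly f x = z}" for z
  proof -
    have "f - [:z:] \<noteq> 0" using deg by (metis degree_pCons_0 eq_iff_diff_eq_0 less_irrefl)
    then have "finite {x. poly (f - [:z:]) x = 0}" by (rule poly_roots_finite)
    then show ?thesis by simp
  qed
  have "infinite (range (\<lambda>n::nat. a * M * int n))"
    by (rule range_inj_infinite) (use a M in \<open>auto intro!: injI\<close>)
  then have "\<not> range (\<lambda>n::nat. a * M * int n) \<subseteq> {x. poly f x = a} \<union> {x. poly f x = - a}"
    using fin by (meson finite_UnI finite_subset)
  then obtain n :: nat where n: "poly f (a * M * int n) \<noteq> a" "poly f (a * M * int n) \<noteq> - a" by auto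
  define t where "t = a * M * int n"
  define v where "v = 1 + M * (int n * poly g t)"
  have ft: "poly f t = a * v" by (simp add: f v_def t_def algebra_simps)
  have "v \<noteq> 0" "v \<noteq> 1" "v \<noteq> - 1" using nz[of t] n ft by (auto simp: t_def)
  then have "nat \<bar>v\<bar> \<noteq> 1" by auto
  then obtain p where p: "prime p" "p dvd nat \<bar>v\<bar>" using prime_factor_nat by blast
  then have "int p dvd int (nat \<bar>v\<bar>)" by (simp only: int_dvd_int_iff)
  then have pv: "int p dvd v" by simp
  have "\<not> int p dvd M"
  proof
    assume "int p dvd M"
    then have "int p dvd M * (int n * poly g t)" by simp
    then have "int p dvd 1" using pv unfolding v_def by (metis dvd_add_left_iff)
    then show False using p(1) by (simp add: prime_nat_iff)
  qed
  moreover have "int p dvd poly f t" using pv ft by simp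
  ultimately show ?thesis using p(1) by blast
qed

subsection \<open>Mean values of uniformly limit periodic functions\<close>

text \<open>The deviation \<open>D\<close> of the partial sums from linear growth is itself
  periodic, hence bounded.\<close>

lemma periodic_mean:
  fixes g :: "int \<Rightarrow> real"
  assumes Q: "Q > 0" and g: "\<And>t. g (t + int Q) = g t"
  shows "(\<lambda>N. (\<Sum>n<N. g (1 + int n)) / real N) \<longlonglongrightarrow> (\<Sum>n<Q. g (1 + int n)) / real Q"
proof -
  define S where "S N = (\<Sum>n<N. g (1 + int n))" for N
  define D where "D N = S N - real N * (S Q / real Q)" for N
  have S_add: "S (N + Q) = S N + S Q" for N
  proof -
    have "S (Q + N) = S Q + (\<Sum>n<N. g (1 + int (Q + n)))"
      unfolding S_def by (induction N) (auto simp: algebra_simps)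
    also have "(\<Sum>n<N. g (1 + int (Q + n))) = S N"
      unfolding S_def by (intro sum.cong refl) (use g[of "1 + int _"] in \<open>simp add: add_ac\<close>)
    finally show ?thesis by (simp add: add.commute)
  qed
  have D_per: "D (N + Q) = D N" for N using Q by (simp add: D_def S_add distrib_right)
  define K where "K = (\<Sum>n<Q. \<bar>D n\<bar>)"
  have D_le: "\<bar>D N\<bar> \<le> K" for N
  proof (induction N rule: less_induct)
    case (less N)
    show ?case
    proof (cases "N < Q")
      case True
      then show ?thesis unfolding K_def by (intro member_le_sum) auto
    next
      case False
      then show ?thesis using less[of "N - Q"] D_per[of "N - Q"] Q by simp
    qed
  qed
  have "(\<lambda>N. D N / real N) \<longlonglongrightarrow> 0"
  proof (rule Lim_null_comparison)
    show "\<forall>\<^sub>F N in sequentially. norm (D N / real N) \<le> K / real N"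
      using D_le by (intro always_eventually allI) (simp add: divide_right_mono)
    show "(\<lambda>N. K / real N) \<longlonglongrightarrow> 0" by (rule lim_const_over_n)
  qed
  then have "(\<lambda>N. D N / real N + S Q / real Q) \<longlonglongrightarrow> 0 + S Q / real Q" by (intro tendsto_add tendsto_const)
  moreover have "\<forall>\<^sub>F N in sequentially. D N / real N + S Q / real Q = S N / real N"
    using eventually_gt_at_top[of 0] by eventually_elim (simp add: D_def field_simps)
  ultimately show ?thesis unfolding S_def by (simp add: tendsto_cong)
qed

lemma limit_periodic_mean:
  fixes f :: "int \<Rightarrow> real"
  assumes approx: "\<And>e. e > 0 \<Longrightarrow> \<exists>Q g. Q > 0 \<and> (\<forall>t. g (t + int Q) = g t) \<and> (\<forall>t. \<bar>f t - g t\<bar> \<le> e)"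
  obtains c where "(\<lambda>N. (\<Sum>n<N. f (1 + int n)) / real N) \<longlonglongrightarrow> c"
proof -
  let ?a = "\<lambda>N. (\<Sum>n<N. f (1 + int n)) / real N"
  have "Cauchy ?a"
  proof (rule CauchyI)
    fix e :: real assume e: "e > 0"
    obtain Q g where Q: "Q > 0" "\<And>t. g (t + int Q) = g t" "\<And>t. \<bar>f t - g t\<bar> \<le> e / 5"
      using approx[of "e / 5"] e by auto
    let ?b = "\<lambda>N. (\<Sum>n<N. g (1 + int n)) / real N" and ?L = "(\<Sum>n<Q. g (1 + int n)) / real Q"
    have ab: "\<bar>?a N - ?b N\<bar> \<le> e / 5" for N
    proof (cases "N = 0")
      case True then show ?thesis using e by simp
    next
      case False
      have "\<bar>(\<Sum>n<N. f (1 + int n)) - (\<Sum>n<N. g (1 + int n))\<bar> \<le> (\<Sum>n<N. e / 5)"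
        unfolding sum_subtractf[symmetric] by (rule order.trans[OF sum_abs sum_mono]) (rule Q(3))
      then have "\<bar>(\<Sum>n<N. f (1 + int n)) - (\<Sum>n<N. g (1 + int n))\<bar> / real N \<le> real N * (e / 5) / real N"
        by (intro divide_right_mono) auto
      then show ?thesis using False by (simp add: diff_divide_distrib[symmetric])
    qed
    have "\<exists>M. \<forall>N\<ge>M. norm (?b N - ?L) < e / 5"
      using LIMSEQ_D[OF periodic_mean[where g = g, OF Q(1,2)], of "e / 5"] e by simp
    then obtain M where M: "\<And>N. N \<ge> M \<Longrightarrow> \<bar>?b N - ?L\<bar> < e / 5" by auto
    have "\<bar>?a m - ?a n\<bar> < e" if "m \<ge> M" "n \<ge> M" for m n
      using ab[of m] ab[of n] M[OF that(1)] M[OF that(2)] by linarith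
    then show "\<exists>M. \<forall>m\<ge>M. \<forall>n\<ge>M. norm (?a m - ?a n) < e" by (auto simp: real_norm_def)
  qed
  then have "convergent ?a" by (rule Cauchy_convergent)
  then show ?thesis using that by (auto simp: convergent_def)
qed

text \<open>A nearby periodic function shows that f stays bounded away from 0 on the whole residue
  class of \<open>t0\<close>, which has positive density.\<close>

lemma limit_periodic_mean_pos:
  fixes f :: "int \<Rightarrow> real"
  assumes approx: "\<And>e. e > 0 \<Longrightarrow> \<exists>Q g. Q > 0 \<and> (\<forall>t. g (t + int Q) = g t) \<and> (\<forall>t. \<bar>f t - g t\<bar> \<le> e)"
    and nonneg: "\<And>t. f t \<ge> 0" and pos: "f t0 > 0"
    and c: "(\<lambda>N. (\<Sum>n<N. f (1 + int n)) / real N) \<longlonglongrightarrow> c"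
  shows "c > 0"
proof -
  \<comment> \<open>On the class of \<open>t0\<close> this gives f t \<ge> g t - d = g t0 - d \<ge>
    f t0 - 2 d = 2 d, more than the bound \<open>d\<close> used below.\<close>
  define d where "d = f t0 / 4"
  have d: "d > 0" using pos by (simp add: d_def)
  obtain Q g where Q: "Q > 0" "\<And>t. g (t + int Q) = g t" "\<And>t. \<bar>f t - g t\<bar> \<le> d"
    using approx[OF d] by auto
  have per: "g (t + int Q * int n) = g t" for t n
  proof (induction n)
    case (Suc n)
    then show ?case using Q(2)[of "t + int Q * int n"] by (simp add: algebra_simps)
  qed simp
  have gc: "g t = g t0" if dvd: "int Q dvd t - t0" for t
  proof -
    obtain z where "t - t0 = int Q * z" using dvd by (elim dvdE)
    then have z: "t = t0 + int Q * z" by simp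
    show ?thesis
    proof (cases "z \<ge> 0")
      case True then show ?thesis using per[of t0 "nat z"] z by simp
    next
      case False then show ?thesis using per[of t "nat (- z)"] z by simp
    qed
  qed
  define h where "h t = (if int Q dvd t - t0 then d else 0)" for t
  have hper: "h (t + int Q) = h t" for t
  proof -
    have "int Q dvd t + int Q - t0 \<longleftrightarrow> int Q dvd t - t0" by (metis add_diff_eq add.commute dvd_add_triv_left_iff)
    then show ?thesis by (simp add: h_def)
  qed
  from periodic_mean[where g = h, OF Q(1) hper]
  have h: "(\<lambda>N. (\<Sum>n<N. h (1 + int n)) / real N) \<longlonglongrightarrow> (\<Sum>n<Q. h (1 + int n)) / real Q" .
  have hf: "h t \<le> f t" for t
  proof (cases "int Q dvd t - t0")
    case True
    have "d \<le> f t" using gc[OF True] Q(3)[of t] Q(3)[of t0] pos unfolding d_def by linarith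
    then show ?thesis using True by (simp add: h_def)
  qed (use nonneg in \<open>simp add: h_def\<close>)
  have "(\<Sum>n<Q. h (1 + int n)) / real Q \<le> c"
  proof (rule LIMSEQ_le[OF h c])
    show "\<exists>N. \<forall>n\<ge>N. (\<Sum>n<n. h (1 + int n)) / real n \<le> (\<Sum>n<n. f (1 + int n)) / real n"
      using hf by (intro exI[of _ 0] allI impI divide_right_mono sum_mono) auto
  qed
  moreover have "(\<Sum>n<Q. h (1 + int n)) > 0"
  proof (rule sum_pos2)
    let ?n = "nat ((t0 - 1) mod int Q)"
    show "?n \<in> {..<Q}" using Q(1) by (simp add: nat_less_iff)
    have "int ?n = (t0 - 1) mod int Q" using Q(1) by simp
    then have "[1 + int ?n = 1 + (t0 - 1)] (mod int Q)" by (intro cong_add cong_refl) (simp add: cong_def)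
    then have "int Q dvd 1 + int ?n - t0" by (simp add: cong_iff_dvd_diff)
    then show "0 < h (1 + int ?n)" using d by (simp add: h_def)
  qed (use d in \<open>auto simp: h_def\<close>)
  ultimately show ?thesis using Q(1) by (smt (verit) divide_pos_pos of_nat_0_less_iff)
qed

lemma mean_floor_tendsto:
  fixes f :: "int \<Rightarrow> real"
  assumes "(\<lambda>N. (\<Sum>n<N. f (1 + int n)) / real N) \<longlonglongrightarrow> c"
  shows "((\<lambda>T :: real. (\<Sum>t=1..\<lfloor>T\<rfloor>. f t) / T) \<longlongrightarrow> c) at_top"
proof -
  have 1: "filterlim (\<lambda>T :: real. nat \<lfloor>T\<rfloor>) sequentially at_top"
    by (rule filterlim_compose[OF filterlim_nat_sequentially filterlim_floor_sequentially])
  have "((\<lambda>T :: real. real_of_int \<lfloor>T\<rfloor> / T) \<longlongrightarrow> 1) at_top"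
  proof (rule real_tendsto_sandwich)
    show "\<forall>\<^sub>F T in at_top. 1 - 1 / T \<le> real_of_int \<lfloor>T\<rfloor> / T"
      using eventually_gt_at_top[of 0] by eventually_elim (simp add: field_simps, linarith)
    show "\<forall>\<^sub>F T :: real in at_top. real_of_int \<lfloor>T\<rfloor> / T \<le> 1"
      using eventually_gt_at_top[of 0] by eventually_elim (simp add: field_simps)
    have "((\<lambda>T :: real. 1 / T) \<longlongrightarrow> 0) at_top" by (rule tendsto_divide_0[OF tendsto_const]) (simp add: filterlim_at_top_imp_at_infinity filterlim_ident)
    then have "((\<lambda>T :: real. 1 - 1 / T) \<longlongrightarrow> 1 - 0) at_top" by (intro tendsto_diff tendsto_const)
    then show "((\<lambda>T :: real. 1 - 1 / T) \<longlongrightarrow> 1) at_top" by simp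
  qed (rule tendsto_const)
  then have 2: "((\<lambda>T :: real. (\<Sum>n<nat \<lfloor>T\<rfloor>. f (1 + int n)) / real (nat \<lfloor>T\<rfloor>) * (real_of_int \<lfloor>T\<rfloor> / T)) \<longlongrightarrow> c * 1) at_top"
    by (intro tendsto_mult filterlim_compose[OF assms 1])
  have "\<forall>\<^sub>F T in at_top. (\<Sum>n<nat \<lfloor>T\<rfloor>. f (1 + int n)) / real (nat \<lfloor>T\<rfloor>) * (real_of_int \<lfloor>T\<rfloor> / T) = (\<Sum>t=1..\<lfloor>T\<rfloor>. f t) / T"
    using eventually_ge_at_top[of 1]
  proof eventually_elim
    case (elim T)
    have "(\<Sum>n<nat \<lfloor>T\<rfloor>. f (1 + int n)) = (\<Sum>t=1..\<lfloor>T\<rfloor>. f t)"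
      by (rule sum.reindex_bij_witness[of _ "\<lambda>t. nat (t - 1)" "\<lambda>n. 1 + int n"]) (use elim in auto)
    moreover have "\<lfloor>T\<rfloor> \<ge> 1" using elim by simp
    ultimately show ?case by (simp add: field_simps)
  qed
  then show ?thesis using 2 by (simp add: tendsto_cong)
qed

text \<open>Partial sums of the series are periodic and converge uniformly in t, and squaring
  preserves this for bounded functions. For positivity it is enough that the real number
  \<open>m\<close> is missed at one argument.\<close>

lemma mean_square_limit_periodic_series:
  fixes A :: "int \<Rightarrow> nat \<Rightarrow> complex"
  assumes bound: "\<And>t n. norm (A t n) \<le> b n" and b: "summable b"
    and per: "\<And>t t' n. [t = t'] (mod int (Suc n)) \<Longrightarrow> A t n = A t' n"
    and real: "\<And>t n. cnj (A t n) = A t n" "cnj m = m"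
    and nonconst: "(\<Sum>n. A t0 n) \<noteq> m"
  shows "\<exists>c :: real. c > 0 \<and> ((\<lambda>T :: real. (\<Sum>t=1..\<lfloor>T\<rfloor>. ((\<Sum>n. A t n) - m) ^ 2) / of_real T) \<longlongrightarrow> of_real c) at_top"
proof -
  have smA: "summable (\<lambda>n. norm (A t n))" for t
    by (rule summable_comparison_test'[OF b]) (use bound in auto)
  have smA': "summable (A t)" for t by (rule summable_norm_cancel[OF smA])
  define G where "G t = (\<Sum>n. A t n)" for t
  have G: "A t sums G t" for t unfolding G_def by (rule summable_sums[OF smA'])
  have "cnj (G t) = G t" for t
    using G[of t] sums_cnj[of "A t" "G t"] by (simp add: real(1)) (metis sums_unique2)
  then have ImG: "Im (G t - m) = 0" for t using real(2) by (metis Im_complex_of_real Reals_cnj_iff complex_is_Real_iff minus_complex.sel(2) diff_self)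
  define f where "f t = (Re (G t - m)) ^ 2" for t
  have Gf: "(G t - m) ^ 2 = of_real (f t)" for t
    using ImG[of t] by (simp add: f_def complex_eq_iff power2_eq_square)
  have b0: "b n \<ge> 0" for n using order.trans[OF norm_ge_zero bound] .
  \<comment> \<open>Bounds the second factor of the difference of two squares; the summand 1 makes K
    positive.\<close>
  define K where "K = 2 * (suminf b + norm m) + 1"
  have K: "K > 0" using suminf_nonneg[OF b] b0 by (simp add: K_def add_nonneg_pos)
  have part: "norm (\<Sum>n<N. A t n) \<le> suminf b" for t N
  proof -
    have "norm (\<Sum>n<N. A t n) \<le> (\<Sum>n<N. b n)" by (rule sum_norm_le) (rule bound)
    also have "\<dots> \<le> suminf b" by (rule sum_le_suminf[OF b]) (use b0 in auto)
    finally show ?thesis .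
  qed
  have full: "norm (G t) \<le> suminf b" for t unfolding G_def by (rule norm_suminf_le[OF bound b])
  have approx: "\<exists>Q g. Q > 0 \<and> (\<forall>t. g (t + int Q) = g t) \<and> (\<forall>t. \<bar>f t - g t\<bar> \<le> e)" if e: "e > 0" for e
  proof -
    obtain N where N: "norm (\<Sum>n. b (n + N)) < e / K"
      using suminf_exist_split[OF _ b, of "e / K"] e K by auto
    define g where "g t = (Re ((\<Sum>n<N. A t n) - m)) ^ 2" for t
    \<comment> \<open>N! is a common period of the first N terms, which have the periods 1, ...,
      N.\<close>
    define Q where "Q = (fact N :: nat)"
    have "g (t + int Q) = g t" for t
    proof -
      have "A (t + int Q) n = A t n" if "n < N" for n
      proof (rule per)
        have "Suc n dvd Q" unfolding Q_def by (rule dvd_fact) (use that in auto)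
        then have "int (Suc n) dvd int Q" by (simp only: int_dvd_int_iff)
        then show "[t + int Q = t] (mod int (Suc n))" by (simp add: cong_iff_dvd_diff)
      qed
      then show ?thesis by (simp add: g_def)
    qed
    moreover have "\<bar>f t - g t\<bar> \<le> e" for t
    proof -
      let ?P = "\<Sum>n<N. A t n"
      have "G t - ?P = (\<Sum>n. A t (n + N))"
        unfolding G_def using suminf_minus_initial_segment[OF smA', of t N] by simp
      then have "norm (G t - ?P) \<le> (\<Sum>n. b (n + N))"
        using norm_suminf_le[of "\<lambda>n. A t (n + N)" "\<lambda>n. b (n + N)"] bound summable_ignore_initial_segment[OF b] by simp
      then have d: "norm (G t - ?P) \<le> e / K" using N by simp
      have "f t - g t = (Re (G t - m) - Re (?P - m)) * (Re (G t - m) + Re (?P - m))"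
        by (simp add: f_def g_def power2_eq_square algebra_simps)
      then have "\<bar>f t - g t\<bar> = \<bar>Re (G t - ?P)\<bar> * \<bar>Re (G t - m) + Re (?P - m)\<bar>" by (simp add: abs_mult)
      also have "\<dots> \<le> (e / K) * K"
      proof (rule mult_mono)
        show "\<bar>Re (G t - ?P)\<bar> \<le> e / K" using abs_Re_le_cmod[of "G t - ?P"] d by linarith
        have 1: "\<bar>Re (G t - m)\<bar> \<le> norm (G t) + norm m" by (rule order.trans[OF abs_Re_le_cmod norm_triangle_ineq4])
        have 2: "\<bar>Re (?P - m)\<bar> \<le> norm ?P + norm m" by (rule order.trans[OF abs_Re_le_cmod norm_triangle_ineq4])
        have "\<bar>a + b'\<bar> \<le> 2 * (x + y) + 1" if "\<bar>a\<bar> \<le> u + y" "\<bar>b'\<bar> \<le> v + y" "u \<le> x" "v \<le> x" for a b' u v x y :: real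
        proof -
          have "\<bar>a + b'\<bar> \<le> \<bar>a\<bar> + \<bar>b'\<bar>" by (rule abs_triangle_ineq)
          also have "\<dots> \<le> (u + y) + (v + y)" by (intro add_mono that)
          also have "\<dots> \<le> (x + y) + (x + y)" by (intro add_mono that order_refl)
          finally show ?thesis by simp
        qed
        from this[OF 1 2 full part] show "\<bar>Re (G t - m) + Re (?P - m)\<bar> \<le> K" unfolding K_def .
      qed (use e K in auto)
      finally show ?thesis using K by simp
    qed
    moreover have "Q > 0" by (simp add: Q_def)
    ultimately show ?thesis by blast
  qed
  obtain c where c: "(\<lambda>N. (\<Sum>n<N. f (1 + int n)) / real N) \<longlonglongrightarrow> c" using limit_periodic_mean[OF approx] by blast
  have "f t0 > 0"
  proof -
    have "Re (G t0 - m) \<noteq> 0" using nonconst ImG[of t0] by (auto simp: G_def complex_eq_iff)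
    then show ?thesis by (simp add: f_def)
  qed
  then have "c > 0" using limit_periodic_mean_pos[OF approx _ _ c] by (simp add: f_def)
  moreover have "((\<lambda>T :: real. (\<Sum>t=1..\<lfloor>T\<rfloor>. ((\<Sum>n. A t n) - m) ^ 2) / of_real T) \<longlongrightarrow> complex_of_real c) at_top"
    using tendsto_of_real[OF mean_floor_tendsto[OF c], where 'a = complex]
    by (simp add: G_def[symmetric] Gf)
  ultimately show ?thesis by blast
qed

subsection \<open>The singular series\<close>

text \<open>A prime divisor of a value of \<open>h 1\<close> is chosen away from all Bezout
  constants, so that at \<open>t0\<close> the derivative of \<open>h 1\<close> and the other
  polynomials are units modulo p. Lifting then gives arguments in the class of \<open>t0\<close> at
  which p divides \<open>h 1\<close> to the exact orders 1 and k + 1.\<close>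

lemma local_density_varies_poly:
  fixes h :: "nat \<Rightarrow> int poly"
  assumes k: "k \<ge> 3" and s: "s \<ge> 2 ^ k + 1 \<or> int s \<ge> 2 * int k ^ 2 - 2"
    and deg: "degree (h 1) > 0" and irr: "irreducible (map_poly of_int (h 1) :: rat poly)"
    and cop: "\<And>i. i \<in> {2..s} \<Longrightarrow> coprime (map_poly of_int (h 1) :: rat poly) (map_poly of_int (h i))"
    and nz: "\<And>x. poly (h 1) x \<noteq> 0"
  shows "\<exists>p t t'. prime p \<and> padic_density k s (\<lambda>i. poly (h i) t) p \<noteq> padic_density k s (\<lambda>i. poly (h i) t') p"
proof -
  obtain R0 u0 v0 where R0: "R0 > 0" "\<And>t. poly u0 t * poly (h 1) t + poly v0 t * poly (pderiv (h 1)) t = R0"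
    using coprime_imp_int_bezout[OF irreducible_imp_coprime_pderiv[OF irr deg]] by blast
  have "\<exists>R u v. R > 0 \<and> (\<forall>t. poly u t * poly (h 1) t + poly v t * poly (h i) t = R)" if "i \<in> {2..s}" for i
    using coprime_imp_int_bezout[OF cop[OF that]] by metis
  then obtain R u v where R: "\<And>i. i \<in> {2..s} \<Longrightarrow> R i > 0"
    "\<And>i t. i \<in> {2..s} \<Longrightarrow> poly (u i) t * poly (h 1) t + poly (v i) t * poly (h i) t = R i" by metis
  \<comment> \<open>The factors exclude, in turn, p dividing k, a multiple zero of
    \<open>h 1\<close> modulo p at \<open>t0\<close>, and a common zero of \<open>h 1\<close> with
    another \<open>h i\<close> there.\<close>
  define M where "M = int k * R0 * (\<Prod>i\<in>{2..s}. R i)"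
  have "M > 0" unfolding M_def using k R0(1) R(1) by (intro mult_pos_pos prod_pos) auto
  then obtain p t0 where p: "prime p" "\<not> int p dvd M" "int p dvd poly (h 1) t0"
    using poly_prime_divisor_coprime[OF deg nz] by blast
  have pp: "prime (int p)" "int p > 0" using p(1) by (auto simp: prime_gt_0_nat)
  have pk: "\<not> p dvd k" using p(2) by (auto simp: M_def)
  have pR0: "\<not> int p dvd R0" using p(2) by (auto simp: M_def)
  have pR: "\<not> int p dvd R i" if "i \<in> {2..s}" for i
    using p(2) dvd_trans[OF _ dvd_prodI[OF _ that, of R]] by (auto simp: M_def)
  have hd: "\<not> int p dvd poly (pderiv (h 1)) t0"
  proof
    assume "int p dvd poly (pderiv (h 1)) t0"
    then have "int p dvd poly u0 t0 * poly (h 1) t0 + poly v0 t0 * poly (pderiv (h 1)) t0"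
      using p(3) by (intro dvd_add dvd_mult)
    then show False using R0(2) pR0 by simp
  qed
  have hi: "\<not> int p dvd poly (h i) t0" if "i \<in> {2..s}" for i
  proof
    assume "int p dvd poly (h i) t0"
    then have "int p dvd poly (u i) t0 * poly (h 1) t0 + poly (v i) t0 * poly (h i) t0"
      using p(3) by (intro dvd_add dvd_mult)
    then show False using R(2)[OF that] pR[OF that] by simp
  qed
  have lift: "\<exists>t w. [t = t0] (mod int p) \<and> poly (h 1) t = int p ^ Suc j * w \<and> \<not> int p dvd w" for j
  proof -
    \<comment> \<open>Prescribing the value p^(j+1) modulo p^(j+2) fixes the exact power of
      p.\<close>
    obtain t where t: "[t = t0] (mod int p)" "[poly (h 1) t = int p ^ Suc j] (mod int p ^ Suc (Suc j))"
      using poly_hensel[OF p(1) p(3) hd, of "int p ^ Suc j" "Suc j"] by auto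
    have "int p ^ Suc (Suc j) dvd poly (h 1) t - int p ^ Suc j" using t(2) by (simp add: cong_iff_dvd_diff)
    then obtain r where "poly (h 1) t - int p ^ Suc j = int p ^ Suc (Suc j) * r" by (elim dvdE)
    then have r: "poly (h 1) t = int p ^ Suc j * (1 + int p * r)" by (simp add: algebra_simps)
    have "\<not> int p dvd 1 + int p * r"
    proof
      assume "int p dvd 1 + int p * r"
      then have "int p dvd 1" by (simp add: dvd_add_left_iff)
      then show False using pp(1) by simp
    qed
    then show ?thesis using t(1) r by blast
  qed
  obtain t w where t: "[t = t0] (mod int p)" "poly (h 1) t = int p ^ Suc 0 * w" "\<not> int p dvd w" using lift[of 0] by blast
  obtain t' w' where t': "[t' = t0] (mod int p)" "poly (h 1) t' = int p ^ Suc k * w'" "\<not> int p dvd w'" using lift[of k] by blast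
  have "padic_density k s (\<lambda>i. poly (h i) t) p \<noteq> padic_density k s (\<lambda>i. poly (h i) t') p"
  proof (rule local_density_varies[OF p(1) k pk s])
    show "poly (h 1) t = int p * w" using t(2) by simp
    show "\<not> int p dvd w" by (rule t(3))
    show "poly (h 1) t' = int p ^ (k + 1) * w'" using t'(2) by simp
    show "\<not> int p dvd w'" by (rule t'(3))
    fix i assume i: "i \<in> {2..s}"
    show "\<not> int p dvd poly (h i) t" using hi[OF i] poly_cong_int[OF t(1), of "h i"] by (simp add: cong_dvd_iff)
    show "[poly (h i) t = poly (h i) t'] (mod int p)"
      by (rule poly_cong_int) (use t(1) t'(1) cong_sym cong_trans in blast)
  qed
  then show ?thesis using p(1) by blast
qed

context
  fixes k d s :: nat and h :: "nat \<Rightarrow> int poly"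
  assumes k: "k \<ge> 3" and d: "d > 1"
    and deg: "\<And>i. i \<in> {1..s} \<Longrightarrow> degree (h i) = d"
    and irr: "\<And>i. i \<in> {1..s} \<Longrightarrow> irreducible (map_poly of_int (h i) :: rat poly)"
    and cop: "\<And>i j. i \<in> {1..s} \<Longrightarrow> j \<in> {1..s} \<Longrightarrow> i \<noteq> j \<Longrightarrow>
           coprime (map_poly of_int (h i) :: rat poly) (map_poly of_int (h j))"
    and nz: "\<And>i x. i \<in> {1..s} \<Longrightarrow> poly (h i) (x :: int) \<noteq> 0"
    and s: "s \<ge> 2 ^ k + 1 \<or> int s \<ge> 2 * int k ^ 2 - 2"
begin

abbreviation "poly_sterm t \<equiv> sterm k s (\<lambda>i. poly (h i) t)"

lemma s_ge: "s \<ge> 3 * k"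
  by (rule diagonal_size_bounds(6)[OF k s])

lemma poly_sterm_bound:
  obtains C where "C \<ge> 0" "\<And>t q. norm (poly_sterm t q) \<le> C * real q powr (- 5/3)"
proof -
  have "\<exists>R>0. \<forall>t. gcd (poly (h i) t) (poly (h j) t) dvd R" if ij: "i \<in> {1..s}" "j \<in> {1..s}" "i \<noteq> j" for i j
  proof -
    obtain R u v where R: "R > 0" "\<And>t. poly u t * poly (h i) t + poly v t * poly (h j) t = R"
      using coprime_imp_int_bezout[OF cop[OF ij]] by blast
    have "gcd (poly (h i) t) (poly (h j) t) dvd R" for t
    proof -
      have "gcd (poly (h i) t) (poly (h j) t) dvd poly u t * poly (h i) t + poly v t * poly (h j) t"
        by (intro dvd_add dvd_mult) auto
      then show ?thesis by (simp only: R(2))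
    qed
    then show ?thesis using R(1) by blast
  qed
  then obtain R where R: "\<And>i j. i \<in> {1..s} \<Longrightarrow> j \<in> {1..s} \<Longrightarrow> i \<noteq> j \<Longrightarrow> R i j > 0"
    "\<And>i j t. i \<in> {1..s} \<Longrightarrow> j \<in> {1..s} \<Longrightarrow> i \<noteq> j \<Longrightarrow> gcd (poly (h i) t) (poly (h j) t) dvd R i j"
    by metis
  define I where "I = {z \<in> {1..s} \<times> {1..s}. fst z \<noteq> snd z}"
  have finI: "finite I" unfolding I_def by simp
  define R' where "R' = (\<Prod>z\<in>I. R (fst z) (snd z))"
  have R': "R' > 0" unfolding R'_def by (rule prod_pos) (use R(1) in \<open>auto simp: I_def\<close>)
  have dvd: "gcd (poly (h i) t) (poly (h j) t) dvd R'" if ij: "i \<in> {1..s}" "j \<in> {1..s}" "i \<noteq> j" for i j t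
  proof -
    have "(i, j) \<in> I" using ij by (simp add: I_def)
    then have "R (fst (i, j)) (snd (i, j)) dvd R'" unfolding R'_def by (rule dvd_prodI[OF finI])
    then show ?thesis using R(2)[OF ij, of t] dvd_trans by auto
  qed
  obtain C where C: "C \<ge> 0" "\<And>c q. q > 0 \<Longrightarrow> (\<And>i j. i \<in> {1..s} \<Longrightarrow> j \<in> {1..s} \<Longrightarrow> i \<noteq> j \<Longrightarrow> gcd (c i) (c j) dvd R') \<Longrightarrow>
    norm (sterm k s c q) \<le> C * real q powr (- 5/3)"
    using sterm_bound[OF k s_ge R'] by blast
  have "norm (poly_sterm t q) \<le> C * real q powr (- 5/3)" for t q
    using C(2)[of q "\<lambda>i. poly (h i) t"] dvd by (cases "q = 0") auto
  then show ?thesis using that C(1) by blast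
qed

lemma poly_sterm_cong:
  assumes "q > 0" "[t = t'] (mod int q)"
  shows "poly_sterm t q = poly_sterm t' q"
  by (rule sterm_cong[OF assms(1)]) (rule poly_cong_int[OF assms(2)])

lemma poly_sterm_abs_summable: "(\<lambda>q. norm (poly_sterm t q)) summable_on UNIV"
  by (rule sterm_abs_summable[OF k s_ge]) (rule nz)

lemma singular_series_eq_infsum: "singular_series k s h t = infsum (poly_sterm t) (rough {})"
proof -
  have bij: "bij_betw Suc UNIV (rough {})"
    by (rule bij_betw_byWitness[of _ "\<lambda>n. n - 1"]) (auto simp: rough_def)
  have "(\<lambda>q. norm (poly_sterm t q)) summable_on rough {}"
    by (rule summable_on_subset_banach[OF poly_sterm_abs_summable]) simp
  then have "poly_sterm t summable_on rough {}" by (rule abs_summable_summable)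
  then have "(poly_sterm t has_sum infsum (poly_sterm t) (rough {})) (rough {})" by (rule has_sum_infsum)
  then have "((\<lambda>n. poly_sterm t (Suc n)) has_sum infsum (poly_sterm t) (rough {})) UNIV"
    using has_sum_reindex_bij_betw[OF bij, of "poly_sterm t"] by simp
  then have "(\<lambda>n. poly_sterm t (Suc n)) sums infsum (poly_sterm t) (rough {})" by (rule has_sum_imp_sums)
  then show ?thesis
    unfolding singular_series_def by (simp add: singular_series_term_eq sums_unique[symmetric])
qed

lemma singular_series_factor:
  assumes "prime p"
  shows "singular_series k s h t = padic_density k s (\<lambda>i. poly (h i) t) p * infsum (poly_sterm t) (rough {p})"
  unfolding singular_series_eq_infsum padic_density_def
  by (rule euler_step[OF _ poly_sterm_abs_summable assms]) (use k sterm_mult in auto)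

text \<open>The mixed argument, \<open>t2\<close> at p and \<open>t1\<close> elsewhere, is reached
  only in the limit: \<open>\<tau> N\<close> imitates it to growing precision, and the uniform bound
  for the terms lets Tannery's theorem pass to the limit in both factors. A constant series would
  make the mixed product equal to the product for \<open>t1\<close>, and cancelling the nonzero
  factor away from p would make the two densities equal.\<close>

lemma singular_series_not_constant: "\<exists>t. singular_series k s h t \<noteq> m"
proof (rule ccontr)
  assume "\<not> ?thesis"
  then have const: "singular_series k s h t = m" for t by blast
  have s1: "1 \<in> {1..s}" using s_ge k by simp
  have deg1: "degree (h 1) > 0" using deg[OF s1] d by simp
  have cop1: "coprime (map_poly of_int (h 1) :: rat poly) (map_poly of_int (h i))" if "i \<in> {2..s}" for i
    by (rule cop[OF s1]) (use that in auto)
  obtain p t1 t2 where p: "prime p" and neq: "padic_density k s (\<lambda>i. poly (h i) t1) p \<noteq> padic_density k s (\<lambda>i. poly (h i) t2) p"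
    using local_density_varies_poly[where h = h, OF k s deg1 irr[OF s1] cop1 nz[OF s1]] by blast
  have p1: "p > 1" using prime_gt_1_nat[OF p] .
  let ?X = "\<lambda>t. padic_density k s (\<lambda>i. poly (h i) t) p"
  let ?r = "\<lambda>t. infsum (poly_sterm t) (rough {p})"
  obtain C where C: "C \<ge> 0" "\<And>t q. norm (poly_sterm t q) \<le> C * real q powr (- 5/3)" using poly_sterm_bound by blast
  \<comment> \<open>A multiple of every q \<le> N that is prime to p, and itself prime to p, so that
    the two congruences for \<open>\<tau> N\<close> are compatible.\<close>
  define Q where "Q N = (\<Prod>q\<in>{q\<in>{1..N}. \<not> p dvd q}. q)" for N
  have copQ: "coprime (int p ^ N) (int (Q N))" for N
  proof -
    have "coprime p (Q N)" unfolding Q_def by (rule prod_coprime_right) (use p prime_imp_coprime in auto)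
    then have "coprime (int p) (int (Q N))" by simp
    then show ?thesis by (rule coprime_power_left_iff[THEN iffD2, OF disjI1])
  qed
  have "\<exists>t. [t = t2] (mod int p ^ N) \<and> [t = t1] (mod int (Q N))" for N
    using binary_chinese_remainder_int[OF copQ] by blast
  then obtain \<tau> where \<tau>: "\<And>N. [\<tau> N = t2] (mod int p ^ N)" "\<And>N. [\<tau> N = t1] (mod int (Q N))" by metis
  have X: "?X t = (\<Sum>j. poly_sterm t (p ^ j))" for t
    using padic_density_sums(1)[OF k s_ge _ p, of "\<lambda>i. poly (h i) t"] nz by (simp add: sums_unique)
  have "(\<lambda>N. ?X (\<tau> N)) \<longlonglongrightarrow> ?X t2"
  proof -
    have lim: "(\<lambda>N. poly_sterm (\<tau> N) (p ^ j)) \<longlonglongrightarrow> poly_sterm t2 (p ^ j)" for j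
    proof (rule tendsto_eventually)
      show "\<forall>\<^sub>F N in sequentially. poly_sterm (\<tau> N) (p ^ j) = poly_sterm t2 (p ^ j)"
        using eventually_ge_at_top[of j]
      proof eventually_elim
        case (elim N)
        then have "int (p ^ j) dvd int p ^ N" by (simp add: le_imp_power_dvd)
        then have "[\<tau> N = t2] (mod int (p ^ j))" using \<tau>(1) cong_dvd_modulus by blast
        then show ?case using p1 by (intro poly_sterm_cong) auto
      qed
    qed
    have "summable (\<lambda>j. C * real (p ^ j) powr (- 5/3))"
    proof -
      have "summable (\<lambda>j. C * (real p powr (- 5/3)) ^ j)"
      proof (intro summable_mult summable_geometric)
        have "real p powr (- 5/3) < real p powr 0" using p1 by (intro powr_less_mono) auto
        then show "norm (real p powr (- 5/3)) < 1" using p1 by simp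
      qed
      moreover have "(real p powr (- 5/3)) ^ j = real (p ^ j) powr (- 5/3)" for j
        using p1 by (simp add: powr_powr powr_realpow[symmetric] mult.commute)
      ultimately show ?thesis by (simp only:)
    qed
    moreover have "\<forall>\<^sub>F (j, N) in at_top \<times>\<^sub>F sequentially. norm (poly_sterm (\<tau> N) (p ^ j)) \<le> C * real (p ^ j) powr (- 5/3)"
      using C(2) by (intro always_eventually) (auto simp del: of_nat_power)
    ultimately have "(\<lambda>N. \<Sum>j. poly_sterm (\<tau> N) (p ^ j)) \<longlonglongrightarrow> (\<Sum>j. poly_sterm t2 (p ^ j))"
      using tannerys_theorem[of "\<lambda>j N. poly_sterm (\<tau> N) (p ^ j)" "\<lambda>j. poly_sterm t2 (p ^ j)" sequentially "\<lambda>j. C * real (p ^ j) powr (- 5/3)", OF lim]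
      by simp
    then show ?thesis by (simp only: X)
  qed
  moreover have "(\<lambda>N. ?r (\<tau> N)) \<longlonglongrightarrow> ?r t1"
  proof -
    \<comment> \<open>Extension by zero turns the sum over integers prime to p into a series over
      all indices, as Tannery's theorem requires.\<close>
    define B where "B t q = (if q \<in> rough {p} then poly_sterm t q else 0)" for t q
    have Bn: "norm (B t q) \<le> C * real q powr (- 5/3)" for t q using C by (simp add: B_def)
    have r: "?r t = (\<Sum>q. B t q)" for t
    proof -
      have "summable (\<lambda>q. norm (B t q))"
        by (rule summable_comparison_test'[OF summable_bound_powr[of C]]) (use Bn in auto)
      then have "(B t has_sum (\<Sum>q. B t q)) UNIV"
        by (intro norm_summable_imp_has_sum summable_sums) (auto intro: summable_norm_cancel)
      then have "infsum (B t) UNIV = (\<Sum>q. B t q)" by (rule infsumI)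
      moreover have "infsum (B t) UNIV = ?r t" by (rule infsum_cong_neutral) (auto simp: B_def)
      ultimately show ?thesis by simp
    qed
    have lim: "(\<lambda>N. B (\<tau> N) q) \<longlonglongrightarrow> B t1 q" for q
    proof (rule tendsto_eventually)
      show "\<forall>\<^sub>F N in sequentially. B (\<tau> N) q = B t1 q"
        using eventually_ge_at_top[of q]
      proof eventually_elim
        case (elim N)
        show ?case
        proof (cases "q \<in> rough {p}")
          case True
          then have "q \<in> {q\<in>{1..N}. \<not> p dvd q}" using elim by (simp add: rough_def)
          then have "q dvd Q N" unfolding Q_def by (intro dvd_prodI) auto
          then have "int q dvd int (Q N)" by simp
          then have "[\<tau> N = t1] (mod int q)" using \<tau>(2) cong_dvd_modulus by blast
          then have "poly_sterm (\<tau> N) q = poly_sterm t1 q" using True by (intro poly_sterm_cong) (auto simp: rough_def)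
          then show ?thesis by (simp add: B_def)
        qed (simp add: B_def)
      qed
    qed
    have "\<forall>\<^sub>F (q, N) in at_top \<times>\<^sub>F sequentially. norm (B (\<tau> N) q) \<le> C * real q powr (- 5/3)"
      using Bn by (intro always_eventually) auto
    then have "(\<lambda>N. \<Sum>q. B (\<tau> N) q) \<longlonglongrightarrow> (\<Sum>q. B t1 q)"
      using tannerys_theorem[of "\<lambda>q N. B (\<tau> N) q" "B t1" sequentially "\<lambda>q. C * real q powr (- 5/3)", OF lim _ summable_bound_powr]
      by simp
    then show ?thesis by (simp only: r)
  qed
  ultimately have "(\<lambda>N. ?X (\<tau> N) * ?r (\<tau> N)) \<longlonglongrightarrow> ?X t2 * ?r t1" by (rule tendsto_mult)
  then have "(\<lambda>N. m) \<longlonglongrightarrow> ?X t2 * ?r t1" by (simp only: singular_series_factor[OF p, symmetric] const)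
  then have "m = ?X t2 * ?r t1" using LIMSEQ_unique tendsto_const by blast
  moreover have "m = ?X t1 * ?r t1" by (simp only: singular_series_factor[OF p, symmetric] const)
  moreover have "?r t1 \<noteq> 0"
    by (rule sterm_infsum_rough_nonzero[OF k s]) (use nz p in auto)
  ultimately show False using neq by simp
qed

text \<open>Each term of the mean series is the average of the corresponding term over a full period
  in t, so it inherits the bound for single arguments.\<close>

lemma mean_series_term_eq: "mean_series_term k s h q = (\<Sum>t=1..int q. poly_sterm t q) / of_nat q"
proof (cases "q = 0")
  case False
  have "(\<Sum>t=1..int q. poly_sterm t q) = (\<Sum>t=1..int q. coprime_sum k s h t q) / of_nat q ^ s"
    unfolding sum_divide_distrib
    by (intro sum.cong refl) (use False in \<open>simp add: singular_series_term_eq[symmetric] singular_series_term_def\<close>)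
  then show ?thesis by (simp add: mean_series_term_def)
qed (simp add: mean_series_term_def)

lemma singular_series_mean_square:
  "(\<forall>t\<ge>1. summable (\<lambda>n. singular_series_term k s h t (Suc n))) \<and>
   summable (\<lambda>n. mean_series_term k s h (Suc n)) \<and>
   (\<exists>c :: real. c > 0 \<and>
     ((\<lambda>T :: real. (\<Sum>t=1..\<lfloor>T\<rfloor>. (singular_series k s h t - mean_series k s h) ^ 2) / of_real T)
       \<longlongrightarrow> of_real c) at_top)"
proof -
  obtain C where C: "C \<ge> 0" "\<And>t q. norm (poly_sterm t q) \<le> C * real q powr (- 5/3)" using poly_sterm_bound by blast
  define b where "b n = C * real (Suc n) powr (- 5/3)" for n
  have b: "summable b" unfolding b_def using summable_bound_powr[of C] by (subst summable_Suc_iff)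
  have Ab: "norm (poly_sterm t (Suc n)) \<le> b n" for t n unfolding b_def by (rule C(2))
  have sst: "singular_series_term k s h t (Suc n) = poly_sterm t (Suc n)" for t n
    by (rule singular_series_term_eq) simp
  have ss: "summable (\<lambda>n. singular_series_term k s h t (Suc n))" for t
    unfolding sst by (rule summable_comparison_test'[OF b]) (use Ab in auto)
  have mb: "norm (mean_series_term k s h (Suc n)) \<le> b n" for n
  proof -
    have "norm (\<Sum>t=1..int (Suc n). poly_sterm t (Suc n)) \<le> (\<Sum>t=1..int (Suc n). b n)" by (rule sum_norm_le) (rule Ab)
    also have "\<dots> = real (Suc n) * b n" by simp
    finally have "norm (\<Sum>t=1..int (Suc n). poly_sterm t (Suc n)) / real (Suc n) \<le> real (Suc n) * b n / real (Suc n)"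
      by (rule divide_right_mono) simp
    then show ?thesis unfolding mean_series_term_eq norm_divide norm_of_nat by simp
  qed
  have ms: "summable (\<lambda>n. mean_series_term k s h (Suc n))"
    by (rule summable_comparison_test'[OF b]) (use mb in auto)
  have realA: "cnj (poly_sterm t (Suc n)) = poly_sterm t (Suc n)" for t n by (rule cnj_sterm) simp
  have realm: "cnj (mean_series k s h) = mean_series k s h"
  proof -
    have "(\<lambda>n. mean_series_term k s h (Suc n)) sums mean_series k s h"
      unfolding mean_series_def by (rule summable_sums[OF ms])
    moreover from this have "(\<lambda>n. cnj (mean_series_term k s h (Suc n))) sums cnj (mean_series k s h)"
      by (simp only: sums_cnj)
    moreover have "cnj (mean_series_term k s h (Suc n)) = mean_series_term k s h (Suc n)" for n
      unfolding mean_series_term_eq by (simp only: complex_cnj_divide cnj_sum realA complex_cnj_of_nat)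
    ultimately show ?thesis using sums_unique2 by simp
  qed
  have series: "singular_series k s h t = (\<Sum>n. poly_sterm t (Suc n))" for t
    unfolding singular_series_def sst ..
  obtain t0 where "singular_series k s h t0 \<noteq> mean_series k s h" using singular_series_not_constant by blast
  then have "\<exists>c :: real. c > 0 \<and> ((\<lambda>T :: real. (\<Sum>t=1..\<lfloor>T\<rfloor>. ((\<Sum>n. poly_sterm t (Suc n)) - mean_series k s h) ^ 2) / of_real T) \<longlongrightarrow> of_real c) at_top"
    unfolding series
    by (intro mean_square_limit_periodic_series[OF Ab b _ realA realm] poly_sterm_cong) auto
  then show ?thesis using ss ms unfolding series by blast
qed

end

theorem theorem1p4:
  fixes k d s :: nat and h :: "nat \<Rightarrow> int poly"
  assumes "k \<ge> 3" and "d > 1"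
    and "\<And>i. i \<in> {1..s} \<Longrightarrow> degree (h i) = d"
    and "\<And>i. i \<in> {1..s} \<Longrightarrow> irreducible (map_poly of_int (h i) :: rat poly)"
    and "\<And>i j. i \<in> {1..s} \<Longrightarrow> j \<in> {1..s} \<Longrightarrow> i \<noteq> j \<Longrightarrow>
           coprime (map_poly of_int (h i) :: rat poly) (map_poly of_int (h j))"
    and "\<And>i x. i \<in> {1..s} \<Longrightarrow> poly (h i) (x :: int) \<noteq> 0"
    and "even k \<Longrightarrow>
           \<not> (\<forall>i\<in>{1..s}. \<forall>j\<in>{1..s}. sgn (lead_coeff (h i)) = sgn (lead_coeff (h j)))"
    and "s \<ge> 2 ^ k + 1 \<or> int s \<ge> 2 * int k ^ 2 - 2"
  shows "(\<forall>t\<ge>1. summable (\<lambda>n. singular_series_term k s h t (Suc n))) \<and>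
         summable (\<lambda>n. mean_series_term k s h (Suc n)) \<and>
         (\<exists>c :: real. c > 0 \<and>
           ((\<lambda>T :: real. (\<Sum>t=1..\<lfloor>T\<rfloor>. (singular_series k s h t - mean_series k s h) ^ 2) / of_real T)
             \<longlongrightarrow> of_real c) at_top)"
  by (rule singular_series_mean_square[OF assms(1-6) assms(8)])

end
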